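(* Let $\alpha>0$ and let $\Theta=(\theta_k)_{k\ge1}$ be a sequence with $\theta_k\ge 0$ for all $k\geq 1$ and $\theta_k\sim k^\alpha$ as $k\to\infty$. Let $\mathbb{P}_\Theta$ be the associated weighted measure on the symmetric group $\mathfrak{S}_n$, and let $n^*$ and $\ell_n$ be the quantities defined in the context. Define for $y\ge0$ $$P_y^{(n)}:=\sum_{k\ge x_n}^{\infty} C_k\qquad\text{with}\qquad x_n=x_n(y):=n^*\bigl(\ell_n+\min\{-\log(y),\ell_n\}\bigr),$$ where $-\log(0):=+\infty$. Then the stochastic process $\{P_y^{(n)},\,y\ge0\}$ converges under $\mathbb{P}_\Theta$ as $n\to\infty$ weakly in $\mathcal{D}[0,\infty)$ to a Poisson process with parameter $1$, where $\mathcal{D}[0,\infty)$ denotes the space of càdlàg functions on $[0,\infty)$.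
   Context: $\mathfrak{S}_n$ is the group of permutations of $\{1,\dots,n\}$. For $\sigma\in\mathfrak{S}_n$, $C_k=C_k(\sigma)$ is the number of cycles of length $k$ in the cycle decomposition of $\sigma$ (fixed points are cycles of length $1$; $C_k=0$ for $k>n$), so $\sum_{k=1}^n kC_k=n$. Sums $\sum_{k\ge x}^\infty$ with real $x$ run over integers $k\ge1$ with $k\ge x$. The weighted measure is $\mathbb{P}_\Theta[\sigma]:=\frac{1}{h_n\, n!}\prod_{k=1}^n\theta_k^{C_k}$ for $\sigma\in\mathfrak{S}_n$, where $h_n=h_n(\Theta)$ is the normalization constant making this a probability measure (it is positive for all large $n$, since $\theta_k\sim k^\alpha$). For $n\ge 1$, $v_n>0$ is the unique solution of $\sum_{k=1}^\infty\theta_k e^{-kv_n}=n$. One has $v_n\to0$. Set $$n^*:=(v_n)^{-1},\qquad \ell_n:=\alpha\log(n^* )+(\alpha-1)\log\bigl(\alpha\log(n^* )\bigr),$$ the latter being defined for all $n$ large enough that $n^*>1$. $a_n\sim b_n$ means $a_n/b_n\to1$. $\mathcal{D}[0,\infty)$ carries the usual Skorokhod topology. *)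

theory Defs
  imports
    "HOL-Probability.Probability"
    "HOL-Combinatorics.Orbits"
    "HOL-Library.Landau_Symbols"
begin

subsection \<open>Weighted random permutations\<close>

definition cycle_count :: "nat \<Rightarrow> (nat \<Rightarrow> nat) \<Rightarrow> nat \<Rightarrow> nat" where
  "cycle_count n \<sigma> k = card {c \<in> orbit \<sigma> ` {1..n}. card c = k}"

definition perm_weight :: "(nat \<Rightarrow> real) \<Rightarrow> nat \<Rightarrow> (nat \<Rightarrow> nat) \<Rightarrow> real" where
  "perm_weight \<theta> n \<sigma> = (\<Prod>k=1..n. \<theta> k ^ cycle_count n \<sigma> k)"

definition norm_const :: "(nat \<Rightarrow> real) \<Rightarrow> nat \<Rightarrow> real" where
  "norm_const \<theta> n = (\<Sum>\<sigma> | \<sigma> permutes {1..n}. perm_weight \<theta> n \<sigma>) / fact n"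

text \<open>If the normalization constant vanishes (possible for finitely many \<open>n\<close> only, in the setting
  considered here), division by zero makes this the zero measure.\<close>

definition weighted_perm_measure :: "(nat \<Rightarrow> real) \<Rightarrow> nat \<Rightarrow> (nat \<Rightarrow> nat) measure" where
  "weighted_perm_measure \<theta> n =
     point_measure {\<sigma>. \<sigma> permutes {1..n}}
       (\<lambda>\<sigma>. ennreal (1 / (norm_const \<theta> n * fact n) * perm_weight \<theta> n \<sigma>))"

definition v_sol :: "(nat \<Rightarrow> real) \<Rightarrow> nat \<Rightarrow> real" where
  "v_sol \<theta> n =
     (THE v. v > 0 \<and> (\<lambda>k. \<theta> (Suc k) * exp (- (real (Suc k) * v))) sums real n)"

definition n_star :: "(nat \<Rightarrow> real) \<Rightarrow> nat \<Rightarrow> real" where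
  "n_star \<theta> n = inverse (v_sol \<theta> n)"

definition ell :: "real \<Rightarrow> (nat \<Rightarrow> real) \<Rightarrow> nat \<Rightarrow> real" where
  "ell \<alpha> \<theta> n = \<alpha> * ln (n_star \<theta> n) + (\<alpha> - 1) * ln (\<alpha> * ln (n_star \<theta> n))"

text \<open>The case \<open>y = 0\<close> is separate because the convention is \<open>- log 0 = \<infinity>\<close>, whereas \<open>ln 0 = 0\<close>
  in HOL.\<close>

definition x_thr :: "real \<Rightarrow> (nat \<Rightarrow> real) \<Rightarrow> nat \<Rightarrow> real \<Rightarrow> real" where
  "x_thr \<alpha> \<theta> n y =
     n_star \<theta> n *
       (ell \<alpha> \<theta> n + (if y = 0 then ell \<alpha> \<theta> n else min (- ln y) (ell \<alpha> \<theta> n)))"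

definition P_proc :: "real \<Rightarrow> (nat \<Rightarrow> real) \<Rightarrow> nat \<Rightarrow> (nat \<Rightarrow> nat) \<Rightarrow> real \<Rightarrow> real" where
  "P_proc \<alpha> \<theta> n \<sigma> =
     (\<lambda>y\<in>{0..}. \<Sum>\<^sub>\<infinity>k\<in>{k. 1 \<le> k \<and> x_thr \<alpha> \<theta> n y \<le> real k}. real (cycle_count n \<sigma> k))"


subsection \<open>The Skorokhod space of cadlag functions on the half line\<close>

text \<open>Functions on \<open>{0..}\<close> are represented extensionally, so that a path is determined by its
  values on the half line.\<close>

definition cadlag :: "(real \<Rightarrow> real) set" where
  "cadlag = {x \<in> extensional {0..}.
     (\<forall>t\<ge>0. continuous (at_right t) x) \<and> (\<forall>t>0. \<exists>l. (x \<longlongrightarrow> l) (at_left t))}"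

text \<open>A strictly increasing bijection of the half line is automatically continuous and fixes 0.\<close>

definition time_changes :: "(real \<Rightarrow> real) set" where
  "time_changes = {\<tau>. strict_mono_on {0..} \<tau> \<and> bij_betw \<tau> {0..} {0..}}"

definition skorokhod_converges :: "(nat \<Rightarrow> real \<Rightarrow> real) \<Rightarrow> (real \<Rightarrow> real) \<Rightarrow> bool" where
  "skorokhod_converges X x \<longleftrightarrow>
     (\<exists>\<Lambda>. (\<forall>n. \<Lambda> n \<in> time_changes) \<and>
          uniform_limit {0..} \<Lambda> (\<lambda>t. t) sequentially \<and>
          (\<forall>T\<ge>0. uniform_limit {0..T} (\<lambda>n t. X n (\<Lambda> n t)) x sequentially))"

text \<open>The Skorokhod (J1) topology is the metrizable topology on the cadlag functions whose convergent
  sequences are those above (Jacod and Shiryaev, Limit Theorems for Stochastic Processes,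
  Theorem VI.1.14). Being metrizable, its open sets are exactly the sequentially open ones.\<close>

definition skorokhod :: "(real \<Rightarrow> real) topology" where
  "skorokhod = topology (\<lambda>U. U \<subseteq> cadlag \<and>
     (\<forall>x\<in>U. \<forall>X. range X \<subseteq> cadlag \<and> skorokhod_converges X x \<longrightarrow> (\<forall>\<^sub>F n in sequentially. X n \<in> U)))"

lemma openin_skorokhod:
  "openin skorokhod U \<longleftrightarrow> U \<subseteq> cadlag \<and>
     (\<forall>x\<in>U. \<forall>X. range X \<subseteq> cadlag \<and> skorokhod_converges X x \<longrightarrow> (\<forall>\<^sub>F n in sequentially. X n \<in> U))"
proof -
  let ?P = "\<lambda>U. U \<subseteq> cadlag \<and>
     (\<forall>x\<in>U. \<forall>X. range X \<subseteq> cadlag \<and> skorokhod_converges X x \<longrightarrow> (\<forall>\<^sub>F n in sequentially. X n \<in> U))"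
  have "?P (S \<inter> T)" if "?P S" "?P T" for S T
    using that by (auto simp: eventually_conj_iff)
  moreover have "?P (\<Union>K)" if K: "\<forall>S\<in>K. ?P S" for K
  proof (intro conjI ballI allI impI)
    show "\<Union>K \<subseteq> cadlag" using K by blast
  next
    fix x X assume "x \<in> \<Union>K" and X: "range X \<subseteq> cadlag \<and> skorokhod_converges X x"
    then obtain S where S: "S \<in> K" "x \<in> S" by blast
    have "\<forall>\<^sub>F n in sequentially. X n \<in> S" using K S X by blast
    then show "\<forall>\<^sub>F n in sequentially. X n \<in> \<Union>K"
      by (rule eventually_mono) (use S in blast)
  qed
  ultimately have "istopology ?P" unfolding istopology_def by blast
  then show ?thesis unfolding skorokhod_def by (simp add: topology_inverse')
qed

lemma topspace_skorokhod: "topspace skorokhod = cadlag"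
proof
  show "topspace skorokhod \<subseteq> cadlag"
    using openin_topspace[of skorokhod] openin_skorokhod by blast
  have "openin skorokhod cadlag" by (auto simp: openin_skorokhod intro!: always_eventually)
  then show "cadlag \<subseteq> topspace skorokhod" by (rule openin_subset)
qed


subsection \<open>Weak convergence and the Poisson process\<close>

definition borel_of :: "'a topology \<Rightarrow> 'a measure" where
  "borel_of T = sigma (topspace T) {U. openin T U}"

definition weak_conv_in :: "'a topology \<Rightarrow> (nat \<Rightarrow> 'a measure) \<Rightarrow> 'a measure \<Rightarrow> bool" where
  "weak_conv_in T \<mu> \<nu> \<longleftrightarrow>
     (\<forall>f :: 'a \<Rightarrow> real. continuous_map T euclideanreal f \<and> bounded (f ` topspace T) \<longrightarrow>
        (\<lambda>n. \<integral>x. f x \<partial>\<mu> n) \<longlonglongrightarrow> (\<integral>x. f x \<partial>\<nu>))"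

definition poisson_process :: "real \<Rightarrow> 'w measure \<Rightarrow> ('w \<Rightarrow> real \<Rightarrow> real) \<Rightarrow> bool" where
  "poisson_process \<rho> M N \<longleftrightarrow>
     prob_space M \<and>
     N \<in> M \<rightarrow>\<^sub>M borel_of skorokhod \<and>
     (AE \<omega> in M. N \<omega> 0 = 0) \<and>
     (\<forall>s t. 0 \<le> s \<and> s < t \<longrightarrow>
        distr M borel (\<lambda>\<omega>. N \<omega> t - N \<omega> s) =
        distr (measure_pmf (poisson_pmf (\<rho> * (t - s)))) borel real) \<and>
     (\<forall>(m::nat) (t :: nat \<Rightarrow> real). 0 \<le> t 0 \<and> (\<forall>i<m. t i \<le> t (Suc i)) \<longrightarrow>
        prob_space.indep_vars M (\<lambda>_. borel) (\<lambda>i \<omega>. N \<omega> (t (Suc i)) - N \<omega> (t i)) {..<m})"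

end

theory Submission
  imports Defs "HOL-Real_Asymp.Real_Asymp"
begin

text \<open>
  By Cauchy's formula the cycle counts under the weighted measure are independent Poisson variables
  \<open>Z\<^sub>k\<close> with means \<open>\<theta>\<^sub>k e\<^sup>-\<^sup>k\<^sup>v / k\<close>, conditioned on \<open>\<Sum> k Z\<^sub>k = n\<close>; this holds for every \<open>v\<close>, and
  \<open>v = v\<^sub>n\<close> makes the condition typical. Let \<open>b\<close> be three quarters of \<open>\<alpha> n\<^sup>* log n\<^sup>*\<close>. The sum over
  \<open>k < b\<close> fluctuates on the scale \<open>v\<^sup>-\<^sup>\<alpha>\<^sup>/\<^sup>2\<^sup>-\<^sup>1\<close>, while the cycles of length at least \<open>b\<close> have expected
  total length of smaller order. A Fourier estimate shows that the point probabilities of the first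
  sum are almost constant over shifts of that smaller order, so conditioning does not change the law
  of \<open>(Z\<^sub>k)\<close>, \<open>k \<ge> b\<close>, in total variation.

  These independent variables can be realized as the increments of the given Poisson process \<open>N\<close> over
  consecutive intervals. The process of long cycles then becomes \<open>N \<circ> \<Lambda>\<^sub>n\<close>, where
  \<open>\<Lambda>\<^sub>n y = \<Sum> \<theta>\<^sub>k e\<^sup>-\<^sup>k\<^sup>v / k\<close> over \<open>k \<ge> x\<^sub>n(y)\<close> tends to \<open>y\<close>. Since almost every path of \<open>N\<close> is an integer-valued
  step function, a time change that aligns its jumps gives pointwise convergence in the Skorokhod
  sense. What the process does after the time corresponding to \<open>b\<close> is irrelevant for the limit; it is
  dealt with by taking the supremum of the test functional over all possible continuations.
\<close>

subsection \<open>The cycle index of the symmetric group\<close>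

text \<open>A full local limit theorem is avoided. With
  \<open>s = v powr (\<alpha> / 2 + 1)\<close>, two crude bounds suffice: point probabilities change
  by at most \<open>K * s * s\<close> per unit shift and are at least \<open>c * s\<close> near the
  mean. A shift by the long total, of mean at most \<open>T\<close>, thus changes them by a relative
  amount of order \<open>T * s\<close>. The proportion 3/4 in the cut-off serves two ends. The tail
  estimate keeps only 3/4 of the exponential decay, so \<open>T * s\<close> has order
  \<open>v powr (\<alpha> / 16)\<close>, vanishing because 9/16 exceeds 1/2; and, being below 1, it
  keeps the cut-off under every threshold \<open>x_thr\<close> with fixed \<open>y\<close>, as
  \<open>ell\<close> has leading term \<open>\<alpha> * ln (n_star \<theta> n)\<close>. Tightness
  and finite-dimensional limits do not appear: coupled paths converge almost surely, and dominated
  convergence treats the bounded functional. The coupling realizes counts, not permutations, so only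
  functionals of the long counts can be transferred; the supremum over continuations is one and
  dominates the true value. It gives upper bounds only; the negated functional gives the lower
  ones.\<close>

text \<open>As \<open>p\<close> fixes \<open>a\<close>, the composition sends the predecessor of
  \<open>b\<close> to \<open>a\<close> and \<open>a\<close> to \<open>b\<close>: the new point is
  spliced into the cycle of \<open>b\<close> just before \<open>b\<close>, and every other cycle is
  unchanged.\<close>

lemma orbit_transpose_fixed:
  assumes p: "p permutes S" and S: "finite S" "a \<notin> S" "b \<in> S"
  shows "orbit (Transposition.transpose a b \<circ> p) a = insert a (orbit p b)"
    and "x \<in> S \<Longrightarrow> orbit (Transposition.transpose a b \<circ> p) x =
           (if b \<in> orbit p x then insert a (orbit p b) else orbit p x)"
proof -
  let ?q = "Transposition.transpose a b \<circ> p"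
  have perm: "permutation p" using p S by (auto simp: permutation_permutes)
  have pa: "p a = a" using p S by (auto simp: permutes_def)
  have q: "?q permutes insert a S"
    using p S by (intro permutes_compose permutes_swap_id) (auto intro: permutes_subset)
  then have permq: "permutation ?q" using S by (auto simp: permutation_permutes)
  have inS: "p y \<in> S" if "y \<in> S" for y using p that by (simp add: permutes_in_image)
  have sub: "orbit p b \<subseteq> S" by (rule permutes_orbit_subset[OF p \<open>b \<in> S\<close>])
  have qa: "?q a = b" by (simp add: pa)
  show *: "orbit ?q a = insert a (orbit p b)"
  proof (intro equalityI subsetI)
    fix y assume "y \<in> orbit ?q a"
    then show "y \<in> insert a (orbit p b)"
    proof induct
      case base
      then show ?case using permutation_self_in_orbit[OF perm] qa by simp
    next
      case (step y)
      then show ?case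
      proof (cases "y = a")
        case True
        then show ?thesis using qa permutation_self_in_orbit[OF perm] by simp
      next
        case False
        then have "p y \<in> orbit p b" using step by (auto intro: orbit.step)
        then show ?thesis
          using permutation_self_in_orbit[OF perm, of b] by (auto simp: Transposition.transpose_def)
      qed
    qed
  next
    have a: "a \<in> orbit ?q a" by (rule permutation_self_in_orbit[OF permq])
    have b: "b \<in> orbit ?q a" using orbit.base[of ?q a] qa by simp
    fix y assume "y \<in> insert a (orbit p b)"
    moreover have "y \<in> orbit ?q a" if "y \<in> orbit p b"
      using that
    proof induct
      case base
      show ?case
      proof (cases "p b = b")
        case False
        moreover have "p b \<noteq> a" using inS S by auto
        ultimately have "?q b = p b" by (simp add: transpose_def)
        then show ?thesis using orbit.step[OF b] by metis
      qed (use b in metis)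
    next
      case (step y)
      show ?case
      proof (cases "p y = b")
        case False
        moreover have "p y \<noteq> a" using inS S sub step by auto
        ultimately have "?q y = p y" by (simp add: transpose_def)
        then show ?thesis using orbit.step[OF step(2)] by metis
      qed (use b in metis)
    qed
    ultimately show "y \<in> orbit ?q a" using a by auto
  qed
  assume x: "x \<in> S"
  show "orbit ?q x = (if b \<in> orbit p x then insert a (orbit p b) else orbit p x)"
  proof (cases "b \<in> orbit p x")
    case True
    then have "x \<in> orbit p b"
      by (meson orbit_swap perm permutation_self_in_orbit)
    then have "x \<in> orbit ?q a" using * by simp
    then have "orbit ?q x = orbit ?q a"
      by (metis orbit_cyclic_eq3 cyclic_on_orbit'[OF permq])
    then show ?thesis using * True by simp
  next
    case False
    have "orbit p x = orbit ?q x"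
    proof (rule orbit_cong0[of x "orbit p x"])
      show "x \<in> orbit p x" by (rule permutation_self_in_orbit[OF perm])
      show "p \<in> orbit p x \<rightarrow> orbit p x" by (auto intro: orbit.step)
      fix y assume "y \<in> orbit p x"
      then have "p y \<in> orbit p x" by (rule orbit.step)
      moreover have "orbit p x \<subseteq> S" by (rule permutes_orbit_subset[OF p x])
      ultimately show "p y = ?q y" using False S by (auto simp: Transposition.transpose_def)
    qed
    then show ?thesis using False by simp
  qed
qed

lemma cycle_count_insert_fixed:
  assumes p: "p permutes {1..n}"
  shows "cycle_count (Suc n) p = (cycle_count n p)(1 := Suc (cycle_count n p 1))"
proof
  fix k
  have "p (Suc n) = Suc n" using p by (auto simp: permutes_def)
  then have o: "orbit p (Suc n) = {Suc n}" by (simp add: orbit_eq_singleton_iff)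
  have "orbit p x \<subseteq> {1..n}" if "x \<in> {1..n}" for x
    by (rule permutes_orbit_subset[OF p that])
  then have ni: "{Suc n} \<notin> orbit p ` {1..n}"
    by (metis (no_types, lifting) atLeastAtMost_iff imageE insert_subset not_less_eq_eq order_refl)
  have im: "orbit p ` {1..Suc n} = insert {Suc n} (orbit p ` {1..n})"
    by (simp add: atLeastAtMostSuc_conv o)
  have "{c \<in> orbit p ` {1..Suc n}. card c = k} =
      (if k = 1 then insert {Suc n} {c \<in> orbit p ` {1..n}. card c = k}
       else {c \<in> orbit p ` {1..n}. card c = k})"
    unfolding im by auto
  then show "cycle_count (Suc n) p k = ((cycle_count n p)(1 := Suc (cycle_count n p 1))) k"
    using ni by (auto simp: cycle_count_def)
qed

text \<open>Splicing exchanges one cycle of length \<open>k\<close> for one of length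
  \<open>Suc k\<close>. The accompanying \<open>C k \<ge> 1\<close> shows that the subtraction on
  natural numbers does not truncate.\<close>

lemma cycle_count_insert_after:
  assumes p: "p permutes {1..n}" and b: "b \<in> {1..n}"
  defines "k \<equiv> card (orbit p b)" and "C \<equiv> cycle_count n p"
  shows "cycle_count (Suc n) (Transposition.transpose (Suc n) b \<circ> p) = C(k := C k - 1, Suc k := Suc (C (Suc k)))"
    and "C k \<ge> 1" and "k \<in> {1..n}"
proof -
  let ?q = "Transposition.transpose (Suc n) b \<circ> p" and ?a = "Suc n" and ?B = "orbit p b"
  have perm: "permutation p" using p by (auto simp: permutation_permutes)
  have sub: "orbit p x \<subseteq> {1..n}" if "x \<in> {1..n}" for x
    by (rule permutes_orbit_subset[OF p that])
  have finB: "finite ?B" using sub[OF b] finite_subset by blast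
  note oq = orbit_transpose_fixed[OF p, of ?a b]
  have eqB: "b \<in> orbit p x \<longleftrightarrow> orbit p x = ?B" for x
    by (metis cyclic_on_orbit'[OF perm] orbit_cyclic_eq3 permutation_self_in_orbit[OF perm])
  have "orbit ?q ` {1..Suc n} = insert (orbit ?q ?a) (orbit ?q ` {1..n})"
    by (simp add: atLeastAtMostSuc_conv)
  also have "orbit ?q ?a = insert ?a ?B" using oq b by simp
  also have "orbit ?q ` {1..n} = (\<lambda>x. if orbit p x = ?B then insert ?a ?B else orbit p x) ` {1..n}"
    using oq b by (intro image_cong) (auto simp: eqB)
  also have "insert (insert ?a ?B) \<dots> = insert (insert ?a ?B) (orbit p ` {1..n} - {?B})"
    by auto
  finally have im: "orbit ?q ` {1..Suc n} = insert (insert ?a ?B) (orbit p ` {1..n} - {?B})" .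
  have ni: "insert ?a ?B \<notin> orbit p ` {1..n}"
  proof
    assume "insert ?a ?B \<in> orbit p ` {1..n}"
    then obtain x where "x \<in> {1..n}" "insert ?a ?B = orbit p x" by auto
    then have "?a \<in> {1..n}" using sub by blast
    then show False by simp
  qed
  have cB: "card (insert ?a ?B) = Suc k"
  proof -
    have "?a \<notin> ?B" using sub[OF b] by (meson atLeastAtMost_iff not_less_eq_eq order_refl subsetD)
    then show ?thesis using finB by (simp add: k_def)
  qed
  have Bin: "?B \<in> {c \<in> orbit p ` {1..n}. card c = k}" using b by (auto simp: k_def)
  show "C k \<ge> 1"
  proof -
    have "{c \<in> orbit p ` {1..n}. card c = k} \<noteq> {}" using Bin by blast
    then show ?thesis unfolding C_def cycle_count_def by (simp add: Suc_le_eq card_gt_0_iff)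
  qed
  show "k \<in> {1..n}"
    using card_mono[OF _ sub[OF b]] finB orbit_nonempty[of p b]
    by (auto simp: k_def Suc_le_eq card_gt_0_iff)
  show "cycle_count (Suc n) ?q = C(k := C k - 1, Suc k := Suc (C (Suc k)))"
  proof
    fix j
    let ?S = "\<lambda>j. {c \<in> orbit p ` {1..n}. card c = j}"
    have "{c \<in> orbit ?q ` {1..Suc n}. card c = j} =
        (if j = Suc k then insert (insert ?a ?B) (?S j)
         else if j = k then ?S j - {?B} else ?S j)"
    proof -
      have kB: "card ?B = k" by (simp add: k_def)
      have "{c \<in> insert B' (O' - {B}). card c = j} =
          (if j = Suc k then insert B' {c \<in> O'. card c = j}
           else if j = k then {c \<in> O'. card c = j} - {B} else {c \<in> O'. card c = j})"
        if "card B = k" "card B' = Suc k" for B B' :: "nat set" and O'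
        using that by auto
      from this[OF kB cB] show ?thesis unfolding im .
    qed
    moreover have "finite (?S j)" by simp
    moreover have "insert ?a ?B \<notin> ?S j" using ni by auto
    ultimately show "cycle_count (Suc n) ?q j = (C(k := C k - 1, Suc k := Suc (C (Suc k)))) j"
      using Bin by (auto simp: C_def cycle_count_def)
  qed
qed

text \<open>The points whose orbit is a given cycle are the elements of that cycle, so a cycle of
  length \<open>k\<close> contributes \<open>k\<close> equal terms.\<close>

lemma sum_card_orbit:
  fixes H :: "nat \<Rightarrow> real"
  assumes p: "p permutes {1..n}"
  shows "(\<Sum>b=1..n. H (card (orbit p b))) = (\<Sum>k=1..n. real k * real (cycle_count n p k) * H k)"
proof -
  let ?O = "orbit p ` {1..n}"
  have perm: "permutation p" using p by (auto simp: permutation_permutes)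
  have sub: "orbit p x \<subseteq> {1..n}" if "x \<in> {1..n}" for x
    by (rule permutes_orbit_subset[OF p that])
  have fib: "{b \<in> {1..n}. orbit p b = B} = B" if "B \<in> ?O" for B
  proof -
    from that obtain x where x: "x \<in> {1..n}" "B = orbit p x" by auto
    have "orbit p b = B" if "b \<in> B" for b
      using orbit_cyclic_eq3[OF cyclic_on_orbit'[OF perm, of x]] that x by simp
    moreover have "b \<in> orbit p b" for b by (rule permutation_self_in_orbit[OF perm])
    moreover have "B \<subseteq> {1..n}" using sub[OF x(1)] x(2) by simp
    ultimately show ?thesis by blast
  qed
  have card: "card B \<in> {1..n}" if "B \<in> ?O" for B
  proof -
    from that obtain x where x: "x \<in> {1..n}" "B = orbit p x" by auto
    have "card B \<le> n" using card_mono[OF _ sub[OF x(1)]] x by simp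
    moreover have "card B > 0"
      using x sub[OF x(1)] orbit_nonempty[of p x] finite_subset card_gt_0_iff by blast
    ultimately show ?thesis by simp
  qed
  have "(\<Sum>b=1..n. H (card (orbit p b))) = (\<Sum>B\<in>?O. \<Sum>b | b \<in> {1..n} \<and> orbit p b = B. H (card (orbit p b)))"
    by (rule sum.image_gen) simp
  also have "\<dots> = (\<Sum>B\<in>?O. real (card B) * H (card B))"
  proof (intro sum.cong refl)
    fix B assume B: "B \<in> ?O"
    have "(\<Sum>b | b \<in> {1..n} \<and> orbit p b = B. H (card (orbit p b))) =
        (\<Sum>b | b \<in> {1..n} \<and> orbit p b = B. H (card B))" by (intro sum.cong) auto
    also have "\<dots> = real (card B) * H (card B)" by (subst fib[OF B]) simp
    finally show "(\<Sum>b | b \<in> {1..n} \<and> orbit p b = B. H (card (orbit p b))) = real (card B) * H (card B)" .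
  qed
  also have "\<dots> = (\<Sum>k=1..n. \<Sum>B | B \<in> ?O \<and> card B = k. real (card B) * H (card B))"
    by (rule sum.group[symmetric]) (use card in auto)
  also have "\<dots> = (\<Sum>k=1..n. real k * real (cycle_count n p k) * H k)"
    by (intro sum.cong refl) (simp add: cycle_count_def)
  finally show ?thesis .
qed

section \<open>Cycle types and their Cauchy weights\<close>

text \<open>These are the partitions of \<open>n\<close> in multiplicity notation. Vanishing outside
  \<open>{1..n}\<close> makes each partition correspond to exactly one function.\<close>

definition cycle_types :: "nat \<Rightarrow> (nat \<Rightarrow> nat) set" where
  "cycle_types n = {c. (\<forall>k. k \<notin> {1..n} \<longrightarrow> c k = 0) \<and> (\<Sum>k=1..n. k * c k) = n}"

text \<open>A part larger than \<open>n\<close> would already exceed the total. The free bound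
  \<open>K\<close> lets the types of \<open>n\<close> and of \<open>Suc n\<close> share one index
  range.\<close>

lemma cycle_types_altdef:
  assumes "n \<le> K"
  shows "cycle_types n = {c. (\<forall>k. k \<notin> {1..K} \<longrightarrow> c k = 0) \<and> (\<Sum>k=1..K. k * c k) = n}"
proof (intro equalityI subsetI)
  fix c assume "c \<in> cycle_types n"
  then have c: "\<And>k. k \<notin> {1..n} \<Longrightarrow> c k = 0" "(\<Sum>k=1..n. k * c k) = n"
    by (auto simp: cycle_types_def)
  have "(\<Sum>k=1..K. k * c k) = (\<Sum>k=1..n. k * c k)"
    using assms by (intro sum.mono_neutral_right) (auto simp: c)
  then have "(\<Sum>k=1..K. k * c k) = n" using c(2) by simp
  moreover have "\<forall>k. k \<notin> {1..K} \<longrightarrow> c k = 0" using assms by (auto intro: c(1))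
  ultimately show "c \<in> {c. (\<forall>k. k \<notin> {1..K} \<longrightarrow> c k = 0) \<and> (\<Sum>k=1..K. k * c k) = n}" by blast
next
  fix c assume "c \<in> {c. (\<forall>k. k \<notin> {1..K} \<longrightarrow> c k = 0) \<and> (\<Sum>k=1..K. k * c k) = n}"
  then have c: "\<And>k. k \<notin> {1..K} \<Longrightarrow> c k = 0" "(\<Sum>k=1..K. k * c k) = n" by auto
  have z: "c k = 0" if "k \<notin> {1..n}" for k
  proof (rule ccontr)
    assume nz: "c k \<noteq> 0"
    then have k: "k \<in> {1..K}" using c(1)[of k] by auto
    have "k * c k \<le> (\<Sum>k=1..K. k * c k)"
      by (rule member_le_sum) (use k in auto)
    moreover have "k * 1 \<le> k * c k" using nz by (intro mult_le_mono) auto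
    ultimately have "k \<le> n" using c(2) by linarith
    then show False using that k by auto
  qed
  have "(\<Sum>k=1..K. k * c k) = (\<Sum>k=1..n. k * c k)"
    using assms by (intro sum.mono_neutral_right) (auto simp: z)
  then show "c \<in> cycle_types n" using c z by (auto simp: cycle_types_def)
qed

lemma finite_cycle_types: "finite (cycle_types n)"
proof (rule finite_subset)
  show "cycle_types n \<subseteq> PiE_dflt {1..n} 0 (\<lambda>_. {..n})"
  proof
    fix c assume c: "c \<in> cycle_types n"
    have "c k \<le> n" if "k \<in> {1..n}" for k
    proof -
      have "k * c k \<le> (\<Sum>k=1..n. k * c k)"
        by (rule member_le_sum) (use that in auto)
      moreover have "1 * c k \<le> k * c k" using that by (intro mult_le_mono) auto
      moreover have "(\<Sum>k=1..n. k * c k) = n" using c by (auto simp: cycle_types_def)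
      ultimately show ?thesis by linarith
    qed
    then show "c \<in> PiE_dflt {1..n} 0 (\<lambda>_. {..n})"
      using c by (auto simp: PiE_dflt_def cycle_types_def)
  qed
  show "finite (PiE_dflt {1..n} (0::nat) (\<lambda>_. {..n}))" by (intro finite_PiE_dflt) auto
qed

text \<open>For a type of \<open>K\<close> this is the reciprocal of the order of the centralizer of
  a permutation of that type, that is, the proportion of permutations having it.\<close>

definition cauchy_weight :: "nat \<Rightarrow> (nat \<Rightarrow> nat) \<Rightarrow> real" where
  "cauchy_weight K c = 1 / (\<Prod>k=1..K. real k ^ c k * fact (c k))"

lemma cauchy_weight_cong:
  assumes "n \<le> K" "c \<in> cycle_types n"
  shows "cauchy_weight K c = cauchy_weight n c"
  unfolding cauchy_weight_def
  using assms by (intro arg_cong[where f = "\<lambda>x. 1 / x"] prod.mono_neutral_right)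
    (auto simp: cycle_types_def)

lemma cauchy_weight_dec:
  assumes "k \<in> {1..K}" "c k \<ge> 1"
  shows "real k * real (c k) * cauchy_weight K c = cauchy_weight K (c(k := c k - 1))"
proof -
  obtain m where m: "c k = Suc m" using assms by (cases "c k") auto
  define R where "R = (\<Prod>j\<in>{1..K} - {k}. real j ^ c j * fact (c j))"
  have R: "R > 0" unfolding R_def by (intro prod_pos) auto
  have 1: "(\<Prod>j=1..K. real j ^ c j * fact (c j)) =
      real k ^ c k * fact (c k) * R"
    using assms by (unfold R_def, subst prod.remove[of _ k]) auto
  have 2: "(\<Prod>j=1..K. real j ^ (c(k := c k - 1)) j * fact ((c(k := c k - 1)) j)) =
      real k ^ m * fact m * R"
    using assms m by (unfold R_def, subst prod.remove[of _ k]) (auto intro!: prod.cong)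
  have k: "real k > 0" using assms by simp
  have "Q * (real k * X) / (real k * X * (Q * Y)) = 1 / Y" if "X > 0" "Q > 0" for Q X Y
    using that k by (simp add: field_simps)
  from this[of "real k ^ m" "real (Suc m)" "fact m * R"] show ?thesis
    unfolding cauchy_weight_def 1 2 using R k by (simp add: m mult_ac)
qed

text \<open>Since \<open>Suc n\<close> is the sum of all \<open>k * c k\<close>, it distributes over
  the part sizes, and \<open>cauchy_weight_dec\<close> reads each summand as the removal of one
  part. Deleting a part 1 and shrinking a part \<open>Suc k\<close> to \<open>k\<close> are the
  inverses of the two moves on the right-hand side.\<close>

lemma cycle_types_Suc_reindex:
  fixes F :: "(nat \<Rightarrow> nat) \<Rightarrow> real"
  shows "(\<Sum>c\<in>cycle_types (Suc n). F c * cauchy_weight (Suc n) c) * real (Suc n) =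
     (\<Sum>c\<in>cycle_types n. cauchy_weight n c * F (c(1 := Suc (c 1)))) +
     (\<Sum>c\<in>cycle_types n. cauchy_weight n c *
        (\<Sum>k=1..n. real k * real (c k) * F (c(k := c k - 1, Suc k := Suc (c (Suc k))))))"
proof -
  let ?K = "Suc n" and ?w = "cauchy_weight (Suc n)"
  have ct: "cycle_types n = {c. (\<forall>k. k \<notin> {1..?K} \<longrightarrow> c k = 0) \<and> (\<Sum>k=1..?K. k * c k) = n}"
    by (rule cycle_types_altdef) simp
  have ct': "cycle_types ?K = {c. (\<forall>k. k \<notin> {1..?K} \<longrightarrow> c k = 0) \<and> (\<Sum>k=1..?K. k * c k) = ?K}"
    by (rule cycle_types_altdef) simp
  have sum_dec: "(\<Sum>j=1..?K. j * c j) = (\<Sum>j=1..?K. j * (c(k := c k - 1)) j) + k"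
    if "k \<in> {1..?K}" "c k \<ge> 1" for c k
  proof -
    have "(\<Sum>j=1..?K. j * c j) = k * c k + (\<Sum>j\<in>{1..?K} - {k}. j * c j)"
      using that by (intro sum.remove) auto
    moreover have "(\<Sum>j=1..?K. j * (c(k := c k - 1)) j) = k * (c k - 1) + (\<Sum>j\<in>{1..?K} - {k}. j * c j)"
      using that by (subst sum.remove[of _ k]) (auto intro!: sum.cong)
    moreover have "k * c k = k * (c k - 1) + k" using that by (cases "c k") auto
    ultimately show ?thesis by simp
  qed
  have w: "cauchy_weight n c = ?w c" if "c \<in> cycle_types n" for c
    using cauchy_weight_cong[of n ?K c] that by simp
  have "(\<Sum>c\<in>cycle_types ?K. F c * ?w c) * real ?K =
      (\<Sum>c\<in>cycle_types ?K. \<Sum>k=1..?K. F c * (real k * real (c k) * ?w c))"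
    unfolding sum_distrib_right
  proof (intro sum.cong refl)
    fix c assume "c \<in> cycle_types ?K"
    then have "real ?K = (\<Sum>k=1..?K. real k * real (c k))"
      unfolding cycle_types_def of_nat_mult[symmetric] of_nat_sum[symmetric] by auto
    then show "F c * ?w c * real ?K = (\<Sum>k=1..?K. F c * (real k * real (c k) * ?w c))"
      by (simp only: sum_distrib_left) (auto intro!: sum.cong simp: mult_ac)
  qed
  also have "\<dots> = (\<Sum>k=1..?K. \<Sum>c\<in>cycle_types ?K. F c * (real k * real (c k) * ?w c))"
    by (rule sum.swap)
  also have "\<dots> = (\<Sum>c\<in>cycle_types ?K. F c * (real 1 * real (c 1) * ?w c)) +
      (\<Sum>k=1..n. \<Sum>c\<in>cycle_types ?K. F c * (real (Suc k) * real (c (Suc k)) * ?w c))"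
  proof -
    have "(\<Sum>k=1..?K. H k) = H 1 + (\<Sum>k=1..n. H (Suc k))" for H :: "nat \<Rightarrow> real"
      by (subst sum.atLeast_Suc_atMost, simp, subst sum.shift_bounds_cl_Suc_ivl[symmetric], simp)
    then show ?thesis .
  qed
  also have "(\<Sum>c\<in>cycle_types ?K. F c * (real 1 * real (c 1) * ?w c)) =
      (\<Sum>c\<in>cycle_types n. cauchy_weight n c * F (c(1 := Suc (c 1))))"
  proof -
    have "(\<Sum>c\<in>cycle_types n. cauchy_weight n c * F (c(1 := Suc (c 1)))) =
        (\<Sum>c | c \<in> cycle_types ?K \<and> c 1 \<ge> 1. F c * (real 1 * real (c 1) * ?w c))"
    proof (rule sum.reindex_bij_witness[where i = "\<lambda>c. c(1 := c 1 - 1)" and j = "\<lambda>c. c(1 := Suc (c 1))"])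
      fix c assume c: "c \<in> cycle_types n"
      show "(c(1 := Suc (c 1)))(1 := (c(1 := Suc (c 1))) 1 - 1) = c" by auto
      let ?c = "c(1 := Suc (c 1))"
      have "?c(1 := ?c 1 - 1) = c" by auto
      then have "(\<Sum>j=1..?K. j * ?c j) = (\<Sum>j=1..?K. j * c j) + 1"
        using sum_dec[of 1 ?c] by simp
      then show "?c \<in> {c \<in> cycle_types ?K. 1 \<le> c 1}"
        using c unfolding ct ct' by auto
      have "real 1 * real (?c 1) * ?w ?c = ?w (?c(1 := ?c 1 - 1))"
        by (rule cauchy_weight_dec) auto
      also have "?c(1 := ?c 1 - 1) = c" by auto
      finally show "F ?c * (real 1 * real (?c 1) * ?w ?c) = cauchy_weight n c * F ?c"
        by (simp only: w[OF c] mult.commute)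
    next
      fix c assume c: "c \<in> {c \<in> cycle_types ?K. 1 \<le> c 1}"
      show "(c(1 := c 1 - 1))(1 := Suc ((c(1 := c 1 - 1)) 1)) = c" using c by auto
      show "c(1 := c 1 - 1) \<in> cycle_types n"
        using c sum_dec[of 1 c] unfolding ct ct' by auto
    qed
    also have "\<dots> = (\<Sum>c\<in>cycle_types ?K. F c * (real 1 * real (c 1) * ?w c))"
      by (intro sum.mono_neutral_left) (auto simp: finite_cycle_types not_le)
    finally show ?thesis ..
  qed
  also have "(\<Sum>k=1..n. \<Sum>c\<in>cycle_types ?K. F c * (real (Suc k) * real (c (Suc k)) * ?w c)) =
      (\<Sum>k=1..n. \<Sum>c\<in>cycle_types n. cauchy_weight n c *
         (real k * real (c k) * F (c(k := c k - 1, Suc k := Suc (c (Suc k))))))"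
  proof (rule sum.cong[OF refl])
    fix k assume k: "k \<in> {1..n}"
    let ?up = "\<lambda>c::nat\<Rightarrow>nat. c(k := c k - 1, Suc k := Suc (c (Suc k)))"
      and ?dn = "\<lambda>c::nat\<Rightarrow>nat. c(Suc k := c (Suc k) - 1, k := Suc (c k))"
    have "(\<Sum>c\<in>cycle_types n. cauchy_weight n c * (real k * real (c k) * F (?up c))) =
        (\<Sum>c | c \<in> cycle_types n \<and> c k \<ge> 1. cauchy_weight n c * (real k * real (c k) * F (?up c)))"
      by (intro sum.mono_neutral_right) (auto simp: finite_cycle_types not_le)
    also have "\<dots> = (\<Sum>c | c \<in> cycle_types ?K \<and> c (Suc k) \<ge> 1.
        F c * (real (Suc k) * real (c (Suc k)) * ?w c))"
    proof (rule sum.reindex_bij_witness[where i = ?dn and j = ?up])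
      fix c assume c: "c \<in> {c \<in> cycle_types n. 1 \<le> c k}"
      show "?dn (?up c) = c" using c by (auto simp: fun_eq_iff)
      \<comment> \<open>Enlarging a part \<open>k\<close> to \<open>Suc k\<close> and then deleting
        it is the same as deleting the part \<open>k\<close>; both weights therefore reduce to the
        weight of that shorter type.\<close>
      have e: "(?up c)(Suc k := ?up c (Suc k) - 1) = c(k := c k - 1)" by (auto simp: fun_eq_iff)
      have "(\<Sum>j=1..?K. j * ?up c j) = (\<Sum>j=1..?K. j * (c(k := c k - 1)) j) + Suc k"
        using sum_dec[of "Suc k" "?up c"] k unfolding e by auto
      moreover have "(\<Sum>j=1..?K. j * c j) = (\<Sum>j=1..?K. j * (c(k := c k - 1)) j) + k"
        using sum_dec[of k c] k c by auto
      moreover have "(\<Sum>j=1..?K. j * c j) = n" using c unfolding ct by blast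
      ultimately have "(\<Sum>j=1..?K. j * ?up c j) = ?K" by linarith
      moreover have "\<forall>j. j \<notin> {1..?K} \<longrightarrow> ?up c j = 0" using c k unfolding ct by auto
      ultimately show "?up c \<in> {c \<in> cycle_types ?K. 1 \<le> c (Suc k)}"
        unfolding ct' by simp
      have "real (Suc k) * real (?up c (Suc k)) * ?w (?up c) = ?w ((?up c)(Suc k := ?up c (Suc k) - 1))"
        using k by (intro cauchy_weight_dec) auto
      also have "\<dots> = ?w (c(k := c k - 1))" unfolding e ..
      also have "\<dots> = real k * real (c k) * ?w c"
        using k c by (intro cauchy_weight_dec[symmetric]) auto
      finally show "F (?up c) * (real (Suc k) * real (?up c (Suc k)) * ?w (?up c)) =
          cauchy_weight n c * (real k * real (c k) * F (?up c))"
        using w[of c] c by simp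
    next
      fix c assume c: "c \<in> {c \<in> cycle_types ?K. 1 \<le> c (Suc k)}"
      show "?up (?dn c) = c" using c by (auto simp: fun_eq_iff)
      have e: "(?dn c)(k := ?dn c k - 1) = c(Suc k := c (Suc k) - 1)" by (auto simp: fun_eq_iff)
      have "(\<Sum>j=1..?K. j * ?dn c j) = (\<Sum>j=1..?K. j * (c(Suc k := c (Suc k) - 1)) j) + k"
        using sum_dec[of k "?dn c"] k unfolding e by auto
      moreover have "(\<Sum>j=1..?K. j * c j) = (\<Sum>j=1..?K. j * (c(Suc k := c (Suc k) - 1)) j) + Suc k"
        using sum_dec[of "Suc k" c] k c by auto
      moreover have "(\<Sum>j=1..?K. j * c j) = ?K" using c unfolding ct' by blast
      ultimately have "(\<Sum>j=1..?K. j * ?dn c j) = n" by linarith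
      moreover have "\<forall>j. j \<notin> {1..?K} \<longrightarrow> ?dn c j = 0" using c k unfolding ct' by auto
      ultimately show "?dn c \<in> {c \<in> cycle_types n. 1 \<le> c k}"
        unfolding ct by simp
    qed
    also have "\<dots> = (\<Sum>c\<in>cycle_types ?K. F c * (real (Suc k) * real (c (Suc k)) * ?w c))"
      by (intro sum.mono_neutral_left) (auto simp: finite_cycle_types not_le)
    finally show "(\<Sum>c\<in>cycle_types ?K. F c * (real (Suc k) * real (c (Suc k)) * ?w c)) =
        (\<Sum>c\<in>cycle_types n. cauchy_weight n c * (real k * real (c k) * F (?up c)))" ..
  qed
  also have "\<dots> = (\<Sum>c\<in>cycle_types n. cauchy_weight n c *
        (\<Sum>k=1..n. real k * real (c k) * F (c(k := c k - 1, Suc k := Suc (c (Suc k))))))"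
    by (subst sum.swap) (simp add: sum_distrib_left)
  finally show ?thesis .
qed

text \<open>Each permutation of \<open>{1..Suc n}\<close> arises exactly once by splicing
  \<open>Suc n\<close> before some \<open>b\<close>; the choice \<open>b = Suc n\<close> gives the
  identity as transposition and hence a fixed point. Grouping the other \<open>b\<close> by the
  length of their cycle produces the factors \<open>k * C k\<close>.\<close>

lemma sum_over_permutations_Suc:
  fixes F :: "(nat \<Rightarrow> nat) \<Rightarrow> real"
  shows "(\<Sum>\<sigma> | \<sigma> permutes {1..Suc n}. F (cycle_count (Suc n) \<sigma>)) =
    (\<Sum>p | p permutes {1..n}. F ((cycle_count n p)(1 := Suc (cycle_count n p 1))) +
       (\<Sum>k=1..n. real k * real (cycle_count n p k) *
          F ((cycle_count n p)(k := cycle_count n p k - 1, Suc k := Suc (cycle_count n p (Suc k))))))"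
proof -
  let ?a = "Suc n" and ?S = "{1..n}"
  let ?g = "\<lambda>(b, p). Transposition.transpose ?a b \<circ> p"
  let ?D = "insert ?a ?S \<times> {p. p permutes ?S}"
  have img: "{\<sigma>. \<sigma> permutes {1..Suc n}} = ?g ` ?D"
    using permutes_insert[of ?a ?S] by (simp add: atLeastAtMostSuc_conv Sigma_def) auto
  have inj: "inj_on ?g ?D"
  proof (rule inj_onI)
    fix x y assume x: "x \<in> ?D" and y: "y \<in> ?D" and e: "?g x = ?g y"
    obtain b p c q where bp: "x = (b, p)" and cq: "y = (c, q)" by (cases x, cases y)
    have pa: "p ?a = ?a" "q ?a = ?a"
      using x y bp cq by (auto simp: permutes_def)
    have "(Transposition.transpose ?a b \<circ> p) ?a = (Transposition.transpose ?a c \<circ> q) ?a" using e bp cq by simp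
    then have bc: "b = c" using pa by simp
    have "Transposition.transpose ?a b \<circ> (Transposition.transpose ?a b \<circ> p) = Transposition.transpose ?a b \<circ> (Transposition.transpose ?a b \<circ> q)"
      using e bp cq bc by simp
    then have "p = q" by (simp add: fun_eq_iff)
    then show "x = y" using bc bp cq by simp
  qed
  have "(\<Sum>\<sigma> | \<sigma> permutes {1..Suc n}. F (cycle_count (Suc n) \<sigma>)) =
      (\<Sum>x\<in>?D. F (cycle_count (Suc n) (?g x)))"
    unfolding img by (subst sum.reindex[OF inj]) (simp add: case_prod_unfold)
  also have "\<dots> = (\<Sum>b\<in>insert ?a ?S. \<Sum>p | p permutes ?S. F (cycle_count (Suc n) (Transposition.transpose ?a b \<circ> p)))"
    by (simp add: sum.cartesian_product case_prod_unfold)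
  also have "\<dots> = (\<Sum>p | p permutes ?S. \<Sum>b\<in>insert ?a ?S. F (cycle_count (Suc n) (Transposition.transpose ?a b \<circ> p)))"
    by (rule sum.swap)
  also have "\<dots> = (\<Sum>p | p permutes {1..n}. F ((cycle_count n p)(1 := Suc (cycle_count n p 1))) +
       (\<Sum>k=1..n. real k * real (cycle_count n p k) *
          F ((cycle_count n p)(k := cycle_count n p k - 1, Suc k := Suc (cycle_count n p (Suc k))))))"
  proof (rule sum.cong[OF refl])
    fix p assume "p \<in> {p. p permutes ?S}"
    then have p: "p permutes ?S" by simp
    let ?C = "cycle_count n p"
    have "(\<Sum>b\<in>insert ?a ?S. F (cycle_count (Suc n) (Transposition.transpose ?a b \<circ> p))) =
        F (cycle_count (Suc n) p) + (\<Sum>b=1..n. F (cycle_count (Suc n) (Transposition.transpose ?a b \<circ> p)))"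
      by simp
    also have "cycle_count (Suc n) p = ?C(1 := Suc (?C 1))" by (rule cycle_count_insert_fixed[OF p])
    also have "(\<Sum>b=1..n. F (cycle_count (Suc n) (Transposition.transpose ?a b \<circ> p))) =
        (\<Sum>b=1..n. (\<lambda>k. F (?C(k := ?C k - 1, Suc k := Suc (?C (Suc k))))) (card (orbit p b)))"
      by (intro sum.cong refl) (simp add: cycle_count_insert_after(1)[OF p])
    also have "\<dots> = (\<Sum>k=1..n. real k * real (?C k) * F (?C(k := ?C k - 1, Suc k := Suc (?C (Suc k)))))"
      by (rule sum_card_orbit[OF p])
    finally show "(\<Sum>b\<in>insert ?a ?S. F (cycle_count (Suc n) (Transposition.transpose ?a b \<circ> p))) =
        F (?C(1 := Suc (?C 1))) +
        (\<Sum>k=1..n. real k * real (?C k) * F (?C(k := ?C k - 1, Suc k := Suc (?C (Suc k)))))" .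
  qed
  finally show ?thesis .
qed

text \<open>Both sides satisfy the recursion for inserting one point, so induction replaces a count
  of conjugacy classes. \<open>F\<close> has to be arbitrary because the step applies the hypothesis
  to \<open>G\<close>, which collects all insertions.\<close>

theorem cauchy_cycle_formula:
  fixes F :: "(nat \<Rightarrow> nat) \<Rightarrow> real"
  shows "(\<Sum>\<sigma> | \<sigma> permutes {1..n}. F (cycle_count n \<sigma>)) =
     fact n * (\<Sum>c\<in>cycle_types n. F c * cauchy_weight n c)"
proof (induction n arbitrary: F)
  case 0
  have "cycle_count 0 \<sigma> = (\<lambda>_. 0)" for \<sigma> by (auto simp: cycle_count_def fun_eq_iff)
  moreover have "cycle_types 0 = {\<lambda>_. 0}" by (auto simp: cycle_types_def)
  ultimately show ?case by (simp add: cauchy_weight_def)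
next
  case (Suc n)
  define G where "G c = F (c(1 := Suc (c 1))) +
    (\<Sum>k=1..n. real k * real (c k) * F (c(k := c k - 1, Suc k := Suc (c (Suc k)))))" for c
  have "(\<Sum>\<sigma> | \<sigma> permutes {1..Suc n}. F (cycle_count (Suc n) \<sigma>)) =
      (\<Sum>p | p permutes {1..n}. G (cycle_count n p))"
    unfolding sum_over_permutations_Suc G_def ..
  also have "\<dots> = fact n * (\<Sum>c\<in>cycle_types n. G c * cauchy_weight n c)" by (rule Suc.IH)
  also have "(\<Sum>c\<in>cycle_types n. G c * cauchy_weight n c) =
      (\<Sum>c\<in>cycle_types (Suc n). F c * cauchy_weight (Suc n) c) * real (Suc n)"
    unfolding cycle_types_Suc_reindex G_def
    by (simp add: sum.distrib[symmetric] distrib_left distrib_right mult_ac)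
  finally show ?case by (simp add: mult_ac)
qed

subsection \<open>Convergence of integer-valued paths in the Skorokhod topology\<close>

text \<open>The hypothesis allows a different time change for each horizon and tolerance, whereas
  the definition wants one sequence. A diagonal choice takes, for each \<open>n\<close>, a time
  change that serves the highest attainable level up to \<open>n\<close>.\<close>

lemma skorokhod_convergesI:
  assumes "\<And>T e. T \<ge> 0 \<Longrightarrow> e > 0 \<Longrightarrow> \<forall>\<^sub>F n in sequentially. \<exists>\<tau>\<in>time_changes.
     (\<forall>t\<ge>0. \<bar>\<tau> t - t\<bar> \<le> e) \<and> (\<forall>t\<in>{0..T}. \<bar>X n (\<tau> t) - x t\<bar> \<le> e)"
  shows "skorokhod_converges X x"
proof -
  \<comment> \<open>Level \<open>j\<close> couples the horizon \<open>j\<close> with the tolerance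
    \<open>1 / (j + 1)\<close>, so that a higher level implies all lower ones.\<close>
  define Q where "Q j n \<tau> \<longleftrightarrow> \<tau> \<in> time_changes \<and> (\<forall>t\<ge>0. \<bar>\<tau> t - t\<bar> \<le> 1 / real (Suc j)) \<and>
     (\<forall>t\<in>{0..real j}. \<bar>X n (\<tau> t) - x t\<bar> \<le> 1 / real (Suc j))" for j n :: nat and \<tau>
  have Q_mono: "Q i n \<tau>" if "Q j n \<tau>" "i \<le> j" for i j n \<tau>
  proof -
    have "1 / real (Suc j) \<le> 1 / real (Suc i)" using that by (intro divide_left_mono) auto
    then show ?thesis using that unfolding Q_def
      by (meson atLeastAtMost_iff of_nat_mono order_trans)
  qed
  have "\<exists>\<tau>. \<tau> \<in> time_changes \<and> (\<forall>j\<le>n. (\<exists>\<tau>'. Q j n \<tau>') \<longrightarrow> Q j n \<tau>)" for n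
  proof (cases "\<exists>j\<le>n. \<exists>\<tau>'. Q j n \<tau>'")
    case False
    have "id \<in> time_changes" by (auto simp: time_changes_def strict_mono_on_def)
    then show ?thesis using False by blast
  next
    case True
    define J where "J = {j. j \<le> n \<and> (\<exists>\<tau>'. Q j n \<tau>')}"
    have "J \<subseteq> {..n}" by (auto simp: J_def)
    then have J: "finite J" "J \<noteq> {}" using True by (auto simp: J_def intro: finite_subset)
    have "Max J \<in> J" using J by (rule Max_in)
    then obtain \<tau> where \<tau>: "Q (Max J) n \<tau>" by (auto simp: J_def)
    have "Q j n \<tau>" if "j \<le> n" "\<exists>\<tau>'. Q j n \<tau>'" for j
      using that J by (intro Q_mono[OF \<tau>] Max_ge) (auto simp: J_def)
    moreover have "\<tau> \<in> time_changes" using \<tau> by (simp add: Q_def)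
    ultimately show ?thesis by blast
  qed
  then obtain L where L: "\<And>n. L n \<in> time_changes"
      "\<And>n j. j \<le> n \<Longrightarrow> \<exists>\<tau>'. Q j n \<tau>' \<Longrightarrow> Q j n (L n)"
    by metis
  have ev: "\<forall>\<^sub>F n in sequentially. Q j n (L n)" for j
  proof -
    have "\<forall>\<^sub>F n in sequentially. \<exists>\<tau>\<in>time_changes.
       (\<forall>t\<ge>0. \<bar>\<tau> t - t\<bar> \<le> 1 / real (Suc j)) \<and>
       (\<forall>t\<in>{0..real j}. \<bar>X n (\<tau> t) - x t\<bar> \<le> 1 / real (Suc j))"
      by (rule assms) auto
    moreover have "\<forall>\<^sub>F n in sequentially. j \<le> n" by (rule eventually_ge_at_top)
    ultimately show ?thesis
      by eventually_elim (rule L, auto simp: Q_def)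
  qed
  show ?thesis unfolding skorokhod_converges_def
  proof (intro exI[of _ L] conjI allI impI)
    show "L n \<in> time_changes" for n by (rule L)
    show "uniform_limit {0..} L (\<lambda>t. t) sequentially"
    proof (rule uniform_limitI)
      fix e :: real assume "e > 0"
      then obtain j where j: "1 / real (Suc j) < e" using nat_approx_posE by blast
      show "\<forall>\<^sub>F n in sequentially. \<forall>t\<in>{0..}. dist (L n t) t < e"
        using ev[of j] by eventually_elim (use j in \<open>force simp: Q_def dist_real_def\<close>)
    qed
    fix T :: real assume "0 \<le> T"
    show "uniform_limit {0..T} (\<lambda>n t. X n (L n t)) x sequentially"
    proof (rule uniform_limitI)
      fix e :: real assume "e > 0"
      then obtain i where i: "1 / real (Suc i) < e" using nat_approx_posE by blast
      obtain k :: nat where k: "T \<le> real k" using real_arch_simple by blast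
      define j where "j = max i k"
      have "1 / real (Suc j) \<le> 1 / real (Suc i)" by (intro divide_left_mono) (auto simp: j_def)
      then have j: "1 / real (Suc j) < e" "T \<le> real j" using i k by (auto simp: j_def)
      show "\<forall>\<^sub>F n in sequentially. \<forall>t\<in>{0..T}. dist (X n (L n t)) (x t) < e"
        using ev[of j] by eventually_elim (use j in \<open>force simp: Q_def dist_real_def\<close>)
    qed
  qed
qed

lemma Ints_eq_if_close:
  fixes a b :: real
  assumes "a \<in> \<int>" "b \<in> \<int>" "\<bar>a - b\<bar> < 1"
  shows "a = b"
  using assms by (auto elim!: Ints_cases)

text \<open>To the right, an integer within distance 1 of the integer \<open>x t\<close> equals it.
  The left limit is not known to be an integer, so on the left the values are compared with each
  other, each being within 1/2 of the limit.\<close>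

lemma integer_cadlag_locally_constant:
  assumes x: "x \<in> cadlag" "\<And>t. t \<ge> 0 \<Longrightarrow> x t \<in> \<int>" and t: "t \<ge> 0"
  obtains d where "d > 0"
    "\<And>u. t \<le> u \<Longrightarrow> u < t + d \<Longrightarrow> x u = x t"
    "\<And>u w. 0 \<le> u \<Longrightarrow> 0 \<le> w \<Longrightarrow> t - d < u \<Longrightarrow> u < t \<Longrightarrow> t - d < w \<Longrightarrow> w < t \<Longrightarrow> x u = x w"
proof -
  have "(x \<longlongrightarrow> x t) (at_right t)"
    using x t by (auto simp: cadlag_def continuous_within)
  then have "\<forall>\<^sub>F u in at_right t. dist (x u) (x t) < 1" by (rule tendstoD) simp
  then obtain b where b: "b > t" "\<And>u. t < u \<Longrightarrow> u < b \<Longrightarrow> dist (x u) (x t) < 1"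
    unfolding eventually_at_right_field by blast
  have 1: "x u = x t" if "t \<le> u" "u < b" for u
    using that b(2)[of u] x(2)[of u] x(2)[of t] t
    by (cases "u = t") (auto simp: dist_real_def intro!: Ints_eq_if_close)
  have "\<exists>a<t. \<forall>u w. 0 \<le> u \<longrightarrow> 0 \<le> w \<longrightarrow> a < u \<longrightarrow> u < t \<longrightarrow> a < w \<longrightarrow> w < t \<longrightarrow> x u = x w"
  proof (cases "t = 0")
    case True
    then show ?thesis by (intro exI[of _ "-1"]) auto
  next
    case False
    then have "t > 0" using t by simp
    with x(1) obtain l where "(x \<longlongrightarrow> l) (at_left t)" unfolding cadlag_def by blast
    then have "\<forall>\<^sub>F u in at_left t. dist (x u) l < 1/2" by (rule tendstoD) simp
    then obtain a where a: "a < t" "\<And>u. a < u \<Longrightarrow> u < t \<Longrightarrow> dist (x u) l < 1/2"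
      unfolding eventually_at_left_field by blast
    have "x u = x w" if "0 \<le> u" "0 \<le> w" "a < u" "u < t" "a < w" "w < t" for u w
    proof (rule Ints_eq_if_close)
      show "\<bar>x u - x w\<bar> < 1" using a(2)[of u] a(2)[of w] that by (auto simp: dist_real_def abs_if split: if_splits)
    qed (use that x in auto)
    then show ?thesis using a(1) by blast
  qed
  then obtain a where a: "a < t"
    "\<And>u w. 0 \<le> u \<Longrightarrow> 0 \<le> w \<Longrightarrow> a < u \<Longrightarrow> u < t \<Longrightarrow> a < w \<Longrightarrow> w < t \<Longrightarrow> x u = x w" by blast
  show thesis
  proof (rule that[of "min (b - t) (t - a)"])
    show "min (b - t) (t - a) > 0" using a b by simp
    show "x u = x t" if "t \<le> u" "u < t + min (b - t) (t - a)" for u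
      using that by (intro 1) auto
    show "x u = x w" if "0 \<le> u" "0 \<le> w" "t - min (b - t) (t - a) < u" "u < t"
        "t - min (b - t) (t - a) < w" "w < t" for u w
      using that by (intro a(2)) auto
  qed
qed

text \<open>Compactness, in the form of \<open>Bolzano\<close>, patches the local statements
  together with finitely many possible jump points. The conclusion says that a value depends only on
  which points of \<open>S\<close> have been passed, which is the form in which time-changed paths
  are compared.\<close>

lemma integer_cadlag_jumps:
  assumes x: "x \<in> cadlag" "\<And>t. t \<ge> 0 \<Longrightarrow> x t \<in> \<int>" and T: "T \<ge> 0"
  obtains S where "finite S" "S \<subseteq> {0<..T}"
    "\<And>t u. t \<in> {0..T} \<Longrightarrow> u \<in> {0..T} \<Longrightarrow> (\<And>s. s \<in> S \<Longrightarrow> s \<le> t \<longleftrightarrow> s \<le> u) \<Longrightarrow> x t = x u"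
proof -
  \<comment> \<open>\<open>Bolzano\<close> tests all small intervals around a point, including those
    that start left of 0, which the premise \<open>0 \<le> a\<close> discards.\<close>
  define P where "P a b \<longleftrightarrow> (0 \<le> a \<longrightarrow> (\<exists>S. finite S \<and> S \<subseteq> {a<..b} \<and>
      (\<forall>t\<in>{a..b}. \<forall>u\<in>{a..b}. (\<forall>s\<in>S. s \<le> t \<longleftrightarrow> s \<le> u) \<longrightarrow> x t = x u)))" for a b
  have "P 0 T"
  proof (rule Bolzano[OF T])
    fix a b c assume ab: "P a b" and bc: "P b c" and le: "a \<le> b" "b \<le> c"
    show "P a c" unfolding P_def
    proof
      assume "0 \<le> a"
      then have "0 \<le> b" using le by simp
      obtain S1 where S1: "finite S1" "S1 \<subseteq> {a<..b}"
        "\<And>t u. t\<in>{a..b} \<Longrightarrow> u\<in>{a..b} \<Longrightarrow> (\<forall>s\<in>S1. s \<le> t \<longleftrightarrow> s \<le> u) \<Longrightarrow> x t = x u"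
        using ab \<open>0 \<le> a\<close> unfolding P_def by blast
      obtain S2 where S2: "finite S2" "S2 \<subseteq> {b<..c}"
        "\<And>t u. t\<in>{b..c} \<Longrightarrow> u\<in>{b..c} \<Longrightarrow> (\<forall>s\<in>S2. s \<le> t \<longleftrightarrow> s \<le> u) \<Longrightarrow> x t = x u"
        using bc \<open>0 \<le> b\<close> unfolding P_def by blast
      have mixed: "x t = x u" if "t \<in> {a..b}" "u \<in> {b..c}" "\<forall>s\<in>S1 \<union> S2. s \<le> t \<longleftrightarrow> s \<le> u" for t u
      proof -
        have "x t = x b" using that S1(2) by (intro S1(3)) fastforce+
        also have "x b = x u"
        proof (intro S2(3) ballI)
          fix s assume s: "s \<in> S2"
          have "b < s" using S2(2) s by auto
          moreover have "s \<le> t \<longleftrightarrow> s \<le> u" using that s by blast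
          ultimately show "s \<le> b \<longleftrightarrow> s \<le> u" using that(1) by auto
        qed (use that le in auto)
        finally show ?thesis .
      qed
      have "x t = x u" if "t \<in> {a..c}" "u \<in> {a..c}" "\<forall>s\<in>S1 \<union> S2. s \<le> t \<longleftrightarrow> s \<le> u" for t u
      proof (cases "t \<le> b"; cases "u \<le> b")
        assume "t \<le> b" "u \<le> b" then show ?thesis using that by (intro S1(3)) auto
      next
        assume "t \<le> b" "\<not> u \<le> b" then show ?thesis using that by (intro mixed) auto
      next
        assume "\<not> t \<le> b" "u \<le> b" then show ?thesis using that by (intro mixed[symmetric]) auto
      next
        assume "\<not> t \<le> b" "\<not> u \<le> b" then show ?thesis using that by (intro S2(3)) auto
      qed
      then have "\<forall>t\<in>{a..c}. \<forall>u\<in>{a..c}. (\<forall>s\<in>S1 \<union> S2. s \<le> t \<longleftrightarrow> s \<le> u) \<longrightarrow> x t = x u" by blast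
      then show "\<exists>S. finite S \<and> S \<subseteq> {a<..c} \<and>
          (\<forall>t\<in>{a..c}. \<forall>u\<in>{a..c}. (\<forall>s\<in>S. s \<le> t \<longleftrightarrow> s \<le> u) \<longrightarrow> x t = x u)"
      proof (intro exI[of _ "S1 \<union> S2"] conjI)
        show "S1 \<union> S2 \<subseteq> {a<..c}" using S1(2) S2(2) le by auto
        show "finite (S1 \<union> S2)" using S1(1) S2(1) by simp
      qed
    qed
  next
    fix t assume "0 \<le> t" "t \<le> T"
    then obtain d where d: "d > 0"
      "\<And>u. t \<le> u \<Longrightarrow> u < t + d \<Longrightarrow> x u = x t"
      "\<And>u w. 0 \<le> u \<Longrightarrow> 0 \<le> w \<Longrightarrow> t - d < u \<Longrightarrow> u < t \<Longrightarrow> t - d < w \<Longrightarrow> w < t \<Longrightarrow> x u = x w"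
      using integer_cadlag_locally_constant[OF x] by metis
    show "\<exists>d>0. \<forall>a b. a \<le> t \<and> t \<le> b \<and> b - a < d \<longrightarrow> P a b"
    proof (intro exI[of _ d] conjI allI impI d(1))
      fix a b assume ab: "a \<le> t \<and> t \<le> b \<and> b - a < d"
      \<comment> \<open>If the interval starts at \<open>t\<close>, right continuity makes the path
        constant on it, and the set of jump points is empty.\<close>
      show "P a b" unfolding P_def
      proof (intro impI exI[of _ "{t} \<inter> {a<..}"] conjI ballI)
        fix u w assume u: "u \<in> {a..b}" and w: "w \<in> {a..b}" and 0: "0 \<le> a"
          and uw: "\<forall>s\<in>{t} \<inter> {a<..}. s \<le> u \<longleftrightarrow> s \<le> w"
        show "x u = x w"
        proof (cases "t \<le> u \<and> t \<le> w")
          case True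
          then show ?thesis using d(2)[of u] d(2)[of w] ab u w by auto
        next
          case False
          then have "u < t" "w < t" using uw u w ab by auto
          then show ?thesis using ab u w 0 by (intro d(3)) auto
        qed
      qed (use ab in auto)
    qed
  qed
  then obtain S where "finite S" "S \<subseteq> {0<..T}"
      "\<forall>t\<in>{0..T}. \<forall>u\<in>{0..T}. (\<forall>s\<in>S. s \<le> t \<longleftrightarrow> s \<le> u) \<longrightarrow> x t = x u"
    unfolding P_def by blast
  then show thesis by (intro that[of S]) blast+
qed

section \<open>Aligning jumps by a time change\<close>

text \<open>\<open>\<tau>\<close> is the identity plus a triangular hat of half-width
  \<open>r\<close> and height \<open>\<sigma> s - s\<close> at each \<open>s\<close>. Separation by
  \<open>r\<close> makes the other hats vanish at \<open>s\<close>, and \<open>r \<le> s\<close>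
  keeps 0 fixed. A unit hat has slope at most \<open>1 / r\<close>, so a total height below
  \<open>r\<close> leaves \<open>\<tau>\<close> strictly increasing.\<close>

lemma hat_time_change:
  fixes S :: "real set" and \<sigma> :: "real \<Rightarrow> real"
  assumes S: "finite S" and r: "r > 0" "\<And>s. s \<in> S \<Longrightarrow> r \<le> s"
      "\<And>s s'. s \<in> S \<Longrightarrow> s' \<in> S \<Longrightarrow> s \<noteq> s' \<Longrightarrow> r \<le> \<bar>s - s'\<bar>"
    and e: "(\<Sum>s\<in>S. \<bar>\<sigma> s - s\<bar>) \<le> e" "e < r"
  obtains \<tau> where "\<tau> \<in> time_changes" "\<And>s. s \<in> S \<Longrightarrow> \<tau> s = \<sigma> s"
    "\<And>t. \<bar>\<tau> t - t\<bar> \<le> e"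
proof -
  define h where "h s t = max 0 (1 - \<bar>t - s\<bar> / r)" for s t :: real
  define \<tau> where "\<tau> t = t + (\<Sum>s\<in>S. (\<sigma> s - s) * h s t)" for t
  have h01: "0 \<le> h s t" "h s t \<le> 1" for s t using r by (auto simp: h_def)
  have hL: "\<bar>h s u - h s t\<bar> \<le> \<bar>u - t\<bar> / r" for s t u
  proof -
    have "\<bar>h s u - h s t\<bar> \<le> \<bar>\<bar>t - s\<bar> / r - \<bar>u - s\<bar> / r\<bar>" 
    proof -
      have "\<bar>max 0 (1 - A) - max 0 (1 - B)\<bar> \<le> \<bar>B - A\<bar>" for A B :: real by (auto simp: max_def)
      then show ?thesis unfolding h_def .
    qed
    also have "\<dots> = \<bar>\<bar>t - s\<bar> - \<bar>u - s\<bar>\<bar> / r" using r(1) by (simp add: diff_divide_distrib[symmetric] abs_divide)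
    also have "\<dots> \<le> \<bar>u - t\<bar> / r" using r(1) by (intro divide_right_mono) auto
    finally show ?thesis .
  qed
  have e0: "e \<ge> 0" by (rule order.trans[OF _ e(1)]) (simp add: sum_nonneg)
  have close: "\<bar>\<tau> t - t\<bar> \<le> e" for t
  proof -
    have "\<bar>\<tau> t - t\<bar> \<le> (\<Sum>s\<in>S. \<bar>(\<sigma> s - s) * h s t\<bar>)" unfolding \<tau>_def by simp
    also have "\<dots> \<le> (\<Sum>s\<in>S. \<bar>\<sigma> s - s\<bar>)"
      using h01 by (intro sum_mono) (auto simp: abs_mult intro!: mult_left_le)
    finally show ?thesis using e by linarith
  qed
  have at: "\<tau> s = \<sigma> s" if "s \<in> S" for s
  proof -
    have "(\<Sum>s'\<in>S. (\<sigma> s' - s') * h s' s) = (\<Sum>s'\<in>{s}. (\<sigma> s' - s') * h s' s)"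
    proof (rule sum.mono_neutral_right)
      show "\<forall>s'\<in>S - {s}. (\<sigma> s' - s') * h s' s = 0"
      proof
        fix s' assume "s' \<in> S - {s}"
        then have "r \<le> \<bar>s - s'\<bar>" using that by (intro r(3)) auto
        then show "(\<sigma> s' - s') * h s' s = 0" using r(1) by (simp add: h_def max_def field_simps)
      qed
    qed (use S that in auto)
    then show ?thesis by (simp add: \<tau>_def h_def)
  qed
  have mono: "\<tau> t < \<tau> u" if "t < u" for t u
  proof -
    have "\<tau> u - \<tau> t = (u - t) + (\<Sum>s\<in>S. (\<sigma> s - s) * (h s u - h s t))"
      unfolding \<tau>_def by (simp add: right_diff_distrib sum_subtractf)
    moreover have "\<bar>\<Sum>s\<in>S. (\<sigma> s - s) * (h s u - h s t)\<bar> \<le> (\<Sum>s\<in>S. \<bar>\<sigma> s - s\<bar> * (\<bar>u - t\<bar> / r))"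
      by (rule order.trans[OF sum_abs sum_mono]) (simp only: abs_mult, intro mult_left_mono hL abs_ge_zero)
    moreover have "(\<Sum>s\<in>S. \<bar>\<sigma> s - s\<bar> * (\<bar>u - t\<bar> / r)) \<le> e * (\<bar>u - t\<bar> / r)"
      unfolding sum_distrib_right[symmetric] using e r by (intro mult_right_mono) auto
    moreover have "e * (\<bar>u - t\<bar> / r) < u - t"
    proof -
      have "e * (u - t) < r * (u - t)" using that e(2) by (intro mult_strict_right_mono) auto
      then show ?thesis using that r(1) by (simp add: field_simps)
    qed
    ultimately show ?thesis by linarith
  qed
  have z: "\<tau> 0 = 0"
  proof -
    have "h s 0 = 0" if "s \<in> S" for s
      using r(2)[OF that] r(1) by (simp add: h_def max_def field_simps)
    then show ?thesis by (simp add: \<tau>_def)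
  qed
  have cont: "continuous_on A \<tau>" for A
    unfolding \<tau>_def h_def by (intro continuous_intros) (use r(1) in auto)
  have "bij_betw \<tau> {0..} {0..}" unfolding bij_betw_def
  proof
    show "inj_on \<tau> {0..}" using mono by (metis inj_onI less_irrefl linorder_neqE_linordered_idom)
    show "\<tau> ` {0..} = {0..}"
    proof (intro equalityI subsetI)
      fix y assume "y \<in> \<tau> ` {0..}"
      then show "y \<in> {0..}" using mono z by (metis atLeast_iff image_iff order.order_iff_strict)
    next
      fix y :: real assume y: "y \<in> {0..}"
      have "\<exists>t. 0 \<le> t \<and> t \<le> y + e \<and> \<tau> t = y"
      proof (rule IVT'[OF _ _ _ cont])
        show "y \<le> \<tau> (y + e)" using close[of "y + e"] by linarith
      qed (use z y e0 in auto)
      then show "y \<in> \<tau> ` {0..}" by auto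
    qed
  qed
  then have "\<tau> \<in> time_changes" using mono by (auto simp: time_changes_def strict_mono_on_def)
  then show thesis using that at close by blast
qed

lemma finite_separation:
  fixes S :: "real set"
  assumes "finite S" "S \<subseteq> {0<..}"
  obtains r where "r > 0" "\<And>s. s \<in> S \<Longrightarrow> r \<le> s"
    "\<And>s s'. s \<in> S \<Longrightarrow> s' \<in> S \<Longrightarrow> s \<noteq> s' \<Longrightarrow> r \<le> \<bar>s - s'\<bar>"
proof -
  define D where "D = insert 1 (S \<union> ((\<lambda>(s, s'). \<bar>s - s'\<bar>) ` (S \<times> S) - {0}))"
  have D: "finite D" "D \<noteq> {}" using assms by (auto simp: D_def)
  have pos: "d > 0" if "d \<in> D" for d using that assms by (auto simp: D_def)
  show thesis
  proof (rule that[of "Min D"])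
    show "Min D > 0" using pos D Min_in by blast
    show "Min D \<le> s" if "s \<in> S" for s using D that by (intro Min_le) (auto simp: D_def)
    show "Min D \<le> \<bar>s - s'\<bar>" if "s \<in> S" "s' \<in> S" "s \<noteq> s'" for s s'
      using D that by (intro Min_le) (auto simp: D_def image_iff intro!: bexI)
  qed
qed

text \<open>\<open>L n\<close> is a clock close to the identity, and \<open>X n\<close> is
  \<open>x\<close> read by it. By \<open>L_rc\<close> the clock has reached a jump \<open>s\<close>
  of \<open>x\<close> exactly from some time \<open>\<sigma> s\<close> on, which is close to
  \<open>s\<close>. A time change with \<open>\<tau> s = \<sigma> s\<close> makes
  \<open>X n (\<tau> t)\<close> and \<open>x t\<close> equal, not merely close, up to the
  horizon.\<close>

lemma skorokhod_converges_random_time: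
  fixes L :: "nat \<Rightarrow> real \<Rightarrow> real"
  assumes x: "x \<in> cadlag" "\<And>t. t \<ge> 0 \<Longrightarrow> x t \<in> \<int>"
    and L0: "\<And>n y. 0 \<le> L n y" and L_mono: "\<And>n y z. y \<le> z \<Longrightarrow> L n y \<le> L n z"
    and L_rc: "\<And>n s z. 0 < s \<Longrightarrow> s \<le> L n z \<Longrightarrow> \<exists>\<sigma>. \<forall>y. s \<le> L n y \<longleftrightarrow> \<sigma> \<le> y"
    and L_lim: "\<And>y. y \<ge> 0 \<Longrightarrow> (\<lambda>n. L n y) \<longlonglongrightarrow> y"
    and X: "\<And>T. T \<ge> 0 \<Longrightarrow> \<forall>\<^sub>F n in sequentially. \<forall>y\<in>{0..T}. X n y = x (L n y)"
  shows "skorokhod_converges X x"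
proof (rule skorokhod_convergesI)
  fix T e :: real assume T: "T \<ge> 0" and e: "e > 0"
  \<comment> \<open>The extra unit leaves room for the time change, which exceeds \<open>T\<close>
    by at most 1/4, and for the clock, which stays below \<open>T + 1\<close> up to time
    \<open>T + 1/2\<close>.\<close>
  obtain S where S: "finite S" "S \<subseteq> {0<..T+1}"
    "\<And>t u. t \<in> {0..T+1} \<Longrightarrow> u \<in> {0..T+1} \<Longrightarrow> (\<And>s. s \<in> S \<Longrightarrow> s \<le> t \<longleftrightarrow> s \<le> u) \<Longrightarrow> x t = x u"
    using integer_cadlag_jumps[OF x, of "T+1"] T by (metis add_nonneg_nonneg zero_le_one)
  have "S \<subseteq> {0<..}" using S by auto
  then obtain r where r: "r > 0" "\<And>s. s \<in> S \<Longrightarrow> r \<le> s"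
    "\<And>s s'. s \<in> S \<Longrightarrow> s' \<in> S \<Longrightarrow> s \<noteq> s' \<Longrightarrow> r \<le> \<bar>s - s'\<bar>"
    using finite_separation[OF S(1)] by blast
  \<comment> \<open>\<open>e' < r\<close> is the slope condition of \<open>hat_time_change\<close>,
    and 1/4 protects the horizon. Dividing by the number of jumps in \<open>\<eta>\<close> bounds
    the sum of all displacements by \<open>e'\<close>.\<close>
  define e' where "e' = min e (min (r / 2) (1 / 4))"
  define \<eta> where "\<eta> = e' / real (Suc (card S))"
  have e': "e' > 0" "e' \<le> e" "e' < r" "e' \<le> 1/4" using e r by (auto simp: e'_def)
  have \<eta>: "\<eta> > 0" "\<eta> \<le> e'" "real (card S) * \<eta> \<le> e'"
    using e' by (auto simp: \<eta>_def field_simps)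
  have "\<forall>\<^sub>F n in sequentially. L n (s - \<eta>) < s \<and> s \<le> L n (s + \<eta>)" if "s \<in> S" for s
  proof (intro eventually_conj)
    have s: "s - \<eta> \<ge> 0" using r(2)[OF that] \<eta> e' by linarith
    show "\<forall>\<^sub>F n in sequentially. L n (s - \<eta>) < s"
      using order_tendstoD(2)[OF L_lim[OF s], of s] \<eta> by simp
    have s: "s + \<eta> \<ge> 0" using r(1) r(2)[OF that] \<eta> e' by linarith
    show "\<forall>\<^sub>F n in sequentially. s \<le> L n (s + \<eta>)"
      using order_tendstoD(1)[OF L_lim[OF s], of s] \<eta> by (auto elim: eventually_mono)
  qed
  then have "\<forall>\<^sub>F n in sequentially. \<forall>s\<in>S. L n (s - \<eta>) < s \<and> s \<le> L n (s + \<eta>)"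
    using S(1) by (simp add: eventually_ball_finite)
  moreover have "\<forall>\<^sub>F n in sequentially. L n (T + 1/2) < T + 1"
    using T by (intro order_tendstoD(2)[OF L_lim]) auto
  moreover have "\<forall>\<^sub>F n in sequentially. \<forall>y\<in>{0..T+1/2}. X n y = x (L n y)"
    using T by (intro X) auto
  ultimately show "\<forall>\<^sub>F n in sequentially. \<exists>\<tau>\<in>time_changes.
     (\<forall>t\<ge>0. \<bar>\<tau> t - t\<bar> \<le> e) \<and> (\<forall>t\<in>{0..T}. \<bar>X n (\<tau> t) - x t\<bar> \<le> e)"
  proof eventually_elim
    case (elim n)
    have "\<exists>\<sigma>. \<forall>y. s \<le> L n y \<longleftrightarrow> \<sigma> \<le> y" if "s \<in> S" for s
      using L_rc[of s n "s + \<eta>"] elim(1) that S(2) by auto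
    then obtain \<sigma> where \<sigma>: "\<And>s y. s \<in> S \<Longrightarrow> s \<le> L n y \<longleftrightarrow> \<sigma> s \<le> y" by metis
    have "\<bar>\<sigma> s - s\<bar> \<le> \<eta>" if "s \<in> S" for s
      using elim(1) that \<sigma>[OF that, of "s - \<eta>"] \<sigma>[OF that, of "s + \<eta>"] by force
    then have "(\<Sum>s\<in>S. \<bar>\<sigma> s - s\<bar>) \<le> (\<Sum>s\<in>S. \<eta>)" by (intro sum_mono) auto
    then have sum: "(\<Sum>s\<in>S. \<bar>\<sigma> s - s\<bar>) \<le> e'" using \<eta>(3) by simp
    obtain \<tau> where \<tau>: "\<tau> \<in> time_changes" "\<And>s. s \<in> S \<Longrightarrow> \<tau> s = \<sigma> s"
        "\<And>t. \<bar>\<tau> t - t\<bar> \<le> e'"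
      using hat_time_change[OF S(1) r sum e'(3)] by blast
    have mono: "\<tau> s \<le> \<tau> t \<longleftrightarrow> s \<le> t" if "s \<ge> 0" "t \<ge> 0" for s t
      using \<tau>(1) that unfolding time_changes_def
      by (metis (mono_tags, lifting) atLeast_iff linorder_not_less mem_Collect_eq
          order.order_iff_strict strict_mono_onD)
    have nn: "\<tau> t \<ge> 0" if "t \<ge> 0" for t
      using \<tau>(1) that unfolding time_changes_def by (auto dest!: bij_betwE)
    have "X n (\<tau> t) = x t" if t: "t \<in> {0..T}" for t
    proof -
      have \<tau>t: "\<tau> t \<in> {0..T+1/2}" using nn[of t] \<tau>(3)[of t] t e' by auto
      have "X n (\<tau> t) = x (L n (\<tau> t))" using elim(3) \<tau>t by blast
      also have "\<dots> = x t"
      proof (rule S(3))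
        have "L n (\<tau> t) \<le> L n (T + 1/2)" using \<tau>t by (intro L_mono) auto
        then show "L n (\<tau> t) \<in> {0..T+1}" using L0 elim(2) by auto
        show "t \<in> {0..T+1}" using t by auto
        fix s assume s: "s \<in> S"
        then have "s \<ge> 0" using S(2) by auto
        then show "s \<le> L n (\<tau> t) \<longleftrightarrow> s \<le> t" using \<sigma>[OF s] \<tau>(2)[OF s] mono[of s t] t by auto
      qed
      finally show ?thesis .
    qed
    moreover have "\<bar>\<tau> t - t\<bar> \<le> e" for t using \<tau>(3)[of t] e' by linarith
    ultimately show ?case using \<tau>(1) e by (intro bexI[of _ \<tau>]) auto
  qed
qed

lemma step_function_cadlag:
  fixes a c :: "nat \<Rightarrow> real"
  assumes K: "finite K"
  shows "(\<lambda>y\<in>{0..}. \<Sum>k | k \<in> K \<and> a k \<le> y. c k) \<in> cadlag"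
proof -
  let ?g = "\<lambda>y. \<Sum>k | k \<in> K \<and> a k \<le> y. c k"
  let ?f = "\<lambda>y\<in>{0..}. ?g y"
  have "(?f \<longlongrightarrow> ?f t) (at_right t)" if t: "t \<ge> 0" for t
  proof (rule tendsto_eventually)
    have "\<forall>\<^sub>F y in at_right t. a k \<le> y \<longleftrightarrow> a k \<le> t" for k
    proof (cases "a k \<le> t")
      case True
      then show ?thesis by (auto simp: eventually_at_right_field intro!: exI[of _ "t + 1"])
    next
      case False
      then show ?thesis by (auto simp: eventually_at_right_field intro!: exI[of _ "a k"])
    qed
    then have "\<forall>\<^sub>F y in at_right t. \<forall>k\<in>K. a k \<le> y \<longleftrightarrow> a k \<le> t"
      using K by (simp add: eventually_ball_finite)
    moreover have "\<forall>\<^sub>F y in at_right t. t < y" by (simp add: eventually_at_right_less)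
    ultimately show "\<forall>\<^sub>F y in at_right t. ?f y = ?f t"
      by eventually_elim (use t in \<open>auto intro!: sum.cong\<close>)
  qed
  moreover have "(?f \<longlongrightarrow> (\<Sum>k | k \<in> K \<and> a k < t. c k)) (at_left t)" if t: "t > 0" for t
  proof (rule tendsto_eventually)
    have "\<forall>\<^sub>F y in at_left t. a k \<le> y \<longleftrightarrow> a k < t" for k
    proof (cases "a k < t")
      case True
      then show ?thesis by (auto simp: eventually_at_left_field intro!: exI[of _ "a k"])
    next
      case False
      then show ?thesis by (auto simp: eventually_at_left_field intro!: exI[of _ "t - 1"])
    qed
    then have "\<forall>\<^sub>F y in at_left t. \<forall>k\<in>K. a k \<le> y \<longleftrightarrow> a k < t"
      using K by (simp add: eventually_ball_finite)
    moreover have "\<forall>\<^sub>F y in at_left t. 0 < y"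
      using t by (auto simp: eventually_at_left_field)
    ultimately show "\<forall>\<^sub>F y in at_left t. ?f y = (\<Sum>k | k \<in> K \<and> a k < t. c k)"
      by eventually_elim (auto intro!: sum.cong)
  qed
  ultimately show ?thesis by (auto simp: cadlag_def continuous_within)
qed

subsection \<open>Sums of powers with an exponential cutoff\<close>

text \<open>From \<open>ln z \<le> z\<close> at \<open>z = a * x / (\<beta> + 1)\<close>. Dividing
  by \<open>\<beta> + 1\<close> instead of \<open>\<beta>\<close> includes the case
  \<open>\<beta> = 0\<close>.\<close>

lemma powr_le_exp:
  fixes \<beta> a :: real
  assumes "\<beta> \<ge> 0" "a > 0"
  obtains C where "C > 0" "\<And>x. x > 0 \<Longrightarrow> x powr \<beta> \<le> C * exp (a * x)"
proof (rule that)
  define D where "D = ln ((\<beta> + 1) / a)"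
  show "exp (\<beta> * D) > 0" by simp
  fix x :: real assume x: "x > 0"
  define z where "z = a * x / (\<beta> + 1)"
  have z: "z > 0" using assms x by (simp add: z_def)
  have "x = z * ((\<beta> + 1) / a)" using assms by (simp add: z_def)
  moreover have "(\<beta> + 1) / a > 0" using assms by simp
  ultimately have "ln x = ln z + D" unfolding D_def using z ln_mult_pos by metis
  moreover have "ln z \<le> z" using ln_le_minus_one[OF z] by simp
  ultimately have "\<beta> * ln x \<le> \<beta> * z + \<beta> * D"
    using assms by (metis add_le_cancel_right distrib_left mult_left_mono)
  moreover have "\<beta> * z \<le> a * x"
    using assms x by (simp add: z_def field_simps)
  ultimately have "\<beta> * ln x \<le> a * x + \<beta> * D" by linarith
  then have "exp (\<beta> * ln x) \<le> exp (a * x + \<beta> * D)" by simp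
  then show "x powr \<beta> \<le> exp (\<beta> * D) * exp (a * x)"
    using x by (simp add: powr_def exp_add mult.commute)
qed

text \<open>The bound \<open>w \<le> exp w - 1\<close> makes each term at most a telescoping
  difference divided by \<open>w\<close>.\<close>

lemma sum_exp_decay_le:
  fixes w :: real
  assumes "w > 0" "finite A" "0 \<notin> A"
  shows "(\<Sum>k\<in>A. exp (- (real k * w))) \<le> 1 / w"
proof -
  have "(\<Sum>k=1..N. exp (- (real k * w))) \<le> (1 - exp (- (real N * w))) / w" for N
  proof (induction N)
    case (Suc N)
    have "w \<le> exp w - 1" using exp_ge_add_one_self[of w] by linarith
    then have "w * exp (- (real (Suc N) * w)) \<le> (exp w - 1) * exp (- (real (Suc N) * w))"
      by (intro mult_right_mono) auto
    also have "\<dots> = exp (- (real N * w)) - exp (- (real (Suc N) * w))"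
      by (simp add: algebra_simps exp_add[symmetric])
    finally have "exp (- (real (Suc N) * w)) \<le>
        (exp (- (real N * w)) - exp (- (real (Suc N) * w))) / w"
      using assms by (simp add: field_simps)
    then show ?case using Suc by (simp add: diff_divide_distrib)
  qed simp
  note bound = this
  obtain N where N: "A \<subseteq> {..N}" using assms(2) unfolding finite_nat_iff_bounded_le by blast
  have "(\<Sum>k\<in>A. exp (- (real k * w))) \<le> (\<Sum>k=1..N. exp (- (real k * w)))"
  proof (rule sum_mono2)
    show "A \<subseteq> {1..N}"
    proof
      fix k assume k: "k \<in> A"
      then have "k \<noteq> 0" using assms(3) by metis
      then show "k \<in> {1..N}" using N k by auto
    qed
  qed auto
  also have "\<dots> \<le> (1 - exp (- (real N * w))) / w" by (rule bound)
  also have "\<dots> \<le> 1 / w" using assms by (intro divide_right_mono) auto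
  finally show ?thesis .
qed

text \<open>Half of the exponential absorbs \<open>(k * v) powr \<beta>\<close>, and the other half
  is summed. Arbitrary finite index sets serve partial sums and tails alike.\<close>

lemma sum_powr_exp_le:
  fixes \<beta> :: real
  assumes "\<beta> \<ge> 0"
  obtains C where "C > 0"
    "\<And>v A. v > 0 \<Longrightarrow> finite A \<Longrightarrow> 0 \<notin> A \<Longrightarrow>
       (\<Sum>k\<in>A. real k powr \<beta> * exp (- (real k * v))) \<le> C * v powr (- (\<beta> + 1))"
proof -
  obtain C where C: "C > 0" "\<And>x. x > 0 \<Longrightarrow> x powr \<beta> \<le> C * exp (1/2 * x)"
    using powr_le_exp[OF assms, of "1/2"] by auto
  show thesis
  proof (rule that)
    show "2 * C > 0" using C by simp
    fix v :: real and A :: "nat set" assume v: "v > 0" and A: "finite A" "0 \<notin> A"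
    have "real k powr \<beta> * exp (- (real k * v)) \<le> C * v powr (- \<beta>) * exp (- (real k * (v / 2)))"
      if "k \<in> A" for k
    proof -
      have k: "real k > 0" using that A by (cases k) auto
      have "(real k * v) powr \<beta> \<le> C * exp (1/2 * (real k * v))" using k v by (intro C) auto
      then have "real k powr \<beta> \<le> C * v powr (- \<beta>) * exp (real k * v / 2)"
        using k v by (simp add: powr_mult powr_minus field_simps)
      then have "real k powr \<beta> * exp (- (real k * v)) \<le>
          C * v powr (- \<beta>) * exp (real k * v / 2) * exp (- (real k * v))"
        by (intro mult_right_mono) auto
      also have "\<dots> = C * v powr (- \<beta>) * exp (- (real k * (v / 2)))"
        by (simp add: mult.assoc exp_add[symmetric])
      finally show ?thesis .
    qed
    then have "(\<Sum>k\<in>A. real k powr \<beta> * exp (- (real k * v))) \<le>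
        C * v powr (- \<beta>) * (\<Sum>k\<in>A. exp (- (real k * (v / 2))))"
      unfolding sum_distrib_left by (intro sum_mono) auto
    also have "\<dots> \<le> C * v powr (- \<beta>) * (1 / (v / 2))"
      using C v A by (intro mult_left_mono sum_exp_decay_le) auto
    also have "\<dots> = 2 * C * v powr (- (\<beta> + 1))"
    proof -
      have "v powr (- (\<beta> + 1)) = v powr (- \<beta>) * v powr (- 1)" by (simp only: minus_add_distrib powr_add)
      also have "v powr (- 1) = 1 / v" using v by (simp add: powr_minus_divide)
      finally show ?thesis by simp
    qed
    finally show "(\<Sum>k\<in>A. real k powr \<beta> * exp (- (real k * v))) \<le> 2 * C * v powr (- (\<beta> + 1))" .
  qed
qed

locale power_weights =
  fixes \<alpha> :: real and \<theta> :: "nat \<Rightarrow> real"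
  assumes \<alpha>: "\<alpha> > 0" and \<theta>_nonneg: "\<And>k. k \<ge> 1 \<Longrightarrow> \<theta> k \<ge> 0"
    and \<theta>_asymp: "\<theta> \<sim>[at_top] (\<lambda>k. real k powr \<alpha>)"
begin

lemma \<theta>_relative:
  assumes "e > 0"
  obtains K where "K \<ge> 1" "\<And>k. k \<ge> K \<Longrightarrow> \<bar>\<theta> k - real k powr \<alpha>\<bar> \<le> e * real k powr \<alpha>"
proof -
  have "(\<lambda>k. \<theta> k / real k powr \<alpha>) \<longlonglongrightarrow> 1"
    using \<theta>_asymp by (rule asymp_equivD_strong) (auto intro: eventually_mono[OF eventually_gt_at_top[of 0]])
  then have "\<forall>\<^sub>F k in sequentially. dist (\<theta> k / real k powr \<alpha>) 1 < e"
    using assms by (rule tendstoD)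
  then obtain K where K: "\<And>k. k \<ge> K \<Longrightarrow> dist (\<theta> k / real k powr \<alpha>) 1 < e"
    by (auto simp: eventually_sequentially)
  show thesis
  proof (rule that[of "Suc K"])
    fix k assume k: "Suc K \<le> k"
    then have pos: "real k powr \<alpha> > 0" by simp
    have "\<bar>\<theta> k - real k powr \<alpha>\<bar> = \<bar>\<theta> k / real k powr \<alpha> - 1\<bar> * real k powr \<alpha>"
      using pos by (simp add: abs_if field_simps)
    also have "\<dots> \<le> e * real k powr \<alpha>"
      using K[of k] k pos by (intro mult_right_mono) (auto simp: dist_real_def)
    finally show "\<bar>\<theta> k - real k powr \<alpha>\<bar> \<le> e * real k powr \<alpha>" .
  qed simp
qed

lemma \<theta>_upper:
  obtains C where "C > 0" "\<And>k. k \<ge> 1 \<Longrightarrow> \<theta> k \<le> C * real k powr \<alpha>"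
proof -
  obtain K where K: "K \<ge> 1" "\<And>k. k \<ge> K \<Longrightarrow> \<bar>\<theta> k - real k powr \<alpha>\<bar> \<le> 1 * real k powr \<alpha>"
    using \<theta>_relative[of 1] by auto
  define C where "C = 2 + (\<Sum>k<K. \<bar>\<theta> k\<bar>)"
  show thesis
  proof (rule that[of C])
    show "C > 0" unfolding C_def by (intro add_pos_nonneg sum_nonneg) auto
    fix k :: nat assume k: "k \<ge> 1"
    have p: "real k powr \<alpha> \<ge> 1" using k \<alpha> by (simp add: ge_one_powr_ge_zero)
    show "\<theta> k \<le> C * real k powr \<alpha>"
    proof (cases "k < K")
      case True
      have "\<theta> k \<le> \<bar>\<theta> k\<bar>" by simp
      also have "\<dots> \<le> (\<Sum>k<K. \<bar>\<theta> k\<bar>)" using True by (intro member_le_sum) auto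
      also have "\<dots> \<le> C * 1" by (simp add: C_def)
      also have "\<dots> \<le> C * real k powr \<alpha>"
        using p by (intro mult_left_mono) (auto simp: C_def intro!: add_nonneg_nonneg sum_nonneg)
      finally show ?thesis .
    next
      case False
      then have "\<theta> k \<le> 2 * real k powr \<alpha>" using K(2)[of k] by auto
      also have "\<dots> \<le> C * real k powr \<alpha>"
        by (intro mult_right_mono) (auto simp: C_def intro!: sum_nonneg)
      finally show ?thesis .
    qed
  qed
qed

lemma \<theta>_moment_le:
  fixes j :: nat
  obtains C where "C > 0"
    "\<And>v A. v > 0 \<Longrightarrow> finite A \<Longrightarrow> 0 \<notin> A \<Longrightarrow>
       (\<Sum>k\<in>A. real k ^ j * (\<theta> k * exp (- (real k * v)))) \<le> C * v powr (- (\<alpha> + real j + 1))"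
proof -
  obtain C1 where C1: "C1 > 0" "\<And>k. k \<ge> 1 \<Longrightarrow> \<theta> k \<le> C1 * real k powr \<alpha>" using \<theta>_upper by blast
  have nn: "\<alpha> + real j \<ge> 0" using \<alpha> by simp
  obtain C2 where C2: "C2 > 0" "\<And>v A. v > 0 \<Longrightarrow> finite A \<Longrightarrow> 0 \<notin> A \<Longrightarrow>
       (\<Sum>k\<in>A. real k powr (\<alpha> + real j) * exp (- (real k * v))) \<le> C2 * v powr (- (\<alpha> + real j + 1))"
    using sum_powr_exp_le[OF nn] by blast
  show thesis
  proof (rule that[of "C1 * C2"])
    show "C1 * C2 > 0" using C1 C2 by simp
    fix v :: real and A :: "nat set" assume v: "v > 0" and A: "finite A" "0 \<notin> A"
    have "(\<Sum>k\<in>A. real k ^ j * (\<theta> k * exp (- (real k * v)))) \<le>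
        (\<Sum>k\<in>A. C1 * (real k powr (\<alpha> + real j) * exp (- (real k * v))))"
    proof (rule sum_mono)
      fix k assume "k \<in> A"
      then have k: "k \<ge> 1" using A by (cases k) auto
      have "real k ^ j * (\<theta> k * exp (- (real k * v))) \<le>
          real k ^ j * ((C1 * real k powr \<alpha>) * exp (- (real k * v)))"
        using C1(2)[OF k] by (intro mult_left_mono mult_right_mono) auto
      also have "\<dots> = C1 * (real k powr (\<alpha> + real j) * exp (- (real k * v)))"
        using k by (simp add: powr_add powr_realpow)
      finally show "real k ^ j * (\<theta> k * exp (- (real k * v))) \<le>
          C1 * (real k powr (\<alpha> + real j) * exp (- (real k * v)))" .
    qed
    also have "\<dots> \<le> C1 * (C2 * v powr (- (\<alpha> + real j + 1)))"
      unfolding sum_distrib_left[symmetric] using C1 by (intro mult_left_mono C2(2) v A) auto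
    finally show "(\<Sum>k\<in>A. real k ^ j * (\<theta> k * exp (- (real k * v)))) \<le>
        C1 * C2 * v powr (- (\<alpha> + real j + 1))" by simp
  qed
qed

text \<open>Three quarters of the exponent yield the gain \<open>exp (- (3 / 4 * B))\<close>; the
  remaining quarter keeps a sum of the usual order in \<open>v\<close>.\<close>

lemma \<theta>_tail_le:
  obtains C where "C > 0"
    "\<And>v B A. v > 0 \<Longrightarrow> finite A \<Longrightarrow> 0 \<notin> A \<Longrightarrow> (\<And>k. k \<in> A \<Longrightarrow> B \<le> real k * v) \<Longrightarrow>
       (\<Sum>k\<in>A. \<theta> k * exp (- (real k * v))) \<le> C * exp (- (3 / 4 * B)) * v powr (- (\<alpha> + 1))"
proof -
  obtain C where C: "C > 0" "\<And>v A. v > 0 \<Longrightarrow> finite A \<Longrightarrow> 0 \<notin> A \<Longrightarrow>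
       (\<Sum>k\<in>A. real k ^ 0 * (\<theta> k * exp (- (real k * v)))) \<le> C * v powr (- (\<alpha> + real 0 + 1))"
    using \<theta>_moment_le[of 0] by blast
  define D where "D = C * (1/4) powr (- (\<alpha> + 1))"
  show thesis
  proof (rule that[of D])
    show "D > 0" using C by (simp add: D_def)
    fix v B :: real and A :: "nat set"
    assume v: "v > 0" and A: "finite A" "0 \<notin> A" "\<And>k. k \<in> A \<Longrightarrow> B \<le> real k * v"
    have "(\<Sum>k\<in>A. \<theta> k * exp (- (real k * v))) \<le>
        (\<Sum>k\<in>A. exp (- (3 / 4 * B)) * (\<theta> k * exp (- (real k * (v / 4)))))"
    proof (rule sum_mono)
      fix k assume k: "k \<in> A"
      then have k1: "k \<ge> 1" using A by (cases k) auto
      have "exp (- (real k * v)) \<le> exp (- (3 / 4 * B) + - (real k * (v / 4)))"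
        using A(3)[OF k] by simp
      then have "\<theta> k * exp (- (real k * v)) \<le> \<theta> k * exp (- (3 / 4 * B) + - (real k * (v / 4)))"
        using \<theta>_nonneg[OF k1] by (intro mult_left_mono)
      then show "\<theta> k * exp (- (real k * v)) \<le> exp (- (3 / 4 * B)) * (\<theta> k * exp (- (real k * (v / 4))))"
        by (simp only: exp_add mult_ac)
    qed
    also have "\<dots> = exp (- (3 / 4 * B)) * (\<Sum>k\<in>A. \<theta> k * exp (- (real k * (v / 4))))"
      by (simp add: sum_distrib_left)
    also have "\<dots> \<le> exp (- (3 / 4 * B)) * (C * (v / 4) powr (- (\<alpha> + 1)))"
      using C(2)[of "v / 4" A] v A(1,2) by (intro mult_left_mono) auto
    also have "(v / 4) powr (- (\<alpha> + 1)) = (1/4) powr (- (\<alpha> + 1)) * v powr (- (\<alpha> + 1))"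
      using powr_mult[of "1/4" v "- (\<alpha> + 1)"] by simp
    finally show "(\<Sum>k\<in>A. \<theta> k * exp (- (real k * v))) \<le> D * exp (- (3 / 4 * B)) * v powr (- (\<alpha> + 1))"
      by (simp add: D_def mult_ac)
  qed
qed

end

subsection \<open>Elementary trigonometric estimates\<close>

text \<open>Jordan's inequality: on this interval the sine is concave, hence above its
  chord.\<close>

lemma sin_ge_chord:
  fixes y :: real
  assumes "0 \<le> y" "y \<le> pi / 2"
  shows "sin y \<ge> 2 * y / pi"
proof -
  have "convex_on {0..pi/2} (\<lambda>x. - sin x)"
  proof (rule f''_ge0_imp_convex)
    show "((\<lambda>x. - sin x) has_real_derivative - cos x) (at x)" for x :: real
      by (auto intro!: derivative_eq_intros)
    show "((\<lambda>x. - cos x) has_real_derivative sin x) (at x)" for x :: real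
      by (auto intro!: derivative_eq_intros)
    show "0 \<le> sin x" if "x \<in> {0..pi/2}" for x :: real
      using that by (intro sin_ge_zero) auto
  qed auto
  then have "- sin ((1 - 2 * y / pi) *\<^sub>R 0 + (2 * y / pi) *\<^sub>R (pi / 2)) \<le>
      (1 - 2 * y / pi) * (- sin 0) + (2 * y / pi) * (- sin (pi / 2))"
    using assms by (intro convex_onD) (auto simp: field_simps)
  then show ?thesis by simp
qed

lemma one_minus_cos_ge:
  fixes x :: real
  assumes "0 \<le> x" "x \<le> pi"
  shows "1 - cos x \<ge> 2 * x\<^sup>2 / pi\<^sup>2"
proof -
  have "x / pi \<le> sin (x / 2)" using sin_ge_chord[of "x / 2"] assms by simp
  then have "(x / pi)\<^sup>2 \<le> (sin (x / 2))\<^sup>2" using assms by (intro power_mono) auto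
  moreover have "1 - cos x = 2 * (sin (x / 2))\<^sup>2" using cos_double_sin[of "x / 2"] by simp
  ultimately show ?thesis by (simp add: power_divide)
qed

lemma one_minus_cos_le: "1 - cos x \<le> x\<^sup>2 / 2" for x :: real
proof -
  have "\<bar>sin (x / 2)\<bar> \<le> \<bar>x / 2\<bar>" by (rule abs_sin_x_le_abs_x)
  then have "(sin (x / 2))\<^sup>2 \<le> (x / 2)\<^sup>2" by (simp only: abs_le_square_iff)
  moreover have "1 - cos x = 2 * (sin (x / 2))\<^sup>2" using cos_double_sin[of "x / 2"] by simp
  ultimately show ?thesis by (simp add: power2_eq_square)
qed

lemma sin_cubic_bound:
  fixes x :: real
  assumes "x \<ge> 0"
  shows "\<bar>sin x - x\<bar> \<le> x ^ 3 / 6"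
proof -
  have "sin 0 - 0 + 0 ^ 3 / 6 \<le> sin x - x + x ^ 3 / 6"
  proof (rule DERIV_nonneg_imp_nondecreasing[OF assms])
    fix y :: real
    show "\<exists>d. ((\<lambda>x. sin x - x + x ^ 3 / 6) has_real_derivative d) (at y) \<and> 0 \<le> d"
      using one_minus_cos_le[of y]
      by (intro exI[of _ "cos y - 1 + y\<^sup>2 / 2"] conjI) (auto intro!: derivative_eq_intros)
  qed
  moreover have "sin x \<le> x" using assms by (rule sin_x_le_x)
  moreover have "x ^ 3 \<ge> 0" using assms by simp
  ultimately show ?thesis by (simp add: abs_le_iff)
qed

text \<open>Multiplying by \<open>2 * sin (t / 2)\<close> telescopes the sum, as for the Dirichlet
  kernel. The bound does not grow with the number of terms, so the length of a block of indices can
  outweigh its cosines.\<close>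

lemma sum_cos_le:
  fixes t :: real
  assumes t: "0 < t" "t \<le> pi" and "p \<le> Suc q"
  shows "(\<Sum>k=p..q. cos (real k * t)) \<le> pi / t"
proof -
  have s: "sin (t / 2) \<ge> t / pi" using sin_ge_chord[of "t / 2"] t by simp
  have "2 * sin (t / 2) * (\<Sum>k=p..q. cos (real k * t)) =
      (\<Sum>k=p..q. sin ((real (Suc k) - 1 / 2) * t) - sin ((real k - 1 / 2) * t))"
    unfolding sum_distrib_left
  proof (rule sum.cong[OF refl])
    fix k
    have "sin (real k * t + t / 2) - sin (real k * t - t / 2) = 2 * sin (t / 2) * cos (real k * t)"
      by (simp add: sin_add sin_diff)
    then show "2 * sin (t / 2) * cos (real k * t) =
        sin ((real (Suc k) - 1 / 2) * t) - sin ((real k - 1 / 2) * t)"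
      by (simp add: algebra_simps)
  qed
  also have "\<dots> = sin ((real (Suc q) - 1 / 2) * t) - sin ((real p - 1 / 2) * t)"
    using assms(3) by (subst sum_Suc_diff) auto
  also have "\<dots> \<le> 2"
    using sin_le_one[of "(real (Suc q) - 1 / 2) * t"] sin_ge_minus_one[of "(real p - 1 / 2) * t"]
    by linarith
  finally have le: "sin (t / 2) * (\<Sum>k=p..q. cos (real k * t)) \<le> 1" by simp
  show ?thesis
  proof (cases "(\<Sum>k=p..q. cos (real k * t)) \<le> 0")
    case True
    moreover have "pi / t > 0" using t by simp
    ultimately show ?thesis by linarith
  next
    case False
    then have "t / pi * (\<Sum>k=p..q. cos (real k * t)) \<le> sin (t / 2) * (\<Sum>k=p..q. cos (real k * t))"
      using s by (intro mult_right_mono) auto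
    with le have "t / pi * (\<Sum>k=p..q. cos (real k * t)) \<le> 1" by linarith
    then show ?thesis using t by (simp add: field_simps)
  qed
qed

subsection \<open>A local limit estimate\<close>

context power_weights
begin

definition lam :: "real \<Rightarrow> nat \<Rightarrow> real" where
  "lam v k = \<theta> k / real k * exp (- (real k * v))"

text \<open>For independent Poisson \<open>Z k\<close> with means \<open>lam v k\<close>, the sum of
  \<open>k * Z k\<close> over \<open>1 \<le> k < b\<close> has characteristic function
  \<open>exp (- damp v b t + \<i> * phase v b t)\<close>.\<close>

definition damp :: "real \<Rightarrow> nat \<Rightarrow> real \<Rightarrow> real" where
  "damp v b t = (\<Sum>k\<in>{1..<b}. lam v k * (1 - cos (real k * t)))"

definition phase :: "real \<Rightarrow> nat \<Rightarrow> real \<Rightarrow> real" where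
  "phase v b t = (\<Sum>k\<in>{1..<b}. lam v k * sin (real k * t))"

text \<open>At an integer \<open>j\<close> this is the probability that the sum just described
  equals \<open>j\<close>. The integrand is even in \<open>t\<close>, so half a period
  suffices.\<close>

definition fourier_coeff :: "real \<Rightarrow> nat \<Rightarrow> real \<Rightarrow> real" where
  "fourier_coeff v b j = integral {0..pi} (\<lambda>t. exp (- damp v b t) * cos (phase v b t - t * j)) / pi"

lemma lam_nonneg: "lam v k \<ge> 0"
proof (cases "k = 0")
  case False
  then show ?thesis using \<theta>_nonneg[of k] by (simp add: lam_def)
qed (simp add: lam_def)

lemma k_lam: "k \<ge> 1 \<Longrightarrow> real k * lam v k = \<theta> k * exp (- (real k * v))"
  by (simp add: lam_def)

text \<open>In the window \<open>1 / v \<le> k \<le> 8 / v\<close> the weight, the power and the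
  exponential all stay within constant factors.\<close>

lemma lam_lower:
  obtains c v0 where "c > 0" "v0 > 0" "v0 \<le> 1"
    "\<And>v k. 0 < v \<Longrightarrow> v < v0 \<Longrightarrow> 1 / v \<le> real k \<Longrightarrow> real k \<le> 8 / v \<Longrightarrow> lam v k \<ge> c * v powr (1 - \<alpha>)"
proof -
  obtain K where K: "K \<ge> 1" "\<And>k. k \<ge> K \<Longrightarrow> \<bar>\<theta> k - real k powr \<alpha>\<bar> \<le> 1/2 * real k powr \<alpha>"
    using \<theta>_relative[of "1/2"] by auto
  \<comment> \<open>The factors bound \<open>\<theta> k / k powr \<alpha>\<close>,
    \<open>exp (- w)\<close> and \<open>w powr (\<alpha> - 1)\<close> from below for
    \<open>w = k * v\<close> in \<open>[1, 8]\<close>; the absolute value covers both signs of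
    \<open>\<alpha> - 1\<close>.\<close>
  define c where "c = 1/2 * exp (-8) * 8 powr (- \<bar>\<alpha> - 1\<bar>)"
  show thesis
  proof (rule that[of c "1 / real K"])
    show "c > 0" by (simp add: c_def)
    show "1 / real K > 0" "1 / real K \<le> 1" using K(1) by auto
    fix v :: real and k :: nat
    assume v: "0 < v" "v < 1 / real K" and k: "1 / v \<le> real k" "real k \<le> 8 / v"
    have "real K < 1 / v" using v K(1) by (simp add: field_simps)
    then have kK: "k \<ge> K" "k \<ge> 1" using k K(1) by linarith+
    define w where "w = real k * v"
    have w: "1 \<le> w" "w \<le> 8" using k v by (auto simp: w_def field_simps)
    have "8 powr (- \<bar>\<alpha> - 1\<bar>) \<le> w powr (\<alpha> - 1)"
    proof -
      have "\<bar>\<alpha> - 1\<bar> * ln w \<le> \<bar>\<alpha> - 1\<bar> * ln 8" using w by (intro mult_left_mono) auto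
      moreover have "- (\<bar>\<alpha> - 1\<bar> * ln w) \<le> (\<alpha> - 1) * ln w"
      proof -
        have "(- \<bar>\<alpha> - 1\<bar>) * ln w \<le> (\<alpha> - 1) * ln w" using w by (intro mult_right_mono) auto
        then show ?thesis by simp
      qed
      ultimately have "- (\<bar>\<alpha> - 1\<bar> * ln 8) \<le> (\<alpha> - 1) * ln w" by linarith
      then show ?thesis using w by (simp add: powr_def)
    qed
    moreover have "real k powr (\<alpha> - 1) = w powr (\<alpha> - 1) * v powr (1 - \<alpha>)"
    proof -
      have "v powr (\<alpha> - 1) * v powr (1 - \<alpha>) = 1" using v by (simp add: powr_add[symmetric])
      then show ?thesis by (simp add: w_def powr_mult)
    qed
    ultimately have 1: "8 powr (- \<bar>\<alpha> - 1\<bar>) * v powr (1 - \<alpha>) \<le> real k powr (\<alpha> - 1)"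
      by (simp add: mult_right_mono)
    have "real k powr \<alpha> = real k powr (\<alpha> - 1) * real k" using kK powr_add[of "real k" "\<alpha> - 1" 1] by simp
    then have 2: "1/2 * real k powr (\<alpha> - 1) \<le> \<theta> k / real k"
    proof -
      have "1/2 * real k powr \<alpha> \<le> \<theta> k" using K(2)[OF kK(1)] by linarith
      then have "1/2 * real k powr (\<alpha> - 1) * real k \<le> \<theta> k" using \<open>real k powr \<alpha> = _\<close> by simp
      then show ?thesis using kK(2) by (subst pos_le_divide_eq) auto
    qed
    have 3: "exp (-8) \<le> exp (- (real k * v))" using w by (simp add: w_def)
    have "c * v powr (1 - \<alpha>) = (1/2 * (8 powr (- \<bar>\<alpha> - 1\<bar>) * v powr (1 - \<alpha>))) * exp (-8)"
      by (simp add: c_def)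
    also have "\<dots> \<le> (1/2 * real k powr (\<alpha> - 1)) * exp (-8)"
      using 1 by (intro mult_right_mono mult_left_mono) auto
    also have "\<dots> \<le> \<theta> k / real k * exp (- (real k * v))"
      using 2 3 \<theta>_nonneg[OF kK(2)] by (intro mult_mono) auto
    finally show "lam v k \<ge> c * v powr (1 - \<alpha>)" by (simp add: lam_def)
  qed
qed

text \<open>For \<open>t \<le> v\<close> the indices from \<open>1 / v\<close> to
  \<open>3 / v\<close> have \<open>k * t \<le> 3 < pi\<close>, where \<open>1 - cos\<close> has a
  quadratic lower bound. For \<open>t \<ge> v\<close> the window up to \<open>8 / v\<close> holds at
  least \<open>6 / v\<close> indices, while their cosines sum to at most
  \<open>pi / t \<le> 4 / v\<close>.\<close>

lemma damp_lower:
  obtains c v0 where "c > 0" "v0 > 0" "v0 \<le> 1"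
    "\<And>v b t. 0 < v \<Longrightarrow> v < v0 \<Longrightarrow> 8 / v + 1 \<le> real b \<Longrightarrow> 0 \<le> t \<Longrightarrow> t \<le> v \<Longrightarrow>
        c * t\<^sup>2 * v powr (- (\<alpha> + 2)) \<le> damp v b t"
    "\<And>v b t. 0 < v \<Longrightarrow> v < v0 \<Longrightarrow> 8 / v + 1 \<le> real b \<Longrightarrow> v \<le> t \<Longrightarrow> t \<le> pi \<Longrightarrow>
        c * v powr (- \<alpha>) \<le> damp v b t"
proof -
  obtain c1 v1 where c1: "c1 > 0" "v1 > 0" "v1 \<le> 1"
    "\<And>v k. 0 < v \<Longrightarrow> v < v1 \<Longrightarrow> 1 / v \<le> real k \<Longrightarrow> real k \<le> 8 / v \<Longrightarrow> lam v k \<ge> c1 * v powr (1 - \<alpha>)"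
    using lam_lower by blast
  define c where "c = c1 * min 1 (2 / pi\<^sup>2)"
  have "c \<le> c1 * 1" unfolding c_def using c1(1) by (intro mult_left_mono) auto
  moreover have "c \<le> c1 * (2 / pi\<^sup>2)" unfolding c_def using c1(1) by (intro mult_left_mono) auto
  ultimately have c: "c \<le> c1" "c \<le> c1 * (2 / pi\<^sup>2)" by auto
  have block: "(\<Sum>k\<in>{nat \<lceil>1 / v\<rceil>..nat \<lfloor>D / v\<rfloor>}. c1 * v powr (1 - \<alpha>) * (1 - cos (real k * t))) \<le> damp v b t"
    if v: "0 < v" "v < v1" and b: "8 / v + 1 \<le> real b" and D: "D \<le> 8" "D > 0" for v b t D
  proof -
    have D8: "D / v \<le> 8 / v" using v D by (intro divide_right_mono) auto
    have k: "1 / v \<le> real k" "real k \<le> 8 / v" "1 \<le> k" "k < b"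
      if "k \<in> {nat \<lceil>1 / v\<rceil>..nat \<lfloor>D / v\<rfloor>}" for k
    proof -
      have "0 < 1 / v" "0 < D / v" using v D by auto
      then show "1 / v \<le> real k" using that by simp
      with \<open>0 < 1 / v\<close> show "1 \<le> k" by (cases k) auto
      show "real k \<le> 8 / v" using that \<open>0 < D / v\<close> D8 by simp linarith
      then show "k < b" using b by linarith
    qed
    have "(\<Sum>k\<in>{nat \<lceil>1 / v\<rceil>..nat \<lfloor>D / v\<rfloor>}. c1 * v powr (1 - \<alpha>) * (1 - cos (real k * t))) \<le>
        (\<Sum>k\<in>{nat \<lceil>1 / v\<rceil>..nat \<lfloor>D / v\<rfloor>}. lam v k * (1 - cos (real k * t)))"
      using k(1,2) v by (intro sum_mono mult_right_mono c1(4)) auto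
    also have "\<dots> \<le> damp v b t" unfolding damp_def
      using k(3,4) by (intro sum_mono2) (auto simp: lam_nonneg)
    finally show ?thesis .
  qed
  \<comment> \<open>One \<open>1 / v\<close> is the start of the window, and the other pays for
    rounding, since \<open>1 \<le> 1 / v\<close>.\<close>
  have count: "(D - 2) / v \<le> real (Suc (nat \<lfloor>D / v\<rfloor>)) - real (nat \<lceil>1 / v\<rceil>)"
    "nat \<lceil>1 / v\<rceil> \<le> Suc (nat \<lfloor>D / v\<rfloor>)"
    if v: "0 < v" "v < v1" and D: "D \<ge> 2" for v D
  proof -
    have "0 < 1 / v" "0 < D / v" using v D by auto
    then have "real (nat \<lceil>1 / v\<rceil>) \<le> 1 / v + 1" "D / v \<le> real (Suc (nat \<lfloor>D / v\<rfloor>))" by linarith+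
    moreover have "1 / v \<ge> 1" using v c1(3) by simp
    ultimately show *: "(D - 2) / v \<le> real (Suc (nat \<lfloor>D / v\<rfloor>)) - real (nat \<lceil>1 / v\<rceil>)"
      unfolding diff_divide_distrib by linarith
    have "(D - 2) / v \<ge> 0" using v D by simp
    with * show "nat \<lceil>1 / v\<rceil> \<le> Suc (nat \<lfloor>D / v\<rfloor>)" by linarith
  qed
  show thesis
  proof (rule that[of c v1])
    show "c > 0" "v1 > 0" "v1 \<le> 1" using c1 by (auto simp: c_def)
  next
    fix v t :: real and b :: nat
    assume v: "0 < v" "v < v1" and b: "8 / v + 1 \<le> real b" and t: "0 \<le> t" "t \<le> v"
    let ?I = "{nat \<lceil>1 / v\<rceil>..nat \<lfloor>3 / v\<rfloor>}"
    have "2 / pi\<^sup>2 * (t / v)\<^sup>2 \<le> 1 - cos (real k * t)" if "k \<in> ?I" for k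
    proof -
      have "0 < 1 / v" "0 < 3 / v" using v by auto
      then have k: "1 / v \<le> real k" "real k \<le> 3 / v" using that by (simp, simp, linarith)
      have kt: "t / v \<le> real k * t" using mult_right_mono[OF k(1) t(1)] by simp
      have "real k * t \<le> 3 / v * v" using k t by (intro mult_mono) auto
      then have "real k * t \<le> pi" using v pi_gt3 by simp
      then have "2 * (real k * t)\<^sup>2 / pi\<^sup>2 \<le> 1 - cos (real k * t)"
        using t by (intro one_minus_cos_ge) auto
      moreover have "2 * (t / v)\<^sup>2 / pi\<^sup>2 \<le> 2 * (real k * t)\<^sup>2 / pi\<^sup>2"
        using kt t v by (intro divide_right_mono mult_left_mono power_mono) auto
      ultimately show ?thesis by simp
    qed
    then have "(\<Sum>k\<in>?I. c1 * v powr (1 - \<alpha>) * (2 / pi\<^sup>2 * (t / v)\<^sup>2)) \<le>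
        (\<Sum>k\<in>?I. c1 * v powr (1 - \<alpha>) * (1 - cos (real k * t)))"
      using c1 by (intro sum_mono mult_left_mono) auto
    also have "\<dots> \<le> damp v b t" by (rule block) (use v b in auto)
    finally have 1: "real (card ?I) * (c1 * v powr (1 - \<alpha>) * (2 / pi\<^sup>2 * (t / v)\<^sup>2)) \<le> damp v b t"
      by simp
    have "real (card ?I) = real (Suc (nat \<lfloor>3 / v\<rfloor>)) - real (nat \<lceil>1 / v\<rceil>)"
      using count(2)[OF v, of 3] by (simp add: of_nat_diff)
    then have "1 / v \<le> real (card ?I)" using count(1)[OF v, of 3] by simp
    moreover have "0 \<le> c1 * v powr (1 - \<alpha>) * (2 / pi\<^sup>2 * (t / v)\<^sup>2)" using c1(1) by simp
    ultimately have "1 / v * (c1 * v powr (1 - \<alpha>) * (2 / pi\<^sup>2 * (t / v)\<^sup>2)) \<le>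
        real (card ?I) * (c1 * v powr (1 - \<alpha>) * (2 / pi\<^sup>2 * (t / v)\<^sup>2))"
      by (rule mult_right_mono)
    moreover have "1 / v * (c1 * v powr (1 - \<alpha>) * (2 / pi\<^sup>2 * (t / v)\<^sup>2)) =
        c1 * (2 / pi\<^sup>2) * t\<^sup>2 * v powr (- (\<alpha> + 2))"
    proof -
      have "v powr (- (\<alpha> + 2)) = v powr (1 - \<alpha>) * v powr (- 3)"
        by (simp add: powr_add[symmetric] algebra_simps)
      also have "v powr (- 3) = 1 / v ^ 3" using v by (simp add: powr_minus_divide powr_numeral)
      finally show ?thesis using v by (simp add: field_simps power2_eq_square power3_eq_cube)
    qed
    moreover have "c * (t\<^sup>2 * v powr (- (\<alpha> + 2))) \<le> c1 * (2 / pi\<^sup>2) * (t\<^sup>2 * v powr (- (\<alpha> + 2)))"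
      using c by (intro mult_right_mono) auto
    ultimately show "c * t\<^sup>2 * v powr (- (\<alpha> + 2)) \<le> damp v b t" using 1 by (simp add: mult.assoc)
  next
    fix v t :: real and b :: nat
    assume v: "0 < v" "v < v1" and b: "8 / v + 1 \<le> real b" and t: "v \<le> t" "t \<le> pi"
    let ?I = "{nat \<lceil>1 / v\<rceil>..nat \<lfloor>8 / v\<rfloor>}"
    have tv: "pi / t \<le> pi / v" using v t by (intro divide_left_mono) auto
    have card: "real (card ?I) = real (Suc (nat \<lfloor>8 / v\<rfloor>)) - real (nat \<lceil>1 / v\<rceil>)"
      using count(2)[OF v, of 8] by (simp add: of_nat_diff)
    have "(\<Sum>k\<in>?I. cos (real k * t)) \<le> pi / t"
      using v t count(2)[OF v, of 8] by (intro sum_cos_le) auto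
    also have "\<dots> \<le> 4 / v" using tv v pi_less_4 by (smt (verit) divide_right_mono)
    finally have "6 / v - 4 / v \<le> (\<Sum>k\<in>?I. 1 - cos (real k * t))"
      using count(1)[OF v, of 8] card by (simp add: sum_subtractf)
    then have "1 / v \<le> (\<Sum>k\<in>?I. 1 - cos (real k * t))"
      using v by (smt (verit) diff_divide_distrib divide_right_mono)
    then have "c1 * v powr (1 - \<alpha>) * (1 / v) \<le> c1 * v powr (1 - \<alpha>) * (\<Sum>k\<in>?I. 1 - cos (real k * t))"
      using c1 by (intro mult_left_mono) auto
    also have "\<dots> = (\<Sum>k\<in>?I. c1 * v powr (1 - \<alpha>) * (1 - cos (real k * t)))"
      by (simp add: sum_distrib_left)
    also have "\<dots> \<le> damp v b t" by (rule block) (use v b in auto)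
    finally have 1: "c1 * v powr (1 - \<alpha>) * (1 / v) \<le> damp v b t" .
    have "v powr (- \<alpha>) = v powr (1 - \<alpha>) * v powr (- 1)" using powr_add[of v "1 - \<alpha>" "- 1"] by simp
    also have "v powr (- 1) = 1 / v" using v by (simp add: powr_minus_divide)
    finally have "c1 * v powr (- \<alpha>) \<le> damp v b t" using 1 by simp
    moreover have "c * v powr (- \<alpha>) \<le> c1 * v powr (- \<alpha>)" using c by (intro mult_right_mono) auto
    ultimately show "c * v powr (- \<alpha>) \<le> damp v b t" by linarith
  qed
qed

lemma continuous_damp [continuous_intros]: "continuous_on A (damp v b)"
  unfolding damp_def by (intro continuous_intros)

lemma continuous_phase [continuous_intros]: "continuous_on A (phase v b)"
  unfolding phase_def by (intro continuous_intros)

lemma damp_le: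
  assumes "(\<Sum>k\<in>{1..<b}. real k ^ 2 * lam v k) \<le> S"
  shows "damp v b t \<le> S * t\<^sup>2 / 2"
proof -
  have "damp v b t \<le> (\<Sum>k\<in>{1..<b}. lam v k * ((real k * t)\<^sup>2 / 2))"
    unfolding damp_def by (intro sum_mono mult_left_mono one_minus_cos_le lam_nonneg)
  also have "\<dots> = (\<Sum>k\<in>{1..<b}. real k ^ 2 * lam v k) * (t\<^sup>2 / 2)"
    unfolding sum_distrib_right by (intro sum.cong) (auto simp: power_mult_distrib)
  also have "\<dots> \<le> S * (t\<^sup>2 / 2)" using assms by (intro mult_right_mono) auto
  finally show ?thesis by simp
qed

text \<open>The phase is \<open>t\<close> times the mean, up to the Taylor remainder of the sine,
  which brings in the third moment. The last term replaces the mean by \<open>x\<close>.\<close>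

lemma phase_close:
  assumes "t \<ge> 0" "(\<Sum>k\<in>{1..<b}. real k ^ 3 * lam v k) \<le> S"
  shows "\<bar>phase v b t - t * x\<bar> \<le> S * t ^ 3 / 6 + t * \<bar>(\<Sum>k\<in>{1..<b}. real k * lam v k) - x\<bar>"
proof -
  let ?m = "\<Sum>k\<in>{1..<b}. real k * lam v k"
  have "\<bar>phase v b t - t * ?m\<bar> = \<bar>\<Sum>k\<in>{1..<b}. lam v k * (sin (real k * t) - real k * t)\<bar>"
    unfolding phase_def sum_distrib_left sum_subtractf[symmetric]
    by (intro arg_cong[where f = abs] sum.cong) (auto simp: algebra_simps)
  also have "\<dots> \<le> (\<Sum>k\<in>{1..<b}. lam v k * ((real k * t) ^ 3 / 6))"
  proof (rule order.trans[OF sum_abs sum_mono])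
    fix k
    show "\<bar>lam v k * (sin (real k * t) - real k * t)\<bar> \<le> lam v k * ((real k * t) ^ 3 / 6)"
      unfolding abs_mult abs_of_nonneg[OF lam_nonneg]
      by (intro mult_left_mono lam_nonneg sin_cubic_bound) (use assms(1) in auto)
  qed
  also have "\<dots> = (\<Sum>k\<in>{1..<b}. real k ^ 3 * lam v k) * (t ^ 3 / 6)"
    unfolding sum_distrib_right by (intro sum.cong) (auto simp: power_mult_distrib)
  also have "\<dots> \<le> S * (t ^ 3 / 6)" using assms by (intro mult_right_mono) auto
  finally have 1: "\<bar>phase v b t - t * ?m\<bar> \<le> S * t ^ 3 / 6" by simp
  have "\<bar>t * ?m - t * x\<bar> = t * \<bar>?m - x\<bar>"
    using assms(1) by (simp add: right_diff_distrib[symmetric] abs_mult)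
  moreover have "\<bar>phase v b t - t * x\<bar> \<le> \<bar>phase v b t - t * ?m\<bar> + \<bar>t * ?m - t * x\<bar>" by linarith
  ultimately show ?thesis using 1 by linarith
qed

text \<open>The scale \<open>s = v powr (\<alpha> / 2 + 1)\<close> is the reciprocal of the standard
  deviation up to constants. The first estimate integrates \<open>t * exp (- damp v b t)\<close>,
  which has order \<open>s * s\<close>. In the second, the integral over \<open>t \<le> s\<close>
  outweighs the rest; the tolerance \<open>d\<close> allows \<open>x\<close> to be off the mean by a
  fraction of a standard deviation.\<close>

lemma local_limit:
  obtains K c d v0 where "K > 0" "c > 0" "d > 0" "v0 > 0" "v0 \<le> 1"
    "\<And>v b j j'. 0 < v \<Longrightarrow> v < v0 \<Longrightarrow> 8 / v + 1 \<le> real b \<Longrightarrow>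
       \<bar>fourier_coeff v b j - fourier_coeff v b j'\<bar> \<le> K * \<bar>j - j'\<bar> * v powr (\<alpha> + 2)"
    "\<And>v b x. 0 < v \<Longrightarrow> v < v0 \<Longrightarrow> 8 / v + 1 \<le> real b \<Longrightarrow>
       \<bar>(\<Sum>k\<in>{1..<b}. real k * lam v k) - x\<bar> * v powr (\<alpha> / 2 + 1) \<le> d \<Longrightarrow>
       c * v powr (\<alpha> / 2 + 1) \<le> fourier_coeff v b x"
proof -
  obtain c v1 where c: "c > 0" "v1 > 0" "v1 \<le> 1"
    "\<And>v b t. 0 < v \<Longrightarrow> v < v1 \<Longrightarrow> 8 / v + 1 \<le> real b \<Longrightarrow> 0 \<le> t \<Longrightarrow> t \<le> v \<Longrightarrow>
        c * t\<^sup>2 * v powr (- (\<alpha> + 2)) \<le> damp v b t"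
    "\<And>v b t. 0 < v \<Longrightarrow> v < v1 \<Longrightarrow> 8 / v + 1 \<le> real b \<Longrightarrow> v \<le> t \<Longrightarrow> t \<le> pi \<Longrightarrow>
        c * v powr (- \<alpha>) \<le> damp v b t"
    using damp_lower by blast
  \<comment> \<open>\<open>E v\<close> bounds \<open>exp (- damp v b t)\<close> on
    \<open>v \<le> t \<le> pi\<close> and is smaller than every power of \<open>v\<close>. Adding it
    to the Gaussian bound gives one estimate valid on the whole interval.\<close>
  define E where "E v = exp (- (c * v powr (- \<alpha>)))" for v
  have decay: "exp (- damp v b t) \<le> exp (- (c * v powr (- (\<alpha> + 2)) * t\<^sup>2)) + E v"
    if "0 < v" "v < v1" "8 / v + 1 \<le> real b" "0 \<le> t" "t \<le> pi" for v b t
  proof (cases "t \<le> v")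
    case True
    then have "exp (- damp v b t) \<le> exp (- (c * v powr (- (\<alpha> + 2)) * t\<^sup>2))"
      using c(4)[OF that(1-4)] by (simp add: mult_ac)
    then show ?thesis unfolding E_def by (smt (verit) exp_gt_zero)
  next
    case False
    then have "exp (- damp v b t) \<le> E v"
      using c(5)[OF that(1-3), of t] that by (simp add: E_def)
    then show ?thesis by (smt (verit) exp_gt_zero)
  qed
  obtain C2 where C2: "C2 > 0" "\<And>v A. v > 0 \<Longrightarrow> finite A \<Longrightarrow> 0 \<notin> A \<Longrightarrow>
       (\<Sum>k\<in>A. real k ^ 1 * (\<theta> k * exp (- (real k * v)))) \<le> C2 * v powr (- (\<alpha> + real 1 + 1))"
    using \<theta>_moment_le[of 1] by blast
  obtain C3 where C3: "C3 > 0" "\<And>v A. v > 0 \<Longrightarrow> finite A \<Longrightarrow> 0 \<notin> A \<Longrightarrow>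
       (\<Sum>k\<in>A. real k ^ 2 * (\<theta> k * exp (- (real k * v)))) \<le> C3 * v powr (- (\<alpha> + real 2 + 1))"
    using \<theta>_moment_le[of 2] by blast
  have m2: "(\<Sum>k\<in>{1..<b}. real k ^ 2 * lam v k) \<le> C2 * v powr (- (\<alpha> + 2))" if "v > 0" for v b
  proof -
    have "(\<Sum>k\<in>{1..<b}. real k ^ 2 * lam v k) = (\<Sum>k\<in>{1..<b}. real k ^ 1 * (\<theta> k * exp (- (real k * v))))"
      by (intro sum.cong) (auto simp: k_lam[symmetric] power2_eq_square)
    also have "\<dots> \<le> C2 * v powr (- (\<alpha> + real 1 + 1))" using that by (intro C2(2)) auto
    finally show ?thesis by (simp add: add.assoc)
  qed
  have m3: "(\<Sum>k\<in>{1..<b}. real k ^ 3 * lam v k) \<le> C3 * v powr (- (\<alpha> + 3))" if "v > 0" for v b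
  proof -
    have "(\<Sum>k\<in>{1..<b}. real k ^ 3 * lam v k) = (\<Sum>k\<in>{1..<b}. real k ^ 2 * (\<theta> k * exp (- (real k * v))))"
      by (intro sum.cong) (auto simp: k_lam[symmetric] power2_eq_square power3_eq_cube)
    also have "\<dots> \<le> C3 * v powr (- (\<alpha> + real 2 + 1))" using that by (intro C3(2)) auto
    finally show ?thesis by (simp add: add.assoc)
  qed
  \<comment> \<open>On \<open>t \<le> s\<close> the damping is at most \<open>C2 / 2\<close> and the
    cosine at least 1/2, so \<open>g\<close> bounds the integrand from below. \<open>R\<close> is
    chosen so that the Gaussian part beyond \<open>R * s\<close> contributes at most
    \<open>g * s / 4\<close>.\<close>
  define g where "g = exp (- (C2 / 2)) / 2"
  define R where "R = max 1 (4 / (c * g))"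
  have g: "g > 0" by (simp add: g_def)
  have R: "R \<ge> 1" "1 / (c * R) \<le> g / 4"
  proof -
    have "4 / (c * g) \<le> R" by (simp add: R_def)
    then have "4 \<le> R * (c * g)" using c(1) g by (simp add: pos_divide_le_eq)
    moreover have "c * R > 0" using c(1) by (simp add: R_def)
    ultimately show "1 / (c * R) \<le> g / 4" by (simp add: pos_divide_le_eq mult_ac)
  qed (simp add: R_def)
  have "\<forall>\<^sub>F v in at_right 0. E v \<le> v powr (\<alpha> + 2)"
    unfolding E_def using c(1) \<alpha> by real_asymp
  moreover have "\<forall>\<^sub>F v in at_right 0. E v \<le> g / (4 * pi) * v powr (\<alpha> / 2 + 1)"
  proof -
    define h where "h = g / (4 * pi)"
    have "h > 0" using g by (simp add: h_def)
    then show ?thesis unfolding E_def h_def[symmetric] using c(1) \<alpha> by real_asymp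
  qed
  moreover have "\<forall>\<^sub>F v in at_right 0. C3 * R ^ 3 / 6 * v powr (\<alpha> / 2) \<le> 1 / 2"
  proof -
    define h where "h = C3 * R ^ 3 / 6"
    have "h > 0" using C3 R by (simp add: h_def)
    then show ?thesis unfolding h_def[symmetric] using \<alpha> by real_asymp
  qed
  moreover have "\<forall>\<^sub>F v in at_right 0. R * v powr (\<alpha> / 2 + 1) \<le> 1"
    using R(1) \<alpha> by real_asymp
  moreover have "\<forall>\<^sub>F v in at_right 0. v < v1" using c(2) by (simp add: eventually_at_right_field) blast
  ultimately have "\<forall>\<^sub>F v in at_right 0. E v \<le> v powr (\<alpha> + 2) \<and> E v \<le> g / (4 * pi) * v powr (\<alpha> / 2 + 1) \<and>
      C3 * R ^ 3 / 6 * v powr (\<alpha> / 2) \<le> 1 / 2 \<and> R * v powr (\<alpha> / 2 + 1) \<le> 1 \<and> v < v1"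
    by eventually_elim blast
  then obtain v2 where v2: "v2 > 0"
    "\<And>v. 0 < v \<Longrightarrow> v < v2 \<Longrightarrow> E v \<le> v powr (\<alpha> + 2)"
    "\<And>v. 0 < v \<Longrightarrow> v < v2 \<Longrightarrow> E v \<le> g / (4 * pi) * v powr (\<alpha> / 2 + 1)"
    "\<And>v. 0 < v \<Longrightarrow> v < v2 \<Longrightarrow> C3 * R ^ 3 / 6 * v powr (\<alpha> / 2) \<le> 1 / 2"
    "\<And>v. 0 < v \<Longrightarrow> v < v2 \<Longrightarrow> R * v powr (\<alpha> / 2 + 1) \<le> 1"
    "\<And>v. 0 < v \<Longrightarrow> v < v2 \<Longrightarrow> v < v1"
    unfolding eventually_at_right_field by blast
  define f where "f v b x t = exp (- damp v b t) * cos (phase v b t - t * x)" for v b x t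
  have f_int: "f v b x integrable_on {p..q}" for v b x p q
    unfolding f_def by (intro integrable_continuous_interval continuous_intros)
  show thesis
  proof (rule that[of "(1 / (2 * c) + pi\<^sup>2) / pi" "g / (2 * pi)" "1 / (2 * R)" "min v2 1"])
    show "(1 / (2 * c) + pi\<^sup>2) / pi > 0" using c(1) by (intro divide_pos_pos add_pos_pos) auto
    show "g / (2 * pi) > 0" "1 / (2 * R) > 0" "min v2 1 > 0" "min v2 1 \<le> 1"
      using g R(1) v2(1) by auto
  next
    fix v :: real and b :: nat and j j' :: real
    assume v: "0 < v" "v < min v2 1" and b: "8 / v + 1 \<le> real b"
    define a where "a = c * v powr (- (\<alpha> + 2))"
    have a: "a > 0" using c(1) v by (simp add: a_def)
    have inv_a: "1 / (2 * a) = 1 / (2 * c) * v powr (\<alpha> + 2)"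
      unfolding a_def powr_minus by (simp add: divide_simps)
    have v1: "v < v1" "E v \<le> v powr (\<alpha> + 2)" using v v2 by auto
    \<comment> \<open>The factor \<open>t\<close>, which comes from the difference of two cosines,
      gives the Gaussian an elementary antiderivative.\<close>
    have "((\<lambda>t. t * exp (- (a * t\<^sup>2))) has_integral
        (- exp (- (a * pi\<^sup>2)) / (2 * a) - (- exp (- (a * 0\<^sup>2)) / (2 * a)))) {0..pi}"
      using a by (intro fundamental_theorem_of_calculus)
        (auto intro!: derivative_eq_intros simp: has_real_derivative_iff_has_vector_derivative[symmetric] field_simps)
    moreover have "((\<lambda>t::real. pi * E v) has_integral (pi * E v) * (pi - 0)) {0..pi}"
      using has_integral_const_real[of "pi * E v" 0 pi] by (simp add: mult_ac)
    ultimately have H: "((\<lambda>t. t * exp (- (a * t\<^sup>2)) + pi * E v) has_integral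
        (1 - exp (- (a * pi\<^sup>2))) / (2 * a) + pi\<^sup>2 * E v) {0..pi}"
      by (rule has_integral_add[THEN has_integral_eq_rhs])
        (simp add: diff_divide_distrib power2_eq_square)
    have H2: "((\<lambda>t. (t * exp (- (a * t\<^sup>2)) + pi * E v) * \<bar>j - j'\<bar>) has_integral
        ((1 - exp (- (a * pi\<^sup>2))) / (2 * a) + pi\<^sup>2 * E v) * \<bar>j - j'\<bar>) {0..pi}"
      by (rule has_integral_mult_left[OF H])
    have "norm (integral {0..pi} (\<lambda>t. f v b j t - f v b j' t)) \<le>
        integral {0..pi} (\<lambda>t. (t * exp (- (a * t\<^sup>2)) + pi * E v) * \<bar>j - j'\<bar>)"
    proof (rule integral_norm_bound_integral)
      show "(\<lambda>t. f v b j t - f v b j' t) integrable_on {0..pi}" by (intro integrable_diff f_int)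
      show "(\<lambda>t. (t * exp (- (a * t\<^sup>2)) + pi * E v) * \<bar>j - j'\<bar>) integrable_on {0..pi}"
        using H2 by blast
      fix t assume t: "t \<in> {0..pi}"
      have "\<bar>cos (phase v b t - t * j) - cos (phase v b t - t * j')\<bar> \<le> t * \<bar>j - j'\<bar>"
      proof -
        have "cos x - cos y = 2 * (sin ((x + y) / 2) * sin ((y - x) / 2))" for x y :: real
          using cos_diff_cos[of x y] by simp
        then have "\<bar>cos x - cos y\<bar> \<le> 2 * (1 * \<bar>(y - x) / 2\<bar>)" for x y :: real
          by (simp only: abs_mult abs_numeral)
            (intro mult_left_mono mult_mono abs_sin_x_le_abs_x abs_sin_le_one, auto)
        from this[of "phase v b t - t * j" "phase v b t - t * j'"]
        have "\<bar>cos (phase v b t - t * j) - cos (phase v b t - t * j')\<bar> \<le> \<bar>t * (j - j')\<bar>"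
          by (simp add: algebra_simps)
        then show ?thesis using t by (simp add: abs_mult)
      qed
      then have "\<bar>f v b j t - f v b j' t\<bar> \<le> exp (- damp v b t) * (t * \<bar>j - j'\<bar>)"
        unfolding f_def right_diff_distrib[symmetric] by (simp add: abs_mult)
      also have "\<dots> \<le> (exp (- (a * t\<^sup>2)) + E v) * (t * \<bar>j - j'\<bar>)"
        unfolding a_def using t v1 v b by (intro mult_right_mono decay) auto
      also have "\<dots> = (t * exp (- (a * t\<^sup>2)) + t * E v) * \<bar>j - j'\<bar>" by (simp add: algebra_simps)
      also have "\<dots> \<le> (t * exp (- (a * t\<^sup>2)) + pi * E v) * \<bar>j - j'\<bar>"
        using t by (intro mult_right_mono add_left_mono) (auto simp: E_def)
      finally show "norm (f v b j t - f v b j' t) \<le> (t * exp (- (a * t\<^sup>2)) + pi * E v) * \<bar>j - j'\<bar>"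
        by simp
    qed
    also have "\<dots> = ((1 - exp (- (a * pi\<^sup>2))) / (2 * a) + pi\<^sup>2 * E v) * \<bar>j - j'\<bar>"
      by (rule integral_unique[OF H2])
    also have "\<dots> \<le> (1 / (2 * a) + pi\<^sup>2 * v powr (\<alpha> + 2)) * \<bar>j - j'\<bar>"
      using a v1(2) by (intro mult_right_mono add_mono divide_right_mono mult_left_mono) auto
    also have "\<dots> = (1 / (2 * c) + pi\<^sup>2) * \<bar>j - j'\<bar> * v powr (\<alpha> + 2)"
      unfolding inv_a by (simp add: algebra_simps)
    also have "integral {0..pi} (\<lambda>t. f v b j t - f v b j' t) =
        integral {0..pi} (f v b j) - integral {0..pi} (f v b j')"
      by (intro integral_diff f_int)
    finally have "\<bar>integral {0..pi} (f v b j) - integral {0..pi} (f v b j')\<bar> \<le>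
        (1 / (2 * c) + pi\<^sup>2) * \<bar>j - j'\<bar> * v powr (\<alpha> + 2)"
      unfolding real_norm_def .
    then have "\<bar>integral {0..pi} (f v b j) - integral {0..pi} (f v b j')\<bar> / pi \<le>
        (1 / (2 * c) + pi\<^sup>2) * \<bar>j - j'\<bar> * v powr (\<alpha> + 2) / pi"
      by (intro divide_right_mono) auto
    then show "\<bar>fourier_coeff v b j - fourier_coeff v b j'\<bar> \<le>
        (1 / (2 * c) + pi\<^sup>2) / pi * \<bar>j - j'\<bar> * v powr (\<alpha> + 2)"
      by (simp add: fourier_coeff_def f_def[abs_def] diff_divide_distrib[symmetric])
  next
    fix v x :: real and b :: nat
    assume v: "0 < v" "v < min v2 1" and b: "8 / v + 1 \<le> real b"
      and x: "\<bar>(\<Sum>k\<in>{1..<b}. real k * lam v k) - x\<bar> * v powr (\<alpha> / 2 + 1) \<le> 1 / (2 * R)"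
    define s where "s = v powr (\<alpha> / 2 + 1)"
    have s: "s > 0" using v by (simp add: s_def)
    have s2: "s\<^sup>2 = v powr (\<alpha> + 2)" using v by (simp add: s_def powr_power)
    have s2': "v powr (- (\<alpha> + 2)) = 1 / s\<^sup>2" unfolding s2 powr_minus by (simp add: divide_simps)
    have s3: "v powr (- (\<alpha> + 3)) * s ^ 3 = v powr (\<alpha> / 2)"
    proof -
      have "s ^ 3 = v powr (3 * (\<alpha> / 2 + 1))" using v by (simp add: s_def powr_power)
      then show ?thesis by (simp add: powr_add[symmetric])
    qed
    have v1: "v < v1" using v v2 by auto
    have Rs: "R * s \<le> 1" "s \<le> R * s" using v2(5)[OF v(1)] v R(1) s by (auto simp: s_def)
    have Rspi: "R * s \<le> pi" using Rs pi_gt3 by linarith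
    have E: "E v \<le> g / (4 * pi) * s" using v2(3)[OF v(1)] v by (simp add: s_def)
    \<comment> \<open>The cubic error and the error from the mean are at most 1/2 each, the latter
      by the choice \<open>d = 1 / (2 * R)\<close>. Their sum is below \<open>pi / 3\<close>, where
      the cosine is 1/2.\<close>
    have cos: "cos (phase v b t - t * x) \<ge> 1 / 2" if t: "0 \<le> t" "t \<le> R * s" for t
    proof -
      have "\<bar>phase v b t - t * x\<bar> \<le> C3 * v powr (- (\<alpha> + 3)) * t ^ 3 / 6 +
          t * \<bar>(\<Sum>k\<in>{1..<b}. real k * lam v k) - x\<bar>"
        by (intro phase_close m3 t v)
      also have "\<dots> \<le> C3 * v powr (- (\<alpha> + 3)) * (R * s) ^ 3 / 6 +
          (R * s) * \<bar>(\<Sum>k\<in>{1..<b}. real k * lam v k) - x\<bar>"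
        using t C3(1) by (intro add_mono divide_right_mono mult_left_mono power_mono mult_right_mono) auto
      also have "C3 * v powr (- (\<alpha> + 3)) * (R * s) ^ 3 / 6 = C3 * R ^ 3 / 6 * v powr (\<alpha> / 2)"
        unfolding s3[symmetric] by (simp add: power_mult_distrib)
      also have "(R * s) * \<bar>(\<Sum>k\<in>{1..<b}. real k * lam v k) - x\<bar> \<le> R * (1 / (2 * R))"
        using mult_left_mono[OF x, of R] R(1) by (simp add: s_def mult_ac)
      also have "R * (1 / (2 * R)) = 1 / 2" using R(1) by simp
      finally have le: "\<bar>phase v b t - t * x\<bar> \<le> 1" using v2(4)[OF v(1)] v by auto
      have "cos (pi / 3) \<le> cos \<bar>phase v b t - t * x\<bar>"
        using le pi_gt3 by (intro cos_monotone_0_pi_le) auto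
      then show ?thesis by (simp add: cos_60)
    qed
    have 1: "g * s \<le> integral {0..s} (f v b x)"
    proof -
      have "integral {0..s} (\<lambda>t. g) \<le> integral {0..s} (f v b x)"
      proof (rule integral_le[OF _ f_int])
        fix t assume t: "t \<in> {0..s}"
        have "damp v b t \<le> C2 * v powr (- (\<alpha> + 2)) * t\<^sup>2 / 2" by (intro damp_le m2 v)
        also have "\<dots> \<le> C2 * v powr (- (\<alpha> + 2)) * s\<^sup>2 / 2"
          using t C2(1) by (intro divide_right_mono mult_left_mono power_mono) auto
        also have "\<dots> = C2 / 2" unfolding s2' using s by simp
        finally have "exp (- (C2 / 2)) * (1 / 2) \<le> exp (- damp v b t) * cos (phase v b t - t * x)"
          using t Rs by (intro mult_mono cos) auto
        then show "g \<le> f v b x t" by (simp add: f_def g_def)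
      qed (rule integrable_const_ivl)
      then show ?thesis using s by (simp add: mult.commute)
    qed
    have 2: "0 \<le> integral {s..R * s} (f v b x)"
      using cos s by (intro integral_nonneg[OF f_int]) (auto simp: f_def intro!: mult_nonneg_nonneg order.trans[OF _ cos])
    \<comment> \<open>Here the cosine may be negative, so only \<open>exp (- damp v b t)\<close> is
      used. Replacing \<open>exp (- (a * t\<^sup>2))\<close> by \<open>1 / (a * t\<^sup>2)\<close>
      makes the tail elementary; it and the part from \<open>E v\<close> cost at most
      \<open>g * s / 4\<close> each.\<close>
    have 3: "- (g / 2 * s) \<le> integral {R * s..pi} (f v b x)"
    proof -
      define a where "a = c / s\<^sup>2"
      have a: "a > 0" using c(1) s by (simp add: a_def)
      have Rs0: "R * s > 0" using R(1) s by simp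
      have "((\<lambda>t. 1 / (a * t\<^sup>2)) has_integral (- 1 / (a * pi) - - 1 / (a * (R * s)))) {R * s..pi}"
        using Rspi a Rs0 by (intro fundamental_theorem_of_calculus)
          (auto intro!: derivative_eq_intros simp: has_real_derivative_iff_has_vector_derivative[symmetric] field_simps power2_eq_square)
      moreover have "((\<lambda>t. E v) has_integral E v * (pi - R * s)) {R * s..pi}"
        using has_integral_const_real[of "E v" "R * s" pi] Rspi by (simp add: mult.commute)
      ultimately have H: "((\<lambda>t. - (1 / (a * t\<^sup>2) + E v)) has_integral
          - ((- 1 / (a * pi) - - 1 / (a * (R * s))) + E v * (pi - R * s))) {R * s..pi}"
        by (intro has_integral_neg has_integral_add)
      have "integral {R * s..pi} (\<lambda>t. - (1 / (a * t\<^sup>2) + E v)) \<le> integral {R * s..pi} (f v b x)"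
      proof (rule integral_le[OF _ f_int])
        show "(\<lambda>t. - (1 / (a * t\<^sup>2) + E v)) integrable_on {R * s..pi}" using H by blast
        fix t assume t: "t \<in> {R * s..pi}"
        then have t0: "t > 0" using Rs0 by auto
        have "f v b x t \<ge> - exp (- damp v b t)"
        proof -
          have "exp (- damp v b t) * (- 1) \<le> f v b x t"
            unfolding f_def by (intro mult_left_mono) auto
          then show ?thesis by simp
        qed
        moreover have "exp (- damp v b t) \<le> exp (- (c * v powr (- (\<alpha> + 2)) * t\<^sup>2)) + E v"
          using t t0 by (intro decay v v1 b) auto
        moreover have "exp (- (c * v powr (- (\<alpha> + 2)) * t\<^sup>2)) = exp (- (a * t\<^sup>2))"
          unfolding s2' by (simp add: a_def)
        moreover have "exp (- (a * t\<^sup>2)) \<le> 1 / (a * t\<^sup>2)"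
        proof -
          have p: "a * t\<^sup>2 > 0" using a t0 by simp
          have "a * t\<^sup>2 \<le> exp (a * t\<^sup>2)" using exp_ge_add_one_self[of "a * t\<^sup>2"] by linarith
          then have "1 / exp (a * t\<^sup>2) \<le> 1 / (a * t\<^sup>2)" using p by (intro divide_left_mono) auto
          then show ?thesis by (simp add: exp_minus inverse_eq_divide)
        qed
        ultimately show "- (1 / (a * t\<^sup>2) + E v) \<le> f v b x t" by linarith
      qed
      moreover have "1 / (a * (R * s)) \<le> g / 4 * s"
      proof -
        have "1 / (a * (R * s)) = 1 / (c * R) * s"
          using c(1) s R(1) by (simp add: a_def power2_eq_square field_simps)
        then show ?thesis using mult_right_mono[OF R(2), of s] s by simp
      qed
      moreover have "- 1 / (a * pi) \<le> 0" "- 1 / (a * (R * s)) = - (1 / (a * (R * s)))" using a by auto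
      moreover have "E v * (pi - R * s) \<le> g / 4 * s"
      proof -
        have "E v * (pi - R * s) \<le> E v * pi" using Rs0 by (intro mult_left_mono) (auto simp: E_def)
        also have "\<dots> \<le> g / (4 * pi) * s * pi" using E by (intro mult_right_mono) auto
        finally show ?thesis by simp
      qed
      ultimately show ?thesis unfolding integral_unique[OF H] by linarith
    qed
    have "integral {0..pi} (f v b x) = integral {0..R * s} (f v b x) + integral {R * s..pi} (f v b x)"
      using Rspi R(1) s f_int by (intro Henstock_Kurzweil_Integration.integral_combine[symmetric]) auto
    also have "integral {0..R * s} (f v b x) = integral {0..s} (f v b x) + integral {s..R * s} (f v b x)"
      using Rs s f_int by (intro Henstock_Kurzweil_Integration.integral_combine[symmetric]) auto
    finally have "g / 2 * s \<le> integral {0..pi} (f v b x)" using 1 2 3 by linarith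
    then have "g / 2 * s / pi \<le> integral {0..pi} (f v b x) / pi" by (intro divide_right_mono) auto
    then show "g / (2 * pi) * v powr (\<alpha> / 2 + 1) \<le> fourier_coeff v b x"
      by (simp add: fourier_coeff_def f_def[abs_def] s_def)
  qed
qed

end

subsection \<open>The saddle point\<close>

context power_weights
begin

definition mean_sum :: "real \<Rightarrow> real" where
  "mean_sum v = (\<Sum>k. \<theta> (Suc k) * exp (- (real (Suc k) * v)))"

lemma sum_shift_Suc:
  "(\<Sum>k<n. \<theta> (Suc k) * exp (- (real (Suc k) * v))) = (\<Sum>k\<in>{1..n}. \<theta> k * exp (- (real k * v)))"
  by (rule sum.reindex_bij_witness[where i = "\<lambda>k. k - 1" and j = Suc]) auto

lemma mean_sum_bound:
  obtains C where "C > 0"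
    "\<And>v. v > 0 \<Longrightarrow> summable (\<lambda>k. \<theta> (Suc k) * exp (- (real (Suc k) * v)))"
    "\<And>v. v > 0 \<Longrightarrow> mean_sum v \<le> C * v powr (- (\<alpha> + 1))"
proof -
  obtain C where C: "C > 0" "\<And>v A. v > 0 \<Longrightarrow> finite A \<Longrightarrow> 0 \<notin> A \<Longrightarrow>
       (\<Sum>k\<in>A. real k ^ 0 * (\<theta> k * exp (- (real k * v)))) \<le> C * v powr (- (\<alpha> + real 0 + 1))"
    using \<theta>_moment_le[of 0] by blast
  have le: "(\<Sum>k<n. \<theta> (Suc k) * exp (- (real (Suc k) * v))) \<le> C * v powr (- (\<alpha> + 1))" if "v > 0" for v n
    unfolding sum_shift_Suc using C(2)[OF that, of "{1..n}"] by simp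
  have s: "summable (\<lambda>k. \<theta> (Suc k) * exp (- (real (Suc k) * v)))" if "v > 0" for v
    using le[OF that] by (intro summableI_nonneg_bounded) (auto simp: \<theta>_nonneg)
  show thesis
    by (rule that[OF C(1) s]) (simp_all only: mean_sum_def suminf_le_const[OF s le])
qed

lemma mean_sum_summable: "v > 0 \<Longrightarrow> summable (\<lambda>k. \<theta> (Suc k) * exp (- (real (Suc k) * v)))"
  using mean_sum_bound by metis

lemma sum_le_mean_sum:
  assumes "v > 0" "finite A" "0 \<notin> A"
  shows "(\<Sum>k\<in>A. \<theta> k * exp (- (real k * v))) \<le> mean_sum v"
proof -
  obtain N where N: "A \<subseteq> {..N}" using assms(2) unfolding finite_nat_iff_bounded_le by blast
  have "A \<subseteq> {1..N}"
  proof
    fix k assume k: "k \<in> A"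
    then have "k \<noteq> 0" using assms(3) by metis
    then show "k \<in> {1..N}" using N k by auto
  qed
  then have "(\<Sum>k\<in>A. \<theta> k * exp (- (real k * v))) \<le> (\<Sum>k\<in>{1..N}. \<theta> k * exp (- (real k * v)))"
    by (intro sum_mono2) (auto simp: \<theta>_nonneg)
  also have "\<dots> \<le> mean_sum v"
    unfolding mean_sum_def sum_shift_Suc[symmetric] using assms(1)
    by (intro sum_le_suminf mean_sum_summable) (auto simp: \<theta>_nonneg)
  finally show ?thesis .
qed

lemma mean_sum_lower:
  obtains c v0 where "c > 0" "v0 > 0" "v0 \<le> 1"
    "\<And>v. 0 < v \<Longrightarrow> v < v0 \<Longrightarrow> c * v powr (- (\<alpha> + 1)) \<le> mean_sum v"
proof -
  obtain c v0 where c: "c > 0" "v0 > 0" "v0 \<le> 1"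
    "\<And>v k. 0 < v \<Longrightarrow> v < v0 \<Longrightarrow> 1 / v \<le> real k \<Longrightarrow> real k \<le> 8 / v \<Longrightarrow> lam v k \<ge> c * v powr (1 - \<alpha>)"
    using lam_lower by blast
  show thesis
  proof (rule that[OF c(1-3)])
    fix v :: real assume v: "0 < v" "v < v0"
    let ?I = "{nat \<lceil>1 / v\<rceil>..nat \<lfloor>8 / v\<rfloor>}"
    have v1: "1 / v \<ge> 1" using v c(3) by simp
    have k: "1 / v \<le> real k" "real k \<le> 8 / v" if "k \<in> ?I" for k
    proof -
      show "1 / v \<le> real k" using that by simp
      have "0 < 8 / v" using v by simp
      then show "real k \<le> 8 / v" using that by (simp, linarith)
    qed
    have e: "8 / v = 8 * (1 / v)" by simp
    have "real (nat \<lceil>1 / v\<rceil>) \<le> 1 / v + 1" using v1 by linarith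
    moreover have "8 * (1 / v) \<le> real (Suc (nat \<lfloor>8 / v\<rfloor>))" unfolding e using v1 by linarith
    moreover have "real (Suc (nat \<lfloor>8 / v\<rfloor>)) \<le> real (card ?I) + real (nat \<lceil>1 / v\<rceil>)"
      unfolding card_atLeastAtMost of_nat_add[symmetric] of_nat_le_iff by simp
    ultimately have "1 / v \<le> real (card ?I)" using v1 by linarith
    moreover have "0 \<le> 1 / v * (c * v powr (1 - \<alpha>))" using c(1) v by simp
    ultimately have "1 / v * (1 / v * (c * v powr (1 - \<alpha>))) \<le>
        real (card ?I) * (1 / v * (c * v powr (1 - \<alpha>)))" by (rule mult_right_mono)
    also have "\<dots> = (\<Sum>k\<in>?I. 1 / v * (c * v powr (1 - \<alpha>)))" by simp
    also have "\<dots> \<le> (\<Sum>k\<in>?I. real k * lam v k)"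
      using k c(1) v by (intro sum_mono mult_mono c(4)) auto
    also have "\<dots> = (\<Sum>k\<in>?I. \<theta> k * exp (- (real k * v)))"
    proof (intro sum.cong refl k_lam)
      fix k assume "k \<in> ?I"
      then have "1 \<le> real k" using k(1) v1 by (rule_tac order.trans)
      then show "1 \<le> k" by simp
    qed
    also have "\<dots> \<le> mean_sum v" using v v1 by (intro sum_le_mean_sum) auto
    also have "1 / v * (1 / v * (c * v powr (1 - \<alpha>))) = c * v powr (- (\<alpha> + 1))"
    proof -
      have "v powr (- (\<alpha> + 1)) = v powr (1 - \<alpha>) * v powr (- 2)"
        by (simp add: powr_add[symmetric] algebra_simps)
      also have "v powr (- 2) = 1 / v\<^sup>2" using v by (simp add: powr_minus_divide powr_numeral)
      finally show ?thesis by (simp add: power2_eq_square)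
    qed
    finally show "c * v powr (- (\<alpha> + 1)) \<le> mean_sum v" .
  qed
qed

text \<open>Termwise monotonicity is only weak because weights may vanish; one index with
  \<open>\<theta> K > 0\<close>, supplied by the asymptotics, makes it strict.\<close>

lemma mean_sum_strict_antimono:
  assumes "0 < v" "v < w"
  shows "mean_sum w < mean_sum v"
proof -
  let ?f = "\<lambda>v k. \<theta> (Suc k) * exp (- (real (Suc k) * v))"
  obtain K where K: "K \<ge> 1" "\<And>k. k \<ge> K \<Longrightarrow> \<bar>\<theta> k - real k powr \<alpha>\<bar> \<le> 1/2 * real k powr \<alpha>"
    using \<theta>_relative[of "1/2"] by auto
  have "real K powr \<alpha> > 0" using K(1) by simp
  then have pos: "\<theta> K > 0" using K(2)[of K] by linarith
  have diff: "?f v k - ?f w k \<ge> 0" for k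
  proof -
    have "exp (- (real (Suc k) * w)) \<le> exp (- (real (Suc k) * v))" using assms by simp
    then show ?thesis using \<theta>_nonneg[of "Suc k"] by (simp add: mult_left_mono)
  qed
  have "0 < (\<Sum>k. ?f v k - ?f w k)"
  proof (rule suminf_pos2[of _ "K - 1"])
    show "summable (\<lambda>k. ?f v k - ?f w k)" using assms by (intro summable_diff mean_sum_summable) auto
    have "exp (- (real K * w)) < exp (- (real K * v))" using assms K(1) by simp
    then show "0 < ?f v (K - 1) - ?f w (K - 1)" using pos K(1) by simp
  qed (rule diff)
  also have "\<dots> = mean_sum v - mean_sum w"
    unfolding mean_sum_def using assms by (intro suminf_diff[symmetric] mean_sum_summable) auto
  finally show ?thesis by simp
qed

text \<open>In \<open>z = exp (- v)\<close> this is \<open>z\<close> times a power series, and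
  summability at \<open>v / 2\<close> puts \<open>exp (- v)\<close> strictly inside the disc of
  convergence.\<close>

lemma isCont_mean_sum:
  assumes "v > 0"
  shows "isCont mean_sum v"
proof -
  have s: "summable (\<lambda>k. \<theta> (Suc k) * exp (- v) ^ k)" if "v > 0" for v
  proof -
    have "summable (\<lambda>k. exp v * (\<theta> (Suc k) * exp (- (real (Suc k) * v))))"
      by (intro summable_mult mean_sum_summable that)
    also have "(\<lambda>k. exp v * (\<theta> (Suc k) * exp (- (real (Suc k) * v)))) = (\<lambda>k. \<theta> (Suc k) * exp (- v) ^ k)"
      by (auto simp: fun_eq_iff exp_of_nat_mult[symmetric] algebra_simps exp_add[symmetric])
    finally show ?thesis .
  qed
  have eq: "mean_sum w = exp (- w) * (\<Sum>k. \<theta> (Suc k) * exp (- w) ^ k)" if "w > 0" for w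
  proof -
    have "exp (- w) * (\<Sum>k. \<theta> (Suc k) * exp (- w) ^ k) = (\<Sum>k. exp (- w) * (\<theta> (Suc k) * exp (- w) ^ k))"
      by (rule suminf_mult[OF s[OF that], symmetric])
    also have "(\<lambda>k. exp (- w) * (\<theta> (Suc k) * exp (- w) ^ k)) = (\<lambda>k. \<theta> (Suc k) * exp (- (real (Suc k) * w)))"
      by (auto simp: fun_eq_iff exp_of_nat_mult[symmetric] algebra_simps exp_add[symmetric])
    finally show ?thesis by (simp add: mean_sum_def)
  qed
  have "isCont (\<lambda>z. \<Sum>k. \<theta> (Suc k) * z ^ k) (exp (- v))"
    by (rule isCont_powser[where K = "exp (- (v / 2))"]) (use assms s[of "v/2"] in auto)
  then have "isCont (\<lambda>w. exp (- w) * (\<Sum>k. \<theta> (Suc k) * exp (- w) ^ k)) v"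
    by (intro continuous_intros isCont_o2[where g = "\<lambda>z. \<Sum>k. \<theta> (Suc k) * z ^ k" and f = "\<lambda>w. exp (- w)"]) auto
  moreover have "\<forall>\<^sub>F w in nhds v. mean_sum w = exp (- w) * (\<Sum>k. \<theta> (Suc k) * exp (- w) ^ k)"
    using eventually_nhds_in_open[of "{0<..}" v] assms by (auto elim!: eventually_mono intro: eq)
  ultimately show ?thesis by (simp add: isCont_cong)
qed

text \<open>\<open>mean_sum\<close> is continuous, tends to infinity at 0 and falls below 1 far out,
  so the value \<open>n \<ge> 1\<close> is attained. Strict monotonicity makes it attained once,
  which justifies the definite description in \<open>v_sol\<close>.\<close>

lemma v_sol_props:
  assumes "n \<ge> 1"
  shows "v_sol \<theta> n > 0" "mean_sum (v_sol \<theta> n) = real n"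
proof -
  let ?P = "\<lambda>v. v > 0 \<and> (\<lambda>k. \<theta> (Suc k) * exp (- (real (Suc k) * v))) sums real n"
  have P_iff: "?P v \<longleftrightarrow> v > 0 \<and> mean_sum v = real n" for v
    using mean_sum_summable[of v] unfolding mean_sum_def by (auto simp only: sums_iff)
  obtain c v0 where c: "c > 0" "v0 > 0" "v0 \<le> 1"
    "\<And>v. 0 < v \<Longrightarrow> v < v0 \<Longrightarrow> c * v powr (- (\<alpha> + 1)) \<le> mean_sum v"
    using mean_sum_lower by blast
  obtain C where C: "C > 0" "\<And>v. v > 0 \<Longrightarrow> mean_sum v \<le> C * v powr (- (\<alpha> + 1))"
    using mean_sum_bound by metis
  have "\<forall>\<^sub>F v in at_right 0. real n \<le> c * v powr (- (\<alpha> + 1))"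
    using c(1) \<alpha> by real_asymp
  then have "\<forall>\<^sub>F v in at_right 0. real n \<le> c * v powr (- (\<alpha> + 1)) \<and> v < v0 \<and> 0 < v \<and> v < 1"
    using c(2) by (intro eventually_conj) (auto simp: eventually_at_right_field intro: exI[of _ v0] exI[of _ 1])
  then obtain a where a: "real n \<le> c * a powr (- (\<alpha> + 1))" "a < v0" "0 < a" "a < 1"
    using eventually_happens'[OF trivial_limit_at_right_real] by blast
  have "\<forall>\<^sub>F v in at_top. C * v powr (- (\<alpha> + 1)) \<le> 1" using C(1) \<alpha> by real_asymp
  then have "\<forall>\<^sub>F v in at_top. C * v powr (- (\<alpha> + 1)) \<le> 1 \<and> v > (1::real)"
    by (intro eventually_conj eventually_gt_at_top)
  then obtain d where d: "C * d powr (- (\<alpha> + 1)) \<le> 1" "d > 1"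
    using eventually_happens'[OF trivial_limit_at_top_linorder] by blast
  have "\<exists>v\<ge>a. v \<le> d \<and> mean_sum v = real n"
  proof (rule IVT2)
    show "mean_sum d \<le> real n" using C(2)[of d] d assms by linarith
    show "real n \<le> mean_sum a" using c(4)[of a] a by linarith
    show "\<forall>x. a \<le> x \<and> x \<le> d \<longrightarrow> isCont mean_sum x" using a by (auto intro: isCont_mean_sum)
  qed (use a d in auto)
  then obtain v where v: "v > 0" "mean_sum v = real n" using a(3) by (meson less_le_trans)
  have "?P (v_sol \<theta> n)" unfolding v_sol_def
  proof (rule theI[of ?P v])
    show "?P v" using P_iff v by blast
    fix w assume "?P w"
    then have w: "w > 0" "mean_sum w = real n" using P_iff by blast+
    show "w = v"
      using mean_sum_strict_antimono[of v w] mean_sum_strict_antimono[of w v] v w by (cases "w < v"; cases "v < w") auto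
  qed
  then show "v_sol \<theta> n > 0" "mean_sum (v_sol \<theta> n) = real n" using P_iff by blast+
qed

lemma v_sol_tendsto: "filterlim (v_sol \<theta>) (at_right 0) sequentially"
proof -
  have "(v_sol \<theta> \<longlongrightarrow> 0) sequentially"
  proof (rule tendstoI)
    fix e :: real assume e: "e > 0"
    have "\<forall>\<^sub>F n in sequentially. real n > mean_sum e"
      using filterlim_real_sequentially by (simp add: filterlim_at_top_dense)
    then show "\<forall>\<^sub>F n in sequentially. dist (v_sol \<theta> n) 0 < e"
      using eventually_ge_at_top[of 1]
    proof eventually_elim
      case (elim n)
      note v = v_sol_props[OF elim(2)]
      have "v_sol \<theta> n < e"
      proof (rule ccontr)
        assume "\<not> v_sol \<theta> n < e"
        then have "mean_sum (v_sol \<theta> n) \<le> mean_sum e"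
          using mean_sum_strict_antimono[OF e, of "v_sol \<theta> n"] by (cases "v_sol \<theta> n = e") auto
        then show False using v elim by simp
      qed
      then show ?case using v by simp
    qed
  qed
  moreover have "\<forall>\<^sub>F n in sequentially. v_sol \<theta> n \<in> {0<..} \<and> v_sol \<theta> n \<noteq> 0"
    using eventually_ge_at_top[of 1]
  proof eventually_elim
    case (elim n)
    then show ?case using v_sol_props(1)[of n] by auto
  qed
  ultimately show ?thesis unfolding filterlim_at by simp
qed

text \<open>At the saddle point \<open>mean_sum v = n\<close>, so the first estimate measures how
  far the truncated mean misses \<open>n\<close>; the second bounds the expected total length of the
  long cycles. Both come from the same tail.\<close>

lemma mean_tail:
  obtains C where "C > 0"
    "\<And>v B b. v > 0 \<Longrightarrow> b \<ge> 1 \<Longrightarrow> B \<le> real b * v \<Longrightarrow>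
       \<bar>(\<Sum>k\<in>{1..<b}. real k * lam v k) - mean_sum v\<bar> \<le> C * exp (- (3 / 4 * B)) * v powr (- (\<alpha> + 1))"
    "\<And>v B b n. v > 0 \<Longrightarrow> b \<ge> 1 \<Longrightarrow> B \<le> real b * v \<Longrightarrow>
       (\<Sum>k\<in>{b..n}. real k * lam v k) \<le> C * exp (- (3 / 4 * B)) * v powr (- (\<alpha> + 1))"
proof -
  obtain C where C: "C > 0"
    "\<And>v B A. v > 0 \<Longrightarrow> finite A \<Longrightarrow> 0 \<notin> A \<Longrightarrow> (\<And>k. k \<in> A \<Longrightarrow> B \<le> real k * v) \<Longrightarrow>
       (\<Sum>k\<in>A. \<theta> k * exp (- (real k * v))) \<le> C * exp (- (3 / 4 * B)) * v powr (- (\<alpha> + 1))"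
    using \<theta>_tail_le by blast
  have 2: "(\<Sum>k\<in>{b..n}. real k * lam v k) \<le> C * exp (- (3 / 4 * B)) * v powr (- (\<alpha> + 1))"
    if "v > 0" "b \<ge> 1" "B \<le> real b * v" for v B b n
  proof -
    have "(\<Sum>k\<in>{b..n}. real k * lam v k) = (\<Sum>k\<in>{b..n}. \<theta> k * exp (- (real k * v)))"
      using that by (intro sum.cong refl k_lam) auto
    also have "\<dots> \<le> C * exp (- (3 / 4 * B)) * v powr (- (\<alpha> + 1))"
    proof (rule C(2))
      fix k assume "k \<in> {b..n}"
      then have "real b * v \<le> real k * v" using that by (intro mult_right_mono) auto
      then show "B \<le> real k * v" using that by linarith
    qed (use that in auto)
    finally show ?thesis .
  qed
  show thesis
  proof (rule that[OF C(1) _ 2])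
    fix v B :: real and b :: nat assume v: "v > 0" and b: "b \<ge> 1" "B \<le> real b * v"
    let ?T = "C * exp (- (3 / 4 * B)) * v powr (- (\<alpha> + 1))" and ?S = "\<Sum>k\<in>{1..<b}. real k * lam v k"
    have S: "?S = (\<Sum>k\<in>{1..<b}. \<theta> k * exp (- (real k * v)))"
      by (intro sum.cong refl k_lam) auto
    have "?S \<le> mean_sum v" unfolding S using v by (intro sum_le_mean_sum) auto
    moreover have "mean_sum v \<le> ?S + ?T" unfolding mean_sum_def
    proof (rule suminf_le_const[OF mean_sum_summable[OF v]])
      fix n
      have "(\<Sum>k<n. \<theta> (Suc k) * exp (- (real (Suc k) * v))) \<le>
          (\<Sum>k\<in>{1..<b} \<union> {b..n}. \<theta> k * exp (- (real k * v)))"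
        unfolding sum_shift_Suc
      proof (rule sum_mono2)
        fix k assume "k \<in> ({1..<b} \<union> {b..n}) - {1..n}"
        then have "k \<ge> 1" using b(1) by auto
        then show "0 \<le> \<theta> k * exp (- (real k * v))" by (simp add: \<theta>_nonneg)
      qed auto
      also have "\<dots> = ?S + (\<Sum>k\<in>{b..n}. \<theta> k * exp (- (real k * v)))"
        unfolding S by (intro sum.union_disjoint) auto
      also have "(\<Sum>k\<in>{b..n}. \<theta> k * exp (- (real k * v))) = (\<Sum>k\<in>{b..n}. real k * lam v k)"
        using b by (intro sum.cong refl k_lam[symmetric]) auto
      also have "\<dots> \<le> ?T" by (rule 2[OF v b])
      finally show "(\<Sum>k<n. \<theta> (Suc k) * exp (- (real (Suc k) * v))) \<le> ?S + ?T" by simp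
    qed
    ultimately show "\<bar>?S - mean_sum v\<bar> \<le> ?T" by linarith
  qed
qed

end

subsection \<open>The intensity of long cycles\<close>

context power_weights
begin

text \<open>For \<open>k v \<ge> X\<close> the summand is compared with a geometric sequence of ratio
  \<open>exp (- v (1 \<plusminus> e))\<close>, because \<open>1 + u / X \<le> exp (u / X)\<close> with \<open>u = k v - X\<close>.\<close>

lemma lam_geometric_bounds:
  assumes e: "0 < e" "e < 1"
  obtains X0 v0 where "X0 \<ge> 1" "v0 > 0"
    "\<And>v X k. 0 < v \<Longrightarrow> v < v0 \<Longrightarrow> X0 \<le> X \<Longrightarrow> X \<le> real k * v \<Longrightarrow>
       (1 - e) * exp (- ((1 + e) * (real k * v - X))) * (v powr (1 - \<alpha>) * X powr (\<alpha> - 1) * exp (- X)) \<le> lam v k"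
    "\<And>v X k. 0 < v \<Longrightarrow> v < v0 \<Longrightarrow> X0 \<le> X \<Longrightarrow> X \<le> real k * v \<Longrightarrow>
       lam v k \<le> (1 + e) * exp (- ((1 - e) * (real k * v - X))) * (v powr (1 - \<alpha>) * X powr (\<alpha> - 1) * exp (- X))"
proof -
  obtain K where K: "K \<ge> 1" "\<And>k. k \<ge> K \<Longrightarrow> \<bar>\<theta> k - real k powr \<alpha>\<bar> \<le> e * real k powr \<alpha>"
    using \<theta>_relative[OF e(1)] by auto
  \<comment> \<open>For \<open>X \<ge> \<bar>\<alpha> - 1\<bar> / e\<close> the power factor changes
    the exponent by at most \<open>e * u\<close>.\<close>
  define X0 where "X0 = max 1 (\<bar>\<alpha> - 1\<bar> / e)"
  have main: "(1 - e) * exp (- ((1 + e) * (real k * v - X))) * (v powr (1 - \<alpha>) * X powr (\<alpha> - 1) * exp (- X)) \<le> lam v k \<and>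
      lam v k \<le> (1 + e) * exp (- ((1 - e) * (real k * v - X))) * (v powr (1 - \<alpha>) * X powr (\<alpha> - 1) * exp (- X))"
    if v: "0 < v" "v < 1 / real K" and X: "X0 \<le> X" "X \<le> real k * v" for v X k
  proof -
    have X1: "X \<ge> 1" "\<bar>\<alpha> - 1\<bar> / X \<le> e"
    proof -
      show "X \<ge> 1" using X by (simp add: X0_def)
      have "\<bar>\<alpha> - 1\<bar> / e \<le> X" using X by (simp add: X0_def)
      then have "\<bar>\<alpha> - 1\<bar> \<le> X * e" using e by (simp add: pos_divide_le_eq)
      then show "\<bar>\<alpha> - 1\<bar> / X \<le> e" using \<open>X \<ge> 1\<close> by (simp add: pos_divide_le_eq mult.commute)
    qed
    have kv: "real k * v \<ge> 1" using X X1 by linarith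
    have "real K * v < 1" using v K(1) by (simp add: field_simps)
    then have "real K * v < real k * v" using kv by linarith
    then have kK: "k \<ge> K" "k \<ge> 1" using v(1) K(1) by auto
    define u where "u = real k * v - X"
    have u: "u \<ge> 0" using X by (simp add: u_def)
    define l where "l = ln (real k * v / X)"
    have l: "0 \<le> l" "l \<le> u / X"
    proof -
      have "real k * v / X \<ge> 1" using X X1 by simp
      then show "0 \<le> l" by (simp add: l_def)
      have "real k * v / X = 1 + u / X" using X1 by (simp add: u_def field_simps)
      then show "l \<le> u / X" unfolding l_def using u X1 by (simp add: ln_add_one_self_le_self)
    qed
    have "\<bar>(\<alpha> - 1) * l\<bar> \<le> \<bar>\<alpha> - 1\<bar> * (u / X)"
      unfolding abs_mult using l by (intro mult_left_mono) auto
    also have "\<dots> = \<bar>\<alpha> - 1\<bar> / X * u" by simp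
    also have "\<dots> \<le> e * u" using X1 u by (intro mult_right_mono)
    finally have b: "\<bar>(\<alpha> - 1) * l\<bar> \<le> e * u" .
    have kb: "real k powr (\<alpha> - 1) = v powr (1 - \<alpha>) * X powr (\<alpha> - 1) * exp ((\<alpha> - 1) * l)"
    proof -
      have "exp ((\<alpha> - 1) * l) = (real k * v / X) powr (\<alpha> - 1)"
        unfolding l_def powr_def using v(1) kK X1 by simp
      also have "\<dots> = real k powr (\<alpha> - 1) * v powr (\<alpha> - 1) / X powr (\<alpha> - 1)"
        using X1 v(1) by (simp add: powr_divide powr_mult)
      finally have "exp ((\<alpha> - 1) * l) = real k powr (\<alpha> - 1) * v powr (\<alpha> - 1) / X powr (\<alpha> - 1)" .
      moreover have "v powr (1 - \<alpha>) * v powr (\<alpha> - 1) = 1" using v(1) by (simp add: powr_add[symmetric])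
      moreover have "X powr (\<alpha> - 1) > 0" using X1 by simp
      moreover have "a = d * p * g" if "g = a * b / p" "d * b = 1" "p > 0" for a b d p g :: real
        using that by (simp add: mult_ac)
      ultimately show ?thesis by blast
    qed
    define q where "q = v powr (1 - \<alpha>) * X powr (\<alpha> - 1) * exp (- X)"
    have q: "q \<ge> 0" by (simp add: q_def)
    have eq: "real k powr (\<alpha> - 1) * exp (- (real k * v)) = q * exp ((\<alpha> - 1) * l - u)"
      unfolding kb q_def u_def by (simp add: exp_diff exp_minus field_simps exp_add)
    have "real k powr \<alpha> = real k powr (\<alpha> - 1) * real k"
      using kK powr_add[of "real k" "\<alpha> - 1" 1] by simp
    then have "\<bar>\<theta> k / real k - real k powr (\<alpha> - 1)\<bar> \<le> e * real k powr (\<alpha> - 1)"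
    proof -
      have "\<bar>\<theta> k / real k - real k powr (\<alpha> - 1)\<bar> = \<bar>\<theta> k - real k powr \<alpha>\<bar> / real k"
      proof -
        have "\<theta> k / real k - real k powr (\<alpha> - 1) = (\<theta> k - real k powr \<alpha>) / real k"
          unfolding \<open>real k powr \<alpha> = _\<close> using kK(2) by (simp add: diff_divide_distrib)
        then show ?thesis by simp
      qed
      also have "\<dots> \<le> e * real k powr \<alpha> / real k" using K(2)[OF kK(1)] by (intro divide_right_mono) auto
      also have "\<dots> = e * real k powr (\<alpha> - 1)" using \<open>real k powr \<alpha> = _\<close> kK(2) by simp
      finally show ?thesis .
    qed
    then have r: "(1 - e) * real k powr (\<alpha> - 1) \<le> \<theta> k / real k" "\<theta> k / real k \<le> (1 + e) * real k powr (\<alpha> - 1)"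
      by (auto simp: abs_le_iff algebra_simps)
    have "(1 - e) * exp (- ((1 + e) * u)) * q \<le> (1 - e) * exp ((\<alpha> - 1) * l - u) * q"
      using b e q by (intro mult_right_mono mult_left_mono) (auto simp: algebra_simps abs_le_iff)
    also have "\<dots> = ((1 - e) * real k powr (\<alpha> - 1)) * exp (- (real k * v))"
      using eq by (simp add: mult_ac)
    also have "\<dots> \<le> lam v k" unfolding lam_def using r by (intro mult_right_mono) auto
    finally have 1: "(1 - e) * exp (- ((1 + e) * u)) * q \<le> lam v k" .
    have "lam v k \<le> ((1 + e) * real k powr (\<alpha> - 1)) * exp (- (real k * v))"
      unfolding lam_def using r by (intro mult_right_mono) auto
    also have "\<dots> = (1 + e) * exp ((\<alpha> - 1) * l - u) * q" using eq by (simp add: mult_ac)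
    also have "\<dots> \<le> (1 + e) * exp (- ((1 - e) * u)) * q"
      using b e q by (intro mult_right_mono mult_left_mono) (auto simp: algebra_simps abs_le_iff)
    finally show ?thesis using 1 unfolding u_def q_def by blast
  qed
  show thesis
    by (rule that[of X0 "1 / real K"]) (use main K(1) in \<open>auto simp: X0_def\<close>)
qed

text \<open>\<open>v * S N\<close> is a Riemann sum of mesh \<open>v\<close> for the integral of
  \<open>exp (- w * u)\<close> over \<open>u \<ge> 0\<close>, which equals \<open>1 / w\<close>. The
  errors are one mesh step and, from below, also the part of the integral beyond
  \<open>D\<close>.\<close>

lemma geometric_block:
  fixes v w X :: real
  assumes v: "v > 0" and w: "w > 0" and X: "X > 0"
  defines "S \<equiv> \<lambda>N. \<Sum>k | k \<in> {1..N} \<and> X \<le> real k * v. exp (- (w * (real k * v - X)))"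
  shows "v * S N \<le> 1 / w + v"
    and "D \<ge> 0 \<Longrightarrow> D \<le> real N * v - X \<Longrightarrow> (1 - v * w - exp (- (w * D))) / w \<le> v * S N"
proof -
  define G where "G k = exp (- (w * (real k * v - X)))" for k
  define k0 where "k0 = nat \<lceil>X / v\<rceil>"
  have Xv: "X / v > 0" using v X by simp
  have k0: "X \<le> real k * v \<longleftrightarrow> k0 \<le> k" for k
  proof -
    have "X \<le> real k * v \<longleftrightarrow> X / v \<le> real k" using v by (simp add: pos_divide_le_eq)
    also have "\<dots> \<longleftrightarrow> k0 \<le> k" unfolding k0_def by (simp add: nat_le_iff ceiling_le_iff)
    finally show ?thesis .
  qed
  have k01: "k0 \<ge> 1" using Xv unfolding k0_def by (simp add: Suc_le_eq)
  have set: "{k. k \<in> {1..N} \<and> X \<le> real k * v} = {k0..N}" unfolding k0 using k01 by auto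
  define z where "z = v * w"
  have z: "z > 0" using v w by (simp add: z_def)
  have G_Suc: "G (Suc k) = exp (- z) * G k" for k
    by (simp add: G_def z_def exp_add[symmetric] algebra_simps)
  have pos: "1 - exp (- z) > 0" using z by simp
  have sumG: "(\<Sum>k\<in>{k0..N}. G k) = (G k0 - G (Suc N)) / (1 - exp (- z))" if "k0 \<le> Suc N"
  proof -
    have "(\<Sum>k\<in>{k0..N}. G k) * (1 - exp (- z)) = (\<Sum>k\<in>{k0..N}. - (G (Suc k) - G k))"
      unfolding sum_distrib_right by (intro sum.cong refl) (simp add: G_Suc algebra_simps)
    also have "\<dots> = G k0 - G (Suc N)"
      unfolding sum_negf using that by (simp add: sum_Suc_diff)
    finally show ?thesis using pos by (simp add: field_simps)
  qed
  have "X \<le> real k0 * v" using k0 by blast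
  then have G1: "G k0 \<le> 1" using w by (simp add: G_def)
  have Gp: "G k > 0" for k by (simp add: G_def)
  show "v * S N \<le> 1 / w + v"
  proof (cases "k0 \<le> Suc N")
    case True
    have "1 / (1 - exp (- z)) \<le> (1 + z) / z"
    proof -
      have "1 + z \<le> exp z" by (rule exp_ge_add_one_self)
      then have "(1 + z) * exp (- z) \<le> exp z * exp (- z)" by (rule mult_right_mono) auto
      then have "z \<le> (1 + z) * (1 - exp (- z))" by (simp add: algebra_simps exp_minus)
      then show ?thesis using pos z by (simp add: divide_simps mult.commute)
    qed
    moreover have "(G k0 - G (Suc N)) / (1 - exp (- z)) \<le> 1 / (1 - exp (- z))"
      using pos G1 Gp[of "Suc N"] by (intro divide_right_mono) auto
    ultimately have "S N \<le> (1 + z) / z" unfolding S_def set using sumG[OF True] G_def by simp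
    then have "v * S N \<le> v * ((1 + z) / z)" using v by (intro mult_left_mono) auto
    also have "\<dots> = 1 / w + v" using v w by (simp add: z_def field_simps)
    finally show ?thesis .
  next
    case False
    then show ?thesis unfolding S_def set using v w by simp
  qed
  assume D: "D \<ge> 0" "D \<le> real N * v - X"
  then have "k0 \<le> N" using k0[of N] by simp
  then have S: "S N = (G k0 - G (Suc N)) / (1 - exp (- z))"
    unfolding S_def set using sumG G_def by simp
  have "real k0 * v - X \<le> v"
  proof -
    have "real k0 \<le> X / v + 1" unfolding k0_def using Xv by linarith
    then have "real k0 * v \<le> (X / v + 1) * v" using v by (intro mult_right_mono) auto
    then show ?thesis using v by (simp add: algebra_simps)
  qed
  then have "w * (real k0 * v - X) \<le> w * v" using w by (intro mult_left_mono) auto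
  then have "exp (- (w * v)) \<le> G k0" by (simp add: G_def)
  moreover have "1 - w * v \<le> exp (- (w * v))" using exp_ge_add_one_self[of "- (w * v)"] by simp
  moreover have "G (Suc N) \<le> exp (- (w * D))"
  proof -
    have "D \<le> real (Suc N) * v - X" using D v by (simp add: algebra_simps)
    then show ?thesis unfolding G_def using w by (simp add: mult_left_mono)
  qed
  ultimately have num: "1 - v * w - exp (- (w * D)) \<le> G k0 - G (Suc N)" by (simp add: mult.commute)
  have num0: "0 \<le> G k0 - G (Suc N)"
  proof -
    have "w * (real k0 * v - X) \<le> w * (real (Suc N) * v - X)"
      using \<open>k0 \<le> N\<close> v w by (intro mult_left_mono diff_right_mono mult_right_mono) auto
    then show ?thesis by (simp add: G_def)
  qed
  have "1 - exp (- z) \<le> z" using exp_ge_add_one_self[of "- z"] by simp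
  then have "(G k0 - G (Suc N)) / z \<le> S N" unfolding S using num0 pos z by (intro divide_left_mono) auto
  then have "v * ((G k0 - G (Suc N)) / z) \<le> v * S N" using v by (intro mult_left_mono) auto
  moreover have "v * ((G k0 - G (Suc N)) / z) = (G k0 - G (Suc N)) / w" using v w by (simp add: z_def)
  moreover have "(1 - v * w - exp (- (w * D))) / w \<le> (G k0 - G (Suc N)) / w"
    using num w by (intro divide_right_mono) auto
  ultimately show "(1 - v * w - exp (- (w * D))) / w \<le> v * S N" by linarith
qed

text \<open>The main term is the leading asymptotics of the incomplete gamma integral of
  \<open>u powr (\<alpha> - 1) * exp (- u)\<close> from \<open>X\<close> on, scaled by
  \<open>v powr (- \<alpha>)\<close>. With \<open>D = ln (1 / e)\<close> the truncation at
  \<open>N\<close> costs a relative error of order \<open>e\<close>.\<close>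

lemma lam_block_asymp:
  assumes e: "0 < e" "e < 1/6"
  obtains X0 v0 D where "X0 \<ge> 1" "v0 > 0"
    "\<And>v X N. 0 < v \<Longrightarrow> v < v0 \<Longrightarrow> X0 \<le> X \<Longrightarrow> D \<le> real N * v - X \<Longrightarrow>
       \<bar>(\<Sum>k | k \<in> {1..N} \<and> X \<le> real k * v. lam v k) - v powr (- \<alpha>) * X powr (\<alpha> - 1) * exp (- X)\<bar>
         \<le> 6 * e * (v powr (- \<alpha>) * X powr (\<alpha> - 1) * exp (- X))"
proof -
  have "e < 1" using e by simp
  then obtain X0 v1 where X0: "X0 \<ge> 1" "v1 > 0"
    "\<And>v X k. 0 < v \<Longrightarrow> v < v1 \<Longrightarrow> X0 \<le> X \<Longrightarrow> X \<le> real k * v \<Longrightarrow>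
       (1 - e) * exp (- ((1 + e) * (real k * v - X))) * (v powr (1 - \<alpha>) * X powr (\<alpha> - 1) * exp (- X)) \<le> lam v k"
    "\<And>v X k. 0 < v \<Longrightarrow> v < v1 \<Longrightarrow> X0 \<le> X \<Longrightarrow> X \<le> real k * v \<Longrightarrow>
       lam v k \<le> (1 + e) * exp (- ((1 - e) * (real k * v - X))) * (v powr (1 - \<alpha>) * X powr (\<alpha> - 1) * exp (- X))"
    using lam_geometric_bounds[OF e(1)] by blast
  show thesis
  proof (rule that[of X0 "min v1 (e / 2)" "ln (1 / e)"])
    show "X0 \<ge> 1" by fact
    show "min v1 (e / 2) > 0" using X0 e by simp
    fix v X :: real and N :: nat
    assume v: "0 < v" "v < min v1 (e / 2)" and X: "X0 \<le> X" and N: "ln (1 / e) \<le> real N * v - X"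
    let ?A = "{k. k \<in> {1..N} \<and> X \<le> real k * v}"
    define Q where "Q = v powr (- \<alpha>) * X powr (\<alpha> - 1) * exp (- X)"
    have Q: "Q \<ge> 0" by (simp add: Q_def)
    have vQ: "v powr (1 - \<alpha>) * X powr (\<alpha> - 1) * exp (- X) = v * Q"
      using v powr_add[of v 1 "- \<alpha>"] by (simp add: Q_def)
    have X1: "X > 0" using X X0(1) by linarith
    have De: "ln (1 / e) \<ge> 0" "exp (- ((1 + e) * ln (1 / e))) \<le> e"
    proof -
      show *: "ln (1 / e) \<ge> 0" using e by simp
      have "1 * ln (1 / e) \<le> (1 + e) * ln (1 / e)" using * e by (intro mult_right_mono) auto
      then have "exp (- ((1 + e) * ln (1 / e))) \<le> exp (- ln (1 / e))" by simp
      also have "\<dots> = e" using e by (simp add: ln_div)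
      finally show "exp (- ((1 + e) * ln (1 / e))) \<le> e" .
    qed
    have "(\<Sum>k\<in>?A. lam v k) \<le> (\<Sum>k\<in>?A. (1 + e) * exp (- ((1 - e) * (real k * v - X))) * (v * Q))"
      using X0(4)[of v X] v X by (intro sum_mono) (auto simp: vQ)
    also have "\<dots> = (1 + e) * Q * (v * (\<Sum>k\<in>?A. exp (- ((1 - e) * (real k * v - X)))))"
      by (simp add: sum_distrib_left sum_distrib_right mult_ac)
    also have "\<dots> \<le> (1 + e) * Q * (1 / (1 - e) + v)"
      using e Q v X1 by (intro mult_left_mono geometric_block(1)) auto
    also have "\<dots> \<le> Q * (1 + 6 * e)"
    proof -
      have "1 / (1 - e) \<le> 1 + 2 * e"
      proof -
        have "2 * (e * e) \<le> e" using e mult_strict_left_mono[of e "1/2" e] by auto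
        then have "1 \<le> (1 + 2 * e) * (1 - e)" by (simp add: algebra_simps)
        then show ?thesis using e by (simp add: pos_divide_le_eq)
      qed
      then have "(1 + e) * (1 / (1 - e) + v) \<le> (1 + e) * (1 + 3 * e)"
        using e v by (intro mult_left_mono) auto
      also have "\<dots> \<le> 1 + 6 * e"
      proof -
        have "3 * (e * e) \<le> 2 * e" using e mult_strict_left_mono[of e "2/3" e] by auto
        then show ?thesis by (simp add: algebra_simps)
      qed
      finally have "Q * ((1 + e) * (1 / (1 - e) + v)) \<le> Q * (1 + 6 * e)" using Q by (intro mult_left_mono)
      then show ?thesis by (simp add: mult_ac)
    qed
    finally have up: "(\<Sum>k\<in>?A. lam v k) \<le> Q * (1 + 6 * e)" .
    have "Q * (1 - 6 * e) \<le> (1 - e) * Q * ((1 - v * (1 + e) - exp (- ((1 + e) * ln (1 / e)))) / (1 + e))"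
    proof -
      have "v * (1 + e) \<le> e / 2 * 2" using v e by (intro mult_mono) auto
      then have "(1 - 2 * e) / (1 + e) \<le> (1 - v * (1 + e) - exp (- ((1 + e) * ln (1 / e)))) / (1 + e)"
        using De e by (intro divide_right_mono) auto
      then have "(1 - e) * ((1 - 2 * e) / (1 + e)) \<le>
          (1 - e) * ((1 - v * (1 + e) - exp (- ((1 + e) * ln (1 / e)))) / (1 + e))"
        using e by (intro mult_left_mono) auto
      moreover have "1 - 6 * e \<le> (1 - e) * ((1 - 2 * e) / (1 + e))"
      proof -
        have "(1 - 6 * e) * (1 + e) \<le> (1 - e) * (1 - 2 * e)" using e by (simp add: algebra_simps)
        then show ?thesis using e by (simp add: pos_le_divide_eq)
      qed
      ultimately have "1 - 6 * e \<le> (1 - e) * ((1 - v * (1 + e) - exp (- ((1 + e) * ln (1 / e)))) / (1 + e))"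
        by linarith
      then have "Q * (1 - 6 * e) \<le> Q * ((1 - e) * ((1 - v * (1 + e) - exp (- ((1 + e) * ln (1 / e)))) / (1 + e)))"
        using Q by (rule mult_left_mono)
      then show ?thesis by (simp only: mult_ac)
    qed
    also have "\<dots> \<le> (1 - e) * Q * (v * (\<Sum>k\<in>?A. exp (- ((1 + e) * (real k * v - X)))))"
      using e Q v X1 De N by (intro mult_left_mono geometric_block(2)) auto
    also have "\<dots> = (\<Sum>k\<in>?A. (1 - e) * exp (- ((1 + e) * (real k * v - X))) * (v * Q))"
      by (simp add: sum_distrib_left sum_distrib_right mult_ac)
    also have "\<dots> \<le> (\<Sum>k\<in>?A. lam v k)"
      using X0(3)[of v X] v X by (intro sum_mono) (auto simp: vQ)
    finally have lo: "Q * (1 - 6 * e) \<le> (\<Sum>k\<in>?A. lam v k)" .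
    have "\<bar>(\<Sum>k\<in>?A. lam v k) - Q\<bar> \<le> 6 * e * Q"
      using up lo by (simp add: abs_le_iff algebra_simps)
    then show "\<bar>(\<Sum>k\<in>?A. lam v k) - v powr (- \<alpha>) * X powr (\<alpha> - 1) * exp (- X)\<bar>
         \<le> 6 * e * (v powr (- \<alpha>) * X powr (\<alpha> - 1) * exp (- X))" unfolding Q_def .
  qed
qed

section \<open>The centering and the limiting intensity\<close>

text \<open>\<open>ell\<close> as a function of \<open>v\<close>, so that its asymptotics become
  limits at 0 from the right.\<close>

definition ellv :: "real \<Rightarrow> real" where
  "ellv v = \<alpha> * ln (inverse v) + (\<alpha> - 1) * ln (\<alpha> * ln (inverse v))"

lemma ell_eq: "ell \<alpha> \<theta> n = ellv (v_sol \<theta> n)"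
  by (simp add: ell_def ellv_def n_star_def)

lemma ellv_at_top: "filterlim (\<lambda>v. ellv v - C) at_top (at_right 0)"
  unfolding ellv_def using \<alpha> by real_asymp

text \<open>This is the equation that \<open>ellv\<close> solves asymptotically:
  \<open>exp (- ellv v)\<close> cancels \<open>v powr (- \<alpha>)\<close> and divides by
  \<open>(\<alpha> * ln (inverse v)) powr (\<alpha> - 1)\<close>, which is asymptotic to the power
  of \<open>ellv v - C\<close>. Only \<open>exp C\<close> survives.\<close>

lemma ellv_density: "((\<lambda>v. v powr (- \<alpha>) * (ellv v - C) powr (\<alpha> - 1) * exp (- (ellv v - C))) \<longlongrightarrow> exp C) (at_right 0)"
proof -
  have "((\<lambda>v. ((ellv v - C) / (\<alpha> * ln (inverse v))) powr (\<alpha> - 1) * exp C) \<longlongrightarrow> 1 powr (\<alpha> - 1) * exp C) (at_right 0)"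
  proof (intro tendsto_intros)
    show "((\<lambda>v. (ellv v - C) / (\<alpha> * ln (inverse v))) \<longlongrightarrow> 1) (at_right 0)"
      unfolding ellv_def using \<alpha> by real_asymp
  qed auto
  then have "((\<lambda>v. ((ellv v - C) / (\<alpha> * ln (inverse v))) powr (\<alpha> - 1) * exp C) \<longlongrightarrow> exp C) (at_right 0)" by simp
  moreover have "\<forall>\<^sub>F v in at_right 0. ((ellv v - C) / (\<alpha> * ln (inverse v))) powr (\<alpha> - 1) * exp C =
      v powr (- \<alpha>) * (ellv v - C) powr (\<alpha> - 1) * exp (- (ellv v - C))"
  proof -
    have "\<forall>\<^sub>F v in at_right (0::real). 0 < v \<and> v < 1" unfolding eventually_at_right_field by (intro exI[of _ 1]) auto
    then show ?thesis
    proof eventually_elim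
      case (elim v)
      have L: "\<alpha> * ln (inverse v) > 0" using elim \<alpha> by (intro mult_pos_pos) (auto simp: one_less_inverse_iff)
      have "exp (- (ellv v - C)) = exp (\<alpha> * ln v) * exp (- ((\<alpha> - 1) * ln (\<alpha> * ln (inverse v)))) * exp C"
        unfolding ellv_def using elim by (simp add: ln_inverse exp_add[symmetric])
      also have "exp (\<alpha> * ln v) = v powr \<alpha>" using elim by (simp add: powr_def)
      also have "exp (- ((\<alpha> - 1) * ln (\<alpha> * ln (inverse v)))) = inverse ((\<alpha> * ln (inverse v)) powr (\<alpha> - 1))"
      proof -
        have "exp (- ((\<alpha> - 1) * ln A)) = inverse (A powr (\<alpha> - 1))" if "A > 0" for A
          using that by (simp add: powr_def exp_minus)
        then show ?thesis using L by blast
      qed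
      finally have "exp (- (ellv v - C)) = v powr \<alpha> * inverse ((\<alpha> * ln (inverse v)) powr (\<alpha> - 1)) * exp C" .
      moreover have "v powr (- \<alpha>) * v powr \<alpha> = 1" using elim by (simp add: powr_add[symmetric])
      moreover have "(u / A) powr b * d = p * u powr b * (q * inverse (A powr b) * d)" if "p * q = 1" for u A b d p q :: real
      proof -
        have "p * u powr b * (q * inverse (A powr b) * d) = (p * q) * (u powr b * inverse (A powr b) * d)"
          by (simp only: mult_ac)
        also have "\<dots> = (u / A) powr b * d" using that by (simp add: powr_divide powr_mult divide_inverse inverse_powr)
        finally show ?thesis by (rule sym)
      qed
      ultimately show ?case by metis
    qed
  qed
  ultimately show ?thesis by (rule Lim_transform_eventually)
qed

text \<open>\<open>lam_block_asymp\<close> at the threshold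
  \<open>ell \<alpha> \<theta> n - ln y\<close>, whose main term tends to
  \<open>exp (ln y) = y\<close> by \<open>ellv_density\<close>.\<close>

lemma intensity_limit:
  fixes y :: real
  assumes y: "y > 0"
  shows "(\<lambda>n. \<Sum>k | k \<in> {1..n} \<and> ell \<alpha> \<theta> n - ln y \<le> real k * v_sol \<theta> n. lam (v_sol \<theta> n) k) \<longlonglongrightarrow> y"
proof -
  define X where "X n = ell \<alpha> \<theta> n - ln y" for n
  define Q where "Q n = v_sol \<theta> n powr (- \<alpha>) * X n powr (\<alpha> - 1) * exp (- X n)" for n
  define S where "S n = (\<Sum>k | k \<in> {1..n} \<and> X n \<le> real k * v_sol \<theta> n. lam (v_sol \<theta> n) k)" for n
  have Q: "Q \<longlonglongrightarrow> y"
    using filterlim_compose[OF ellv_density v_sol_tendsto, of "ln y"] y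
    by (simp add: Q_def[abs_def] X_def ell_eq)
  have XT: "filterlim X at_top sequentially"
    using filterlim_compose[OF ellv_at_top v_sol_tendsto, of "ln y"] by (simp add: X_def[abs_def] ell_eq)
  obtain c v0 where c: "c > 0" "v0 > 0" "v0 \<le> 1"
    "\<And>v. 0 < v \<Longrightarrow> v < v0 \<Longrightarrow> c * v powr (- (\<alpha> + 1)) \<le> mean_sum v"
    using mean_sum_lower by blast
  have small: "\<forall>\<^sub>F n in sequentially. v_sol \<theta> n < w" if "w > 0" for w
    using v_sol_tendsto that unfolding filterlim_at by (auto dest: order_tendstoD(2))
  \<comment> \<open>The range of summation stops at \<open>n\<close>. Since \<open>n * v\<close> has
    at least the order \<open>v powr (- \<alpha>)\<close> while the threshold is only logarithmic,
    it stops far beyond the threshold.\<close>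
  have NT: "\<forall>\<^sub>F n in sequentially. D \<le> real n * v_sol \<theta> n - X n" for D
  proof -
    have "filterlim (\<lambda>v. c * v powr (- (\<alpha> + 1)) * v - (ellv v - ln y)) at_top (at_right 0)"
      unfolding ellv_def using c(1) \<alpha> by real_asymp
    then have "filterlim (\<lambda>n. c * v_sol \<theta> n powr (- (\<alpha> + 1)) * v_sol \<theta> n - X n) at_top sequentially"
      unfolding X_def ell_eq by (rule filterlim_compose[OF _ v_sol_tendsto])
    then have "\<forall>\<^sub>F n in sequentially. D \<le> c * v_sol \<theta> n powr (- (\<alpha> + 1)) * v_sol \<theta> n - X n"
      by (simp add: filterlim_at_top)
    then show ?thesis using eventually_ge_at_top[of 1] small[OF c(2)]
    proof eventually_elim
      case (elim n)
      note v = v_sol_props[OF elim(2)]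
      have "c * v_sol \<theta> n powr (- (\<alpha> + 1)) \<le> real n" using c(4)[OF v(1) elim(3)] v(2) by simp
      then have "c * v_sol \<theta> n powr (- (\<alpha> + 1)) * v_sol \<theta> n \<le> real n * v_sol \<theta> n"
        using v(1) by (intro mult_right_mono) auto
      then show ?case using elim by linarith
    qed
  qed
  have "(\<lambda>n. S n - Q n) \<longlonglongrightarrow> 0"
  proof (rule tendstoI)
    fix d :: real assume d: "d > 0"
    define e where "e = min (1/7) (d / (6 * (y + 1)) / 2)"
    have e: "0 < e" "e < 1/6" "6 * e * (y + 1) < d"
    proof -
      show "0 < e" "e < 1/6" using d y by (auto simp: e_def)
      have "e \<le> d / (6 * (y + 1)) / 2" by (simp add: e_def)
      then have "6 * e * (y + 1) \<le> 6 * (d / (6 * (y + 1)) / 2) * (y + 1)"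
        using y by (intro mult_right_mono mult_left_mono) auto
      also have "\<dots> = d / 2" using y by (simp add: field_simps)
      also have "\<dots> < d" using d by simp
      finally show "6 * e * (y + 1) < d" .
    qed
    obtain X0 v1 D where X0: "X0 \<ge> 1" "v1 > 0"
      "\<And>v X N. 0 < v \<Longrightarrow> v < v1 \<Longrightarrow> X0 \<le> X \<Longrightarrow> D \<le> real N * v - X \<Longrightarrow>
       \<bar>(\<Sum>k | k \<in> {1..N} \<and> X \<le> real k * v. lam v k) - v powr (- \<alpha>) * X powr (\<alpha> - 1) * exp (- X)\<bar>
         \<le> 6 * e * (v powr (- \<alpha>) * X powr (\<alpha> - 1) * exp (- X))"
      using lam_block_asymp[OF e(1,2)] by blast
    have "\<forall>\<^sub>F n in sequentially. X0 \<le> X n" using XT by (simp add: filterlim_at_top)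
    moreover have "\<forall>\<^sub>F n in sequentially. Q n < y + 1" by (rule order_tendstoD(2)[OF Q]) simp
    ultimately show "\<forall>\<^sub>F n in sequentially. dist (S n - Q n) 0 < d"
      using NT[of D] small[OF X0(2)] eventually_ge_at_top[of 1]
    proof eventually_elim
      case (elim n)
      have "\<bar>S n - Q n\<bar> \<le> 6 * e * Q n" unfolding S_def Q_def
        using elim v_sol_props(1)[OF elim(5)] by (intro X0(3)) auto
      also have "\<dots> \<le> 6 * e * (y + 1)" using elim e by (intro mult_left_mono) auto
      finally show ?case using e by simp
    qed
  qed
  from tendsto_add[OF this Q] show ?thesis by (simp add: S_def X_def)
qed

end

subsection \<open>Expectations under probability mass functions\<close>

lemma integrable_pmf_bounded:
  fixes f :: "'a \<Rightarrow> 'b :: {banach, second_countable_topology}"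
  assumes "\<And>x. norm (f x) \<le> B"
  shows "integrable (measure_pmf p) f"
  using assms by (intro measure_pmf.integrable_const_bound[where B = B]) auto

text \<open>Adding \<open>B\<close> makes the integrand nonnegative, which reduces the claim to the
  iterated nonnegative integral.\<close>

lemma expectation_pair_pmf_bounded:
  fixes f :: "'a \<times> 'b \<Rightarrow> real"
  assumes "\<And>x. \<bar>f x\<bar> \<le> B"
  shows "measure_pmf.expectation (pair_pmf p q) f =
    measure_pmf.expectation p (\<lambda>x. measure_pmf.expectation q (\<lambda>y. f (x, y)))"
proof -
  define g where "g x = f x + B" for x
  have g: "0 \<le> g x" "norm (g x) \<le> 2 * B" for x
    using assms[of x] by (auto simp: g_def abs_le_iff)
  define h where "h x = measure_pmf.expectation q (\<lambda>y. g (x, y))" for x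
  have int: "integrable (measure_pmf r) (\<lambda>z. g (k z))" for r and k :: "'c \<Rightarrow> 'a \<times> 'b"
    by (rule integrable_pmf_bounded[where B = "2 * B"]) (rule g)
  have int_f: "integrable (measure_pmf r) (\<lambda>z. f (k z))" for r and k :: "'c \<Rightarrow> 'a \<times> 'b"
    using assms by (intro integrable_pmf_bounded[where B = B]) auto
  have h: "0 \<le> h x" "norm (h x) \<le> 2 * B" for x
  proof -
    show 0: "0 \<le> h x" unfolding h_def by (intro integral_nonneg_AE AE_I2 g)
    have "h x \<le> measure_pmf.expectation q (\<lambda>_. 2 * B)"
      unfolding h_def using g(2) g(1) by (intro integral_mono int) auto
    then show "norm (h x) \<le> 2 * B" using 0 by simp
  qed
  have "ennreal (measure_pmf.expectation (pair_pmf p q) g) = (\<integral>\<^sup>+x. ennreal (g x) \<partial>pair_pmf p q)"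
    using int[of _ "\<lambda>x. x"] g by (intro nn_integral_eq_integral[symmetric]) auto
  also have "\<dots> = (\<integral>\<^sup>+x. (\<integral>\<^sup>+y. ennreal (g (x, y)) \<partial>measure_pmf q) \<partial>measure_pmf p)"
    by (rule nn_integral_pair_pmf')
  also have "\<dots> = (\<integral>\<^sup>+x. ennreal (h x) \<partial>measure_pmf p)"
    unfolding h_def using g by (intro nn_integral_cong nn_integral_eq_integral int) auto
  also have "\<dots> = ennreal (measure_pmf.expectation p h)"
    using h by (intro nn_integral_eq_integral integrable_pmf_bounded[where B = "2 * B"]) auto
  finally have eq: "measure_pmf.expectation (pair_pmf p q) g = measure_pmf.expectation p h"
    using g h by (subst (asm) ennreal_inj) (auto intro!: integral_nonneg_AE)
  have "measure_pmf.expectation (pair_pmf p q) g = measure_pmf.expectation (pair_pmf p q) f + B"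
    unfolding g_def using int_f[of _ "\<lambda>x. x"] by simp
  moreover have "h x = measure_pmf.expectation q (\<lambda>y. f (x, y)) + B" for x
    unfolding h_def g_def using int_f[of q "\<lambda>y. (x, y)"] by simp
  moreover have "integrable (measure_pmf p) (\<lambda>x. measure_pmf.expectation q (\<lambda>y. f (x, y)))"
  proof (rule integrable_pmf_bounded[where B = "2 * B + \<bar>B\<bar>"])
    fix x
    have "measure_pmf.expectation q (\<lambda>y. f (x, y)) = h x - B" using calculation(2) by simp
    then show "norm (measure_pmf.expectation q (\<lambda>y. f (x, y))) \<le> 2 * B + \<bar>B\<bar>" using h[of x] by auto
  qed
  moreover have "measure_pmf.expectation p h = measure_pmf.expectation p (\<lambda>x. measure_pmf.expectation q (\<lambda>y. f (x, y)) + B)"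
    using calculation(2) by (intro Bochner_Integration.integral_cong) auto
  ultimately show ?thesis using eq by simp
qed

lemma expectation_nat_pmf:
  fixes f :: "nat \<Rightarrow> 'b :: {banach, second_countable_topology}"
  assumes "summable (\<lambda>k. norm (pmf p k *\<^sub>R f k))"
  shows "integrable (measure_pmf p) f" "measure_pmf.expectation p f = (\<Sum>k. pmf p k *\<^sub>R f k)"
proof -
  have "integrable (count_space UNIV) (\<lambda>k. pmf p k *\<^sub>R f k)"
    using assms by (simp add: integrable_count_space_nat_iff)
  then show "integrable (measure_pmf p) f" "measure_pmf.expectation p f = (\<Sum>k. pmf p k *\<^sub>R f k)"
    unfolding measure_pmf_eq_density by (simp_all add: integrable_density integral_density integral_count_space_nat)
qed

lemma expectation_Pi_pmf_component:
  fixes f :: "'b \<Rightarrow> 'c :: {banach, second_countable_topology}"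
  assumes "finite A" "x \<in> A"
  shows "measure_pmf.expectation (Pi_pmf A d p) (\<lambda>c. f (c x)) = measure_pmf.expectation (p x) f"
    and "integrable (measure_pmf (p x)) f \<Longrightarrow> integrable (measure_pmf (Pi_pmf A d p)) (\<lambda>c. f (c x))"
proof -
  have eq: "p x = map_pmf (\<lambda>c. c x) (Pi_pmf A d p)" using assms by (simp add: Pi_pmf_component)
  show "measure_pmf.expectation (Pi_pmf A d p) (\<lambda>c. f (c x)) = measure_pmf.expectation (p x) f"
    unfolding eq by (rule integral_map_pmf[symmetric])
  assume "integrable (measure_pmf (p x)) f"
  then show "integrable (measure_pmf (Pi_pmf A d p)) (\<lambda>c. f (c x))"
    unfolding eq by (simp add: integrable_map_pmf_eq)
qed

subsection \<open>Poisson variables\<close>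

text \<open>\<^const>\<open>poisson_pmf\<close> requires a positive rate, but weights may vanish.\<close>

definition pois :: "real \<Rightarrow> nat pmf" where
  "pois r = (if r > 0 then poisson_pmf r else return_pmf 0)"

lemma pmf_pois: "r \<ge> 0 \<Longrightarrow> pmf (pois r) k = r ^ k / fact k * exp (- r)"
  by (cases "r = 0"; cases k) (auto simp: pois_def)

lemma expectation_pois:
  assumes "r \<ge> 0"
  shows "integrable (measure_pmf (pois r)) real" "measure_pmf.expectation (pois r) real = r"
proof -
  have "(\<lambda>k. r ^ k /\<^sub>R fact k) sums exp r" by (rule exp_converges)
  then have "(\<lambda>k. r * exp (- r) * (r ^ k /\<^sub>R fact k)) sums (r * exp (- r) * exp r)" by (rule sums_mult)
  also have "(\<lambda>k. r * exp (- r) * (r ^ k /\<^sub>R fact k)) = (\<lambda>k. pmf (pois r) (Suc k) *\<^sub>R real (Suc k))"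
  proof
    fix k
    have "pmf (pois r) (Suc k) *\<^sub>R real (Suc k) = r * r ^ k * exp (- r) * (real (Suc k) / fact (Suc k))"
      using assms by (simp only: pmf_pois) simp
    also have "real (Suc k) / fact (Suc k) = 1 / fact k"
      by (simp only: fact_Suc of_nat_mult) simp
    finally show "r * exp (- r) * (r ^ k /\<^sub>R fact k) = pmf (pois r) (Suc k) *\<^sub>R real (Suc k)"
      by (simp add: divide_inverse)
  qed
  also have "r * exp (- r) * exp r = r" by (simp add: exp_minus)
  finally have s: "(\<lambda>k. pmf (pois r) k *\<^sub>R real k) sums r"
    by (subst (asm) sums_Suc_iff) simp
  then have "summable (\<lambda>k. norm (pmf (pois r) k *\<^sub>R real k))" by (simp add: sums_iff)
  from expectation_nat_pmf[OF this] s
  show "integrable (measure_pmf (pois r)) real" "measure_pmf.expectation (pois r) real = r"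
    by (auto simp: sums_iff)
qed

lemma char_pois:
  assumes "r \<ge> 0"
  shows "measure_pmf.expectation (pois r) (\<lambda>k. cis (real k * x)) = exp (of_real r * (cis x - 1))"
proof -
  have "(\<lambda>k. (of_real r * cis x) ^ k /\<^sub>R fact k) sums exp (of_real r * cis x)" by (rule exp_converges)
  then have "(\<lambda>k. exp (- of_real r) * ((of_real r * cis x) ^ k /\<^sub>R fact k)) sums
      (exp (- of_real r) * exp (of_real r * cis x))" by (rule sums_mult)
  also have "(\<lambda>k. exp (- of_real r) * ((of_real r * cis x) ^ k /\<^sub>R fact k)) =
      (\<lambda>k. pmf (pois r) k *\<^sub>R cis (real k * x))"
  proof
    fix k
    have "exp (- of_real r :: complex) = of_real (exp (- r))" by (metis exp_of_real of_real_minus)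
    then show "exp (- of_real r) * ((of_real r * cis x) ^ k /\<^sub>R fact k) = pmf (pois r) k *\<^sub>R cis (real k * x)"
      using assms by (simp add: pmf_pois power_mult_distrib Complex.DeMoivre scaleR_conv_of_real divide_inverse)
  qed
  also have "exp (- of_real r) * exp (of_real r * cis x) = exp (of_real r * (cis x - 1))"
    by (simp add: exp_add[symmetric] algebra_simps)
  finally have s: "(\<lambda>k. pmf (pois r) k *\<^sub>R cis (real k * x)) sums exp (of_real r * (cis x - 1))" .
  have "(\<lambda>k. pmf (pois r) k) sums 1"
  proof -
    have "(\<lambda>k. exp (- r) * (r ^ k /\<^sub>R fact k)) sums (exp (- r) * exp r)" by (intro sums_mult exp_converges)
    then show ?thesis using assms by (simp add: pmf_pois exp_minus field_simps)
  qed
  then have "summable (\<lambda>k. norm (pmf (pois r) k *\<^sub>R cis (real k * x)))" by (simp add: sums_iff)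
  from expectation_nat_pmf(2)[OF this] s show ?thesis by (simp add: sums_iff)
qed

lemma char_Pi_pois:
  assumes A: "finite A" and r: "\<And>k. k \<in> A \<Longrightarrow> r k \<ge> 0"
  shows "measure_pmf.expectation (Pi_pmf A 0 (\<lambda>k. pois (r k))) (\<lambda>c. cis (t * real (\<Sum>k\<in>A. k * c k))) =
    exp (\<Sum>k\<in>A. of_real (r k) * (cis (real k * t) - 1))"
proof -
  let ?P = "Pi_pmf A (0::nat) (\<lambda>k. pois (r k))"
  have eq: "cis (t * real (\<Sum>k\<in>A. k * c k)) = (\<Prod>k\<in>A. cis (real (c k) * (real k * t)))" for c
    by (simp add: cis_conv_exp exp_sum[OF A, symmetric] sum_distrib_left mult_ac)
  have "prob_space.indep_vars (measure_pmf ?P) (\<lambda>_. borel) (\<lambda>k c. cis (real (c k) * (real k * t))) A"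
    by (rule prob_space.indep_vars_compose2[OF prob_space_measure_pmf indep_vars_Pi_pmf[OF A]]) simp
  then have "measure_pmf.expectation ?P (\<lambda>c. \<Prod>k\<in>A. cis (real (c k) * (real k * t))) =
      (\<Prod>k\<in>A. measure_pmf.expectation ?P (\<lambda>c. cis (real (c k) * (real k * t))))"
    by (intro prob_space.indep_vars_lebesgue_integral[OF prob_space_measure_pmf A]
        integrable_pmf_bounded[where B = 1]) auto
  also have "\<dots> = (\<Prod>k\<in>A. exp (of_real (r k) * (cis (real k * t) - 1)))"
  proof (rule prod.cong[OF refl])
    fix k assume k: "k \<in> A"
    have "measure_pmf.expectation ?P (\<lambda>c. cis (real (c k) * (real k * t))) =
        measure_pmf.expectation (pois (r k)) (\<lambda>j. cis (real j * (real k * t)))"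
      by (rule expectation_Pi_pmf_component(1)[OF A k, where f = "\<lambda>j. cis (real j * (real k * t))"])
    then show "measure_pmf.expectation ?P (\<lambda>c. cis (real (c k) * (real k * t))) =
        exp (of_real (r k) * (cis (real k * t) - 1))"
      using char_pois[OF r[OF k]] by simp
  qed
  finally show ?thesis unfolding eq by (simp add: exp_sum[OF A])
qed

subsection \<open>Fourier inversion on the integers\<close>

lemma integral_cos_int:
  fixes m :: int
  shows "(LINT t:{0..pi}|lborel. cos (t * of_int m)) = (if m = 0 then pi else 0)"
proof -
  have c: "continuous_on {0..pi} (\<lambda>t. cos (t * of_int m))" by (intro continuous_intros)
  have "(LINT t:{0..pi}|lborel. cos (t * of_int m)) = integral {0..pi} (\<lambda>t. cos (t * of_int m))"
    by (rule set_borel_integral_eq_integral(2)[OF borel_integrable_atLeastAtMost'[OF c]])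
  also have "\<dots> = (if m = 0 then pi else 0)"
  proof (cases "m = 0")
    case False
    have "((\<lambda>t. cos (t * of_int m)) has_integral (sin (pi * of_int m) / of_int m - sin (0 * of_int m) / of_int m)) {0..pi}"
      using False by (intro fundamental_theorem_of_calculus)
        (auto intro!: derivative_eq_intros simp: has_real_derivative_iff_has_vector_derivative[symmetric])
    then show ?thesis using False by (simp add: integral_unique sin_zero_iff_int2 mult.commute)
  qed simp
  finally show ?thesis .
qed

text \<open>Orthogonality: for an integer \<open>m\<close> the integral of
  \<open>cos (t * m)\<close> over \<open>[0, pi]\<close> vanishes unless \<open>m = 0\<close>.
  Exchanging this integral with the expectation picks out the event.\<close>

lemma prob_eq_fourier:
  fixes P :: "'a pmf" and T :: "'a \<Rightarrow> int" and x :: int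
  shows "measure_pmf.prob P {c. T c = x} =
    (LINT t:{0..pi}|lborel. measure_pmf.expectation P (\<lambda>c. cos (t * of_int (T c - x)))) / pi"
proof -
  interpret pair_sigma_finite "measure_pmf P" lborel
    by (intro pair_sigma_finite.intro measure_pmf.sigma_finite_measure_axioms lborel.sigma_finite_measure_axioms)
  let ?f = "\<lambda>(c, t). indicator {0..pi} t *\<^sub>R cos (t * of_int (T c - x)) :: real"
  have [measurable]: "(\<lambda>c. of_int (T c - x) :: real) \<in> borel_measurable (measure_pmf P)" by simp
  have meas: "?f \<in> borel_measurable (measure_pmf P \<Otimes>\<^sub>M lborel)" by measurable
  have si: "set_integrable lborel {0..pi} (\<lambda>t. cos (t * of_int m))" for m :: int
    by (intro borel_integrable_atLeastAtMost' continuous_intros)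
  have "integrable (measure_pmf P \<Otimes>\<^sub>M lborel) ?f"
  proof (rule Fubini_integrable[OF meas])
    show "AE c in measure_pmf P. integrable lborel (\<lambda>t. ?f (c, t))"
    proof (intro AE_I2)
      fix c
      show "integrable lborel (\<lambda>t. ?f (c, t))" using si[of "T c - x"] by (simp add: set_integrable_def)
    qed
    show "integrable (measure_pmf P) (\<lambda>c. LINT t|lborel. norm (?f (c, t)))"
    proof (rule integrable_pmf_bounded[where B = pi])
      fix c
      have "(LINT t|lborel. norm (?f (c, t))) \<le> (LINT t|lborel. indicator {0..pi} t *\<^sub>R (1::real))"
      proof (rule integral_mono)
        show "integrable lborel (\<lambda>t. norm (?f (c, t)))"
          using si[of "T c - x"] unfolding set_integrable_def by (intro integrable_norm) simp
      qed (auto split: split_indicator)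
      moreover have "0 \<le> (LINT t|lborel. norm (?f (c, t)))" by (intro integral_nonneg_AE) auto
      ultimately show "norm (LINT t|lborel. norm (?f (c, t))) \<le> pi" by simp
    qed
  qed
  then have "(LINT t|lborel. measure_pmf.expectation P (\<lambda>c. ?f (c, t))) =
      measure_pmf.expectation P (\<lambda>c. LINT t|lborel. ?f (c, t))"
    by (intro Fubini_integral) (simp add: case_prod_unfold)
  also have "(\<lambda>c. LINT t|lborel. ?f (c, t)) = (\<lambda>c. pi * indicator {c. T c = x} c)"
  proof
    fix c
    show "(LINT t|lborel. ?f (c, t)) = pi * indicator {c. T c = x} c"
      using integral_cos_int[of "T c - x"] unfolding set_lebesgue_integral_def by simp
  qed
  also have "measure_pmf.expectation P \<dots> = pi * measure_pmf.prob P {c. T c = x}" by simp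
  finally show ?thesis by (simp add: set_lebesgue_integral_def)
qed

context power_weights
begin

text \<open>Used for three index sets: \<open>{1..n}\<close> for all lengths, \<open>{1..<b}\<close>
  for the short ones and \<open>{b..n}\<close> for the long ones.\<close>

definition long_pmf :: "real \<Rightarrow> nat set \<Rightarrow> (nat \<Rightarrow> nat) pmf" where
  "long_pmf v A = Pi_pmf A 0 (\<lambda>k. pois (lam v k))"

text \<open>\<open>x\<close> ranges over the integers because \<open>n\<close> minus the total
  length of the long cycles can be negative; both sides are then 0.\<close>

lemma prob_eq_fourier_coeff:
  "measure_pmf.prob (long_pmf v {1..<b}) {c. int (\<Sum>k\<in>{1..<b}. k * c k) = x} = fourier_coeff v b (of_int x)"
proof -
  let ?P = "long_pmf v {1..<b}" and ?T = "\<lambda>c::nat\<Rightarrow>nat. \<Sum>k\<in>{1..<b}. k * c k"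
  have E: "measure_pmf.expectation ?P (\<lambda>c. cos (t * of_int (int (?T c) - x))) =
      exp (- damp v b t) * cos (phase v b t - t * of_int x)" for t
  proof -
    let ?z = "\<Sum>k\<in>{1..<b}. of_real (lam v k) * (cis (real k * t) - 1)"
    have int: "integrable (measure_pmf ?P) (\<lambda>c. cis (t * real (?T c)))"
      by (rule integrable_pmf_bounded[where B = 1]) simp
    have "measure_pmf.expectation ?P (\<lambda>c. cos (t * of_int (int (?T c) - x))) =
        measure_pmf.expectation ?P (\<lambda>c. Re (cis (- (t * of_int x)) * cis (t * real (?T c))))"
      by (simp add: cis_mult algebra_simps)
    also have "\<dots> = Re (cis (- (t * of_int x)) * measure_pmf.expectation ?P (\<lambda>c. cis (t * real (?T c))))"
      using int by (subst integral_Re) auto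
    also have "measure_pmf.expectation ?P (\<lambda>c. cis (t * real (?T c))) = exp ?z"
      unfolding long_pmf_def by (intro char_Pi_pois lam_nonneg) simp
    also have "cis (- (t * of_int x)) = exp (\<i> * of_real (- (t * of_int x)))" by (simp only: cis_conv_exp)
    also have "Re (exp (\<i> * of_real (- (t * of_int x))) * exp ?z) = Re (exp (\<i> * of_real (- (t * of_int x)) + ?z))"
      by (simp only: exp_add)
    also have "\<dots> = exp (Re ?z) * cos (- (t * of_int x) + Im ?z)"
      by (simp add: Re_exp)
    also have "Re ?z = - damp v b t" by (simp add: damp_def Re_sum sum_negf[symmetric] algebra_simps)
    also have "Im ?z = phase v b t" by (simp add: phase_def Im_sum)
    finally show ?thesis by (simp add: algebra_simps)
  qed
  have "measure_pmf.prob ?P {c. int (?T c) = x} =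
      (LINT t:{0..pi}|lborel. exp (- damp v b t) * cos (phase v b t - t * of_int x)) / pi"
    using prob_eq_fourier[of ?P "\<lambda>c. int (?T c)" x] unfolding E .
  also have "(LINT t:{0..pi}|lborel. exp (- damp v b t) * cos (phase v b t - t * of_int x)) =
      integral {0..pi} (\<lambda>t. exp (- damp v b t) * cos (phase v b t - t * of_int x))"
    by (intro set_borel_integral_eq_integral(2) borel_integrable_atLeastAtMost' continuous_intros)
  finally show ?thesis by (simp add: fourier_coeff_def)
qed

end

subsection \<open>Cycle counts as conditioned Poisson variables\<close>

context power_weights
begin

lemma pmf_long_pmf:
  assumes "finite A" "\<And>k. k \<notin> A \<Longrightarrow> c k = 0"
  shows "pmf (long_pmf v A) c = (\<Prod>k\<in>A. lam v k ^ c k / fact (c k) * exp (- lam v k))"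
  using assms unfolding long_pmf_def by (subst pmf_Pi') (auto simp: pmf_pois lam_nonneg)

text \<open>On a type of \<open>n\<close> the factors \<open>exp (- (k * v))\<close> multiply to the
  constant \<open>exp (- (n * v))\<close>, which is why \<open>v\<close> is free.\<close>

lemma weight_eq_pmf:
  assumes c: "c \<in> cycle_types n"
  shows "(\<Prod>k=1..n. \<theta> k ^ c k) * cauchy_weight n c =
    exp (real n * v + (\<Sum>k=1..n. lam v k)) * pmf (long_pmf v {1..n}) c"
proof -
  have s: "real (\<Sum>k=1..n. k * c k) = real n" using c by (simp add: cycle_types_def)
  have "pmf (long_pmf v {1..n}) c = (\<Prod>k=1..n. lam v k ^ c k / fact (c k) * exp (- lam v k))"
    using c by (intro pmf_long_pmf) (auto simp: cycle_types_def)
  also have "\<dots> = (\<Prod>k=1..n. \<theta> k ^ c k * (1 / (real k ^ c k * fact (c k))) * exp (- (real (k * c k) * v)) * exp (- lam v k))"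
  proof (rule prod.cong[OF refl])
    fix k assume "k \<in> {1..n}"
    have "exp (- (real k * v)) ^ c k = exp (- (real (k * c k) * v))"
      by (simp add: exp_of_nat_mult[symmetric] mult_ac)
    then show "lam v k ^ c k / fact (c k) * exp (- lam v k) =
        \<theta> k ^ c k * (1 / (real k ^ c k * fact (c k))) * exp (- (real (k * c k) * v)) * exp (- lam v k)"
      unfolding lam_def[of v k] power_mult_distrib power_divide by simp
  qed
  also have "\<dots> = (\<Prod>k=1..n. \<theta> k ^ c k) * cauchy_weight n c * exp (- (real n * v)) * exp (- (\<Sum>k=1..n. lam v k))"
    unfolding prod.distrib cauchy_weight_def s[symmetric]
    by (simp add: prod.distrib exp_sum[symmetric] sum_negf sum_distrib_right prod_dividef)
  finally show ?thesis by (simp add: exp_add exp_minus field_simps)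
qed

lemma sum_perm_weight:
  "(\<Sum>\<sigma> | \<sigma> permutes {1..n}. perm_weight \<theta> n \<sigma> * F (cycle_count n \<sigma>)) =
    fact n * exp (real n * v + (\<Sum>k=1..n. lam v k)) *
    measure_pmf.expectation (long_pmf v {1..n}) (\<lambda>c. F c * indicator (cycle_types n) c)"
proof -
  have "(\<Sum>\<sigma> | \<sigma> permutes {1..n}. perm_weight \<theta> n \<sigma> * F (cycle_count n \<sigma>)) =
      fact n * (\<Sum>c\<in>cycle_types n. (\<Prod>k=1..n. \<theta> k ^ c k) * F c * cauchy_weight n c)"
    unfolding perm_weight_def by (rule cauchy_cycle_formula[where F = "\<lambda>c. (\<Prod>k=1..n. \<theta> k ^ c k) * F c"])
  also have "(\<Sum>c\<in>cycle_types n. (\<Prod>k=1..n. \<theta> k ^ c k) * F c * cauchy_weight n c) =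
      (\<Sum>c\<in>cycle_types n. exp (real n * v + (\<Sum>k=1..n. lam v k)) * (F c * pmf (long_pmf v {1..n}) c))"
  proof (rule sum.cong[OF refl])
    fix c assume "c \<in> cycle_types n"
    from weight_eq_pmf[OF this, of v]
    show "(\<Prod>k=1..n. \<theta> k ^ c k) * F c * cauchy_weight n c =
        exp (real n * v + (\<Sum>k=1..n. lam v k)) * (F c * pmf (long_pmf v {1..n}) c)"
      by (simp add: mult_ac)
  qed
  also have "\<dots> = exp (real n * v + (\<Sum>k=1..n. lam v k)) *
      measure_pmf.expectation (long_pmf v {1..n}) (\<lambda>c. F c * indicator (cycle_types n) c)"
    unfolding sum_distrib_left[symmetric]
    by (subst integral_measure_pmf_real[OF finite_cycle_types]) (auto simp: indicator_def split: if_splits)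
  finally show ?thesis by simp
qed

text \<open>Given the independent long counts \<open>z\<close>, membership in
  \<open>cycle_types n\<close> says that the short total is \<open>n\<close> minus the long total,
  an event whose probability is a Fourier coefficient. The case \<open>b = Suc n\<close> is that of
  an empty long range.\<close>

lemma expectation_split:
  assumes b: "1 \<le> b" "b \<le> Suc n" and G: "\<And>z. \<bar>G z\<bar> \<le> B"
  shows "measure_pmf.expectation (long_pmf v {1..n})
      (\<lambda>c. G (\<lambda>k. if b \<le> k then c k else 0) * indicator (cycle_types n) c) =
    measure_pmf.expectation (long_pmf v {b..n})
      (\<lambda>z. G z * fourier_coeff v b (real n - real (\<Sum>k\<in>{b..n}. k * z k)))"
proof -
  let ?P = "long_pmf v {b..n}" and ?Q = "long_pmf v {1..<b}"
  let ?m = "\<lambda>(f::nat\<Rightarrow>nat, g) x. if x \<in> {b..n} then f x else g x"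
  let ?H = "\<lambda>c. G (\<lambda>k. if b \<le> k then c k else 0) * indicator (cycle_types n) c"
  have un: "{1..n} = {b..n} \<union> {1..<b}" using b by auto
  have eq: "long_pmf v {1..n} = map_pmf ?m (pair_pmf ?P ?Q)"
    unfolding un long_pmf_def by (rule Pi_pmf_union) auto
  have bd: "\<bar>?H c\<bar> \<le> B" for c
    using G[of "\<lambda>k. if b \<le> k then c k else 0"] by (auto simp: indicator_def abs_mult)
  have "measure_pmf.expectation (long_pmf v {1..n}) ?H = measure_pmf.expectation (pair_pmf ?P ?Q) (\<lambda>x. ?H (?m x))"
    unfolding eq by (rule integral_map_pmf)
  also have "\<dots> = measure_pmf.expectation ?P (\<lambda>f. measure_pmf.expectation ?Q (\<lambda>g. ?H (?m (f, g))))"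
    using bd by (rule expectation_pair_pmf_bounded)
  also have "\<dots> = measure_pmf.expectation ?P
      (\<lambda>z. G z * fourier_coeff v b (real n - real (\<Sum>k\<in>{b..n}. k * z k)))"
  proof (intro integral_cong_AE)
    show "AE f in measure_pmf ?P. measure_pmf.expectation ?Q (\<lambda>g. ?H (?m (f, g))) =
        G f * fourier_coeff v b (real n - real (\<Sum>k\<in>{b..n}. k * f k))"
      unfolding AE_measure_pmf_iff
    proof
      fix f assume "f \<in> set_pmf ?P"
      then have f: "f k = 0" if "k \<notin> {b..n}" for k
        using that set_Pi_pmf_subset[of "{b..n}" 0 "\<lambda>k. pois (lam v k)"] unfolding long_pmf_def by blast
      have "measure_pmf.expectation ?Q (\<lambda>g. ?H (?m (f, g))) =
          measure_pmf.expectation ?Q (\<lambda>g. G f * indicator {g. int (\<Sum>k\<in>{1..<b}. k * g k) = int n - int (\<Sum>k\<in>{b..n}. k * f k)} g)"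
      proof (intro integral_cong_AE)
        show "AE g in measure_pmf ?Q. ?H (?m (f, g)) =
            G f * indicator {g. int (\<Sum>k\<in>{1..<b}. k * g k) = int n - int (\<Sum>k\<in>{b..n}. k * f k)} g"
          unfolding AE_measure_pmf_iff
        proof
          fix g assume "g \<in> set_pmf ?Q"
          then have g: "g k = 0" if "k \<notin> {1..<b}" for k
            using that set_Pi_pmf_subset[of "{1..<b}" 0 "\<lambda>k. pois (lam v k)"] unfolding long_pmf_def by blast
          have 1: "(\<lambda>k. if b \<le> k then ?m (f, g) k else 0) = f"
            using f g by (auto simp: fun_eq_iff)
          have "(\<Sum>k=1..n. k * ?m (f, g) k) = (\<Sum>k\<in>{b..n}. k * ?m (f, g) k) + (\<Sum>k\<in>{1..<b}. k * ?m (f, g) k)"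
            unfolding un by (rule sum.union_disjoint) auto
          also have "(\<Sum>k\<in>{b..n}. k * ?m (f, g) k) = (\<Sum>k\<in>{b..n}. k * f k)" by (intro sum.cong) auto
          also have "(\<Sum>k\<in>{1..<b}. k * ?m (f, g) k) = (\<Sum>k\<in>{1..<b}. k * g k)" by (intro sum.cong) auto
          finally have 2: "(\<Sum>k=1..n. k * ?m (f, g) k) = (\<Sum>k\<in>{b..n}. k * f k) + (\<Sum>k\<in>{1..<b}. k * g k)" .
          have "?m (f, g) \<in> cycle_types n \<longleftrightarrow> (\<Sum>k=1..n. k * ?m (f, g) k) = n"
            using g b unfolding cycle_types_def mem_Collect_eq by auto
          also have "\<dots> \<longleftrightarrow> int (\<Sum>k\<in>{1..<b}. k * g k) = int n - int (\<Sum>k\<in>{b..n}. k * f k)"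
            unfolding 2 by linarith
          finally show "?H (?m (f, g)) =
            G f * indicator {g. int (\<Sum>k\<in>{1..<b}. k * g k) = int n - int (\<Sum>k\<in>{b..n}. k * f k)} g"
            unfolding 1 by (simp add: indicator_def)
        qed
      qed simp_all
      also have "\<dots> = G f * measure_pmf.prob ?Q {g. int (\<Sum>k\<in>{1..<b}. k * g k) = int n - int (\<Sum>k\<in>{b..n}. k * f k)}"
        by simp
      also have "\<dots> = G f * fourier_coeff v b (of_int (int n - int (\<Sum>k\<in>{b..n}. k * f k)))"
        unfolding prob_eq_fourier_coeff ..
      finally show "measure_pmf.expectation ?Q (\<lambda>g. ?H (?m (f, g))) =
        G f * fourier_coeff v b (real n - real (\<Sum>k\<in>{b..n}. k * f k))" by simp
    qed
  qed simp_all
  finally show ?thesis .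
qed

lemma expectation_total:
  "integrable (measure_pmf (long_pmf v {b..n})) (\<lambda>z. real (\<Sum>k\<in>{b..n}. k * z k))"
  "measure_pmf.expectation (long_pmf v {b..n}) (\<lambda>z. real (\<Sum>k\<in>{b..n}. k * z k)) =
     (\<Sum>k\<in>{b..n}. real k * lam v k)"
proof -
  have int: "integrable (measure_pmf (long_pmf v {b..n})) (\<lambda>z. real (z k))" if "k \<in> {b..n}" for k
    unfolding long_pmf_def using that
    by (intro expectation_Pi_pmf_component(2)[where f = real] expectation_pois lam_nonneg) auto
  have E: "measure_pmf.expectation (long_pmf v {b..n}) (\<lambda>z. real (z k)) = lam v k" if "k \<in> {b..n}" for k
    unfolding long_pmf_def using that
    by (subst expectation_Pi_pmf_component(1)[where f = real]) (auto simp: expectation_pois lam_nonneg)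
  show "integrable (measure_pmf (long_pmf v {b..n})) (\<lambda>z. real (\<Sum>k\<in>{b..n}. k * z k))"
    using int by (auto simp: of_nat_sum intro!: Bochner_Integration.integrable_sum)
  show "measure_pmf.expectation (long_pmf v {b..n}) (\<lambda>z. real (\<Sum>k\<in>{b..n}. k * z k)) =
     (\<Sum>k\<in>{b..n}. real k * lam v k)"
    unfolding of_nat_sum of_nat_mult using int E by (subst Bochner_Integration.integral_sum) auto
qed

section \<open>Removing the conditioning\<close>

text \<open>\<open>p z\<close> stands for the probability of the conditioning event given the long
  counts \<open>z\<close>. Its mean deviation from \<open>p0\<close> is at most
  \<open>K * S\<close>, and passing from \<open>p0\<close> to the mean of \<open>p\<close> costs the
  same again, hence the factor 2.\<close>

lemma nearly_constant_reweighting: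
  fixes P :: "'a pmf" and G p m :: "'a \<Rightarrow> real"
  assumes G: "\<And>z. \<bar>G z\<bar> \<le> B" and p: "\<And>z. \<bar>p z - p0\<bar> \<le> K * m z" "\<And>z. \<bar>p z\<bar> \<le> U"
    and m: "integrable (measure_pmf P) m" "measure_pmf.expectation P m \<le> S" and K: "K \<ge> 0"
  shows "\<bar>measure_pmf.expectation P p - p0\<bar> \<le> K * S"
    and "\<bar>measure_pmf.expectation P (\<lambda>z. G z * p z) -
      measure_pmf.expectation P p * measure_pmf.expectation P G\<bar> \<le> 2 * B * K * S"
proof -
  let ?E = "measure_pmf.expectation P"
  define q where "q = ?E p"
  have B: "B \<ge> 0" using G[of undefined] by linarith
  have ip: "integrable (measure_pmf P) p" using p(2) by (intro integrable_pmf_bounded[where B = U]) auto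
  have iG: "integrable (measure_pmf P) G" using G by (intro integrable_pmf_bounded[where B = B]) auto
  have iGp: "integrable (measure_pmf P) (\<lambda>z. G z * p z)"
    using G p(2) B by (intro integrable_pmf_bounded[where B = "B * U"]) (auto simp: abs_mult intro!: mult_mono)
  have abs1: "?E (\<lambda>z. \<bar>p z - p0\<bar>) \<le> K * S"
  proof -
    have "?E (\<lambda>z. \<bar>p z - p0\<bar>) \<le> ?E (\<lambda>z. K * m z)"
      using ip m p by (intro integral_mono integrable_abs Bochner_Integration.integrable_diff) auto
    also have "\<dots> \<le> K * S" using m K by (simp add: mult_left_mono)
    finally show ?thesis .
  qed
  have "q - p0 = ?E (\<lambda>z. p z - p0)" unfolding q_def using ip by simp
  then show q: "\<bar>?E p - p0\<bar> \<le> K * S"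
    unfolding q_def using abs1 integral_abs_bound[of "measure_pmf P" "\<lambda>z. p z - p0"] by linarith
  have "?E (\<lambda>z. G z * p z) - q * ?E G = ?E (\<lambda>z. G z * (p z - q))"
    using iG iGp by (simp add: right_diff_distrib mult.commute)
  also have "\<bar>\<dots>\<bar> \<le> ?E (\<lambda>z. \<bar>G z * (p z - q)\<bar>)" by (rule integral_abs_bound)
  also have "\<dots> \<le> ?E (\<lambda>z. B * (\<bar>p z - p0\<bar> + K * S))"
  proof (rule integral_mono)
    show "integrable (measure_pmf P) (\<lambda>z. \<bar>G z * (p z - q)\<bar>)"
      using iG iGp by (simp add: right_diff_distrib)
    show "integrable (measure_pmf P) (\<lambda>z. B * (\<bar>p z - p0\<bar> + K * S))"
      using ip by (intro integrable_mult_right Bochner_Integration.integrable_add integrable_abs Bochner_Integration.integrable_diff) auto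
    fix z
    have "\<bar>p z - q\<bar> \<le> \<bar>p z - p0\<bar> + K * S" using q unfolding q_def by linarith
    then show "\<bar>G z * (p z - q)\<bar> \<le> B * (\<bar>p z - p0\<bar> + K * S)"
      unfolding abs_mult using G B by (intro mult_mono) auto
  qed
  also have "\<dots> = B * (?E (\<lambda>z. \<bar>p z - p0\<bar>) + K * S)" using ip by simp
  also have "\<dots> \<le> B * (K * S + K * S)" using abs1 B by (intro mult_left_mono) auto
  finally show "\<bar>?E (\<lambda>z. G z * p z) - ?E p * ?E G\<bar> \<le> 2 * B * K * S" unfolding q_def by (simp add: mult_ac)
qed

definition bcut :: "real \<Rightarrow> nat" where
  "bcut v = nat \<lceil>3 / 4 * (\<alpha> * ln (inverse v)) / v\<rceil>"

lemma bcut_props: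
  "\<forall>\<^sub>F v in at_right 0. 1 \<le> bcut v \<and> 8 / v + 1 \<le> real (bcut v) \<and>
     3 / 4 * (\<alpha> * ln (inverse v)) \<le> real (bcut v) * v \<and>
     real (bcut v) * v \<le> 3 / 4 * (\<alpha> * ln (inverse v)) + v"
proof -
  have "\<forall>\<^sub>F v in at_right 0. 8 / v + 1 \<le> 3 / 4 * (\<alpha> * ln (inverse v)) / v"
    using \<alpha> by real_asymp
  moreover have "\<forall>\<^sub>F v in at_right (0::real). 0 < v" by (simp add: eventually_at_right_less)
  ultimately show ?thesis
  proof eventually_elim
    case (elim v)
    let ?x = "3 / 4 * (\<alpha> * ln (inverse v)) / v"
    have "8 / v > 0" using elim by simp
    then have b: "?x \<le> real (bcut v)" "real (bcut v) \<le> ?x + 1" "?x > 0"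
      using elim unfolding bcut_def by linarith+
    have "8 / v + 1 \<le> real (bcut v)" using b elim by linarith
    moreover from this have "1 \<le> bcut v" using \<open>8 / v > 0\<close> by linarith
    moreover have "?x * v \<le> real (bcut v) * v" "real (bcut v) * v \<le> (?x + 1) * v"
      using elim by (intro mult_right_mono b less_imp_le; simp)+
    moreover have "?x * v = 3 / 4 * (\<alpha> * ln (inverse v))" using elim by simp
    ultimately show ?case unfolding distrib_right by linarith
  qed
qed

text \<open>\<open>G\<close> is only bounded and may vary with \<open>n\<close>, so this is
  convergence in total variation. The weighted expectation is the mean of \<open>G n z\<close>
  weighted by Fourier coefficients, divided by the mean of these coefficients; positivity of this
  denominator gives the second claim.\<close>

lemma conditioned_counts_limit:
  fixes G :: "nat \<Rightarrow> (nat \<Rightarrow> nat) \<Rightarrow> real"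
  assumes G: "\<And>n z. \<bar>G n z\<bar> \<le> B"
  shows "(\<lambda>n. (\<Sum>\<sigma> | \<sigma> permutes {1..n}. perm_weight \<theta> n \<sigma> *
            G n (\<lambda>k. if bcut (v_sol \<theta> n) \<le> k then cycle_count n \<sigma> k else 0)) / (norm_const \<theta> n * fact n) -
          measure_pmf.expectation (long_pmf (v_sol \<theta> n) {bcut (v_sol \<theta> n)..n}) (G n)) \<longlonglongrightarrow> 0"
    and "\<forall>\<^sub>F n in sequentially. norm_const \<theta> n > 0"
proof -
  obtain K c d v0 where KC: "K > 0" "c > 0" "d > 0" "v0 > 0" "v0 \<le> 1"
    "\<And>v b j j'. 0 < v \<Longrightarrow> v < v0 \<Longrightarrow> 8 / v + 1 \<le> real b \<Longrightarrow>
       \<bar>fourier_coeff v b j - fourier_coeff v b j'\<bar> \<le> K * \<bar>j - j'\<bar> * v powr (\<alpha> + 2)"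
    "\<And>v b x. 0 < v \<Longrightarrow> v < v0 \<Longrightarrow> 8 / v + 1 \<le> real b \<Longrightarrow>
       \<bar>(\<Sum>k\<in>{1..<b}. real k * lam v k) - x\<bar> * v powr (\<alpha> / 2 + 1) \<le> d \<Longrightarrow>
       c * v powr (\<alpha> / 2 + 1) \<le> fourier_coeff v b x"
    using local_limit by blast
  obtain C where C: "C > 0"
    "\<And>v B b. v > 0 \<Longrightarrow> b \<ge> 1 \<Longrightarrow> B \<le> real b * v \<Longrightarrow>
       \<bar>(\<Sum>k\<in>{1..<b}. real k * lam v k) - mean_sum v\<bar> \<le> C * exp (- (3 / 4 * B)) * v powr (- (\<alpha> + 1))"
    "\<And>v B b n. v > 0 \<Longrightarrow> b \<ge> 1 \<Longrightarrow> B \<le> real b * v \<Longrightarrow>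
       (\<Sum>k\<in>{b..n}. real k * lam v k) \<le> C * exp (- (3 / 4 * B)) * v powr (- (\<alpha> + 1))"
    using mean_tail by blast
  define T where "T v = C * exp (- (3 / 4 * (3 / 4 * (\<alpha> * ln (inverse v))))) * v powr (- (\<alpha> + 1))" for v
  define s where "s v = v powr (\<alpha> / 2 + 1)" for v :: real
  have Ts: "((\<lambda>v. T v * s v) \<longlongrightarrow> 0) (at_right 0)"
    unfolding T_def s_def using C(1) \<alpha> by real_asymp
  have B: "B \<ge> 0" using G[of 0 undefined] by linarith
  have "\<forall>\<^sub>F v in at_right 0. v < v0" using KC(4) by (auto simp: eventually_at_right_field)
  \<comment> \<open>Below \<open>d\<close> the local lower bound applies at \<open>x = n\<close>;
    below \<open>c / (2 * K)\<close> the mean of the point probabilities keeps at least half of that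
    bound.\<close>
  moreover have "\<forall>\<^sub>F v in at_right 0. T v * s v < min d (c / (2 * K))"
    using KC by (intro order_tendstoD(2)[OF Ts]) auto
  ultimately have "\<forall>\<^sub>F v in at_right 0. v < v0 \<and> T v * s v < min d (c / (2 * K)) \<and>
      1 \<le> bcut v \<and> 8 / v + 1 \<le> real (bcut v) \<and> 3 / 4 * (\<alpha> * ln (inverse v)) \<le> real (bcut v) * v"
    using bcut_props by eventually_elim blast
  then have "\<forall>\<^sub>F n in sequentially. v_sol \<theta> n < v0 \<and> T (v_sol \<theta> n) * s (v_sol \<theta> n) < min d (c / (2 * K)) \<and>
      1 \<le> bcut (v_sol \<theta> n) \<and> 8 / v_sol \<theta> n + 1 \<le> real (bcut (v_sol \<theta> n)) \<and>
      3 / 4 * (\<alpha> * ln (inverse (v_sol \<theta> n))) \<le> real (bcut (v_sol \<theta> n)) * v_sol \<theta> n"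
    by (rule eventually_compose_filterlim[OF _ v_sol_tendsto])
  \<comment> \<open>Again \<open>n * v\<close> has at least the order
    \<open>v powr (- \<alpha>)\<close>, while \<open>bcut v * v\<close> is logarithmic.\<close>
  moreover have "\<forall>\<^sub>F n in sequentially. bcut (v_sol \<theta> n) \<le> Suc n"
  proof -
    obtain c' v1 where c': "c' > 0" "v1 > 0" "v1 \<le> 1"
      "\<And>v. 0 < v \<Longrightarrow> v < v1 \<Longrightarrow> c' * v powr (- (\<alpha> + 1)) \<le> mean_sum v"
      using mean_sum_lower by blast
    have "\<forall>\<^sub>F v in at_right 0. 3 / 4 * (\<alpha> * ln (inverse v)) + v \<le> c' * v powr (- (\<alpha> + 1)) * v"
      using c'(1) \<alpha> by real_asymp
    moreover have "\<forall>\<^sub>F v in at_right 0. v < v1" using c'(2) by (auto simp: eventually_at_right_field)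
    ultimately have "\<forall>\<^sub>F v in at_right 0. v < v1 \<and> real (bcut v) * v \<le> c' * v powr (- (\<alpha> + 1)) * v"
      using bcut_props by eventually_elim linarith
    then have "\<forall>\<^sub>F n in sequentially. v_sol \<theta> n < v1 \<and>
        real (bcut (v_sol \<theta> n)) * v_sol \<theta> n \<le> c' * v_sol \<theta> n powr (- (\<alpha> + 1)) * v_sol \<theta> n"
      by (rule eventually_compose_filterlim[OF _ v_sol_tendsto])
    then show ?thesis using eventually_ge_at_top[of 1]
    proof eventually_elim
      case (elim n)
      note v = v_sol_props[OF elim(2)]
      have "real (bcut (v_sol \<theta> n)) \<le> c' * v_sol \<theta> n powr (- (\<alpha> + 1))"
        using elim v(1) by (simp add: mult_le_cancel_right)
      also have "\<dots> \<le> real n" using c'(4)[OF v(1)] elim v(2) by simp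
      finally show ?case by simp
    qed
  qed
  ultimately have ev: "\<forall>\<^sub>F n in sequentially. norm_const \<theta> n > 0 \<and>
    norm ((\<Sum>\<sigma> | \<sigma> permutes {1..n}. perm_weight \<theta> n \<sigma> *
            G n (\<lambda>k. if bcut (v_sol \<theta> n) \<le> k then cycle_count n \<sigma> k else 0)) / (norm_const \<theta> n * fact n) -
          measure_pmf.expectation (long_pmf (v_sol \<theta> n) {bcut (v_sol \<theta> n)..n}) (G n))
      \<le> 4 * B * K / c * (T (v_sol \<theta> n) * s (v_sol \<theta> n))"
    using eventually_ge_at_top[of 1]
  proof eventually_elim
    case (elim n)
    define v where "v = v_sol \<theta> n"
    define b where "b = bcut v"
    have v: "v > 0" "mean_sum v = real n" using v_sol_props[OF elim(3)] by (auto simp: v_def)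
    have v0: "v < v0" and Tsv: "T v * s v < d" "T v * s v < c / (2 * K)" and b: "1 \<le> b" "b \<le> Suc n"
      "8 / v + 1 \<le> real b" "3 / 4 * (\<alpha> * ln (inverse v)) \<le> real b * v"
      using elim by (auto simp: v_def b_def)
    let ?P = "long_pmf v {b..n}" and ?m = "\<lambda>z. real (\<Sum>k\<in>{b..n}. k * z k)"
    let ?p = "\<lambda>z. fourier_coeff v b (real n - ?m z)"
    have s: "s v > 0" using v by (simp add: s_def)
    have s2: "v powr (\<alpha> + 2) = s v * s v" using v by (simp add: s_def powr_add[symmetric])
    have p0: "c * s v \<le> fourier_coeff v b (real n)"
    proof -
      have "\<bar>(\<Sum>k\<in>{1..<b}. real k * lam v k) - real n\<bar> \<le> T v"
        using C(2)[OF v(1) b(1) b(4)] v(2) by (simp add: T_def)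
      then have "\<bar>(\<Sum>k\<in>{1..<b}. real k * lam v k) - real n\<bar> * s v \<le> T v * s v"
        using s by (intro mult_right_mono) auto
      then show ?thesis unfolding s_def using Tsv(1) by (intro KC(7) v v0 b) (auto simp: s_def)
    qed
    have p_close: "\<bar>?p z - fourier_coeff v b (real n)\<bar> \<le> K * (s v * s v) * ?m z" for z
    proof -
      have "\<bar>real n - ?m z - real n\<bar> = ?m z" by (simp del: of_nat_sum)
      then have "\<bar>?p z - fourier_coeff v b (real n)\<bar> \<le> K * ?m z * (s v * s v)"
        using KC(6)[OF v(1) v0 b(3), of "real n - ?m z" "real n"] unfolding s2 by (simp only:)
      then show ?thesis by (simp only: mult_ac)
    qed
    have p_bd: "\<bar>?p z\<bar> \<le> 1" for z
    proof -
      have "?p z = fourier_coeff v b (of_int (int n - int (\<Sum>k\<in>{b..n}. k * z k)))" by simp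
      also have "\<dots> = measure_pmf.prob (long_pmf v {1..<b})
          {c. int (\<Sum>k\<in>{1..<b}. k * c k) = int n - int (\<Sum>k\<in>{b..n}. k * z k)}"
        by (rule prob_eq_fourier_coeff[symmetric])
      finally show ?thesis by simp
    qed
    have Em: "measure_pmf.expectation ?P ?m \<le> T v"
      unfolding expectation_total T_def by (intro C(3) v b)
    have K': "K * (s v * s v) \<ge> 0" using KC by simp
    define q where "q = measure_pmf.expectation ?P ?p"
    note rw = nearly_constant_reweighting[where G = "G n" and p = ?p and m = ?m and P = ?P,
        OF G p_close p_bd expectation_total(1) Em K']
    have "K * (s v * s v) * T v = K * (T v * s v) * s v" by simp
    also have "\<dots> \<le> K * (c / (2 * K)) * s v" using Tsv KC s by (intro mult_right_mono mult_left_mono) auto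
    also have "\<dots> = c / 2 * s v" using KC by simp
    finally have q: "q \<ge> c / 2 * s v" using rw(1) p0 unfolding q_def by linarith
    have "c / 2 * s v > 0" using KC s by simp
    then have q0: "q > 0" using q by linarith
    define X where "X = fact n * exp (real n * v + (\<Sum>k=1..n. lam v k))"
    have X: "X > 0" by (simp add: X_def)
    have perm: "(\<Sum>\<sigma> | \<sigma> permutes {1..n}. perm_weight \<theta> n \<sigma> *
        F (\<lambda>k. if b \<le> k then cycle_count n \<sigma> k else 0)) = X * measure_pmf.expectation ?P (\<lambda>z. F z * ?p z)"
      if "\<And>z. \<bar>F z\<bar> \<le> B'" for F B'
      unfolding X_def sum_perm_weight[where F = "\<lambda>c. F (\<lambda>k. if b \<le> k then c k else 0)" and v = v]
      by (subst expectation_split[OF b(1,2) that]) simp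
    \<comment> \<open>The normalization is the same identity for the constant functional 1.\<close>
    have nc: "norm_const \<theta> n * fact n = X * q"
      using perm[of "\<lambda>_. 1" 1] by (simp add: norm_const_def q_def)
    then have "norm_const \<theta> n * fact n > 0" using X q0 by simp
    then have pos: "norm_const \<theta> n > 0" by (simp add: zero_less_mult_iff)
    have "(\<Sum>\<sigma> | \<sigma> permutes {1..n}. perm_weight \<theta> n \<sigma> *
            G n (\<lambda>k. if b \<le> k then cycle_count n \<sigma> k else 0)) / (norm_const \<theta> n * fact n) -
          measure_pmf.expectation ?P (G n) =
        (measure_pmf.expectation ?P (\<lambda>z. G n z * ?p z) - q * measure_pmf.expectation ?P (G n)) / q"
      unfolding nc perm[where F = "G n", OF G] using X q0 by (simp add: diff_divide_distrib)
    also have "norm \<dots> \<le> 2 * B * (K * (s v * s v)) * T v / q"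
      using rw(2) q0 unfolding q_def by (simp add: abs_divide divide_right_mono)
    also have "\<dots> \<le> 2 * B * (K * (s v * s v)) * T v / (c / 2 * s v)"
      using q \<open>c / 2 * s v > 0\<close> B KC C by (intro divide_left_mono) (auto simp: T_def)
    also have "\<dots> = 4 * B * K / c * (T v * s v)" using s KC by (simp add: field_simps)
    finally show ?case using pos unfolding v_def b_def by blast
  qed
  then show "\<forall>\<^sub>F n in sequentially. norm_const \<theta> n > 0" by (rule eventually_mono) blast
  show "(\<lambda>n. (\<Sum>\<sigma> | \<sigma> permutes {1..n}. perm_weight \<theta> n \<sigma> *
            G n (\<lambda>k. if bcut (v_sol \<theta> n) \<le> k then cycle_count n \<sigma> k else 0)) / (norm_const \<theta> n * fact n) -
          measure_pmf.expectation (long_pmf (v_sol \<theta> n) {bcut (v_sol \<theta> n)..n}) (G n)) \<longlonglongrightarrow> 0"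
  proof (rule Lim_null_comparison)
    show "\<forall>\<^sub>F n in sequentially. norm ((\<Sum>\<sigma> | \<sigma> permutes {1..n}. perm_weight \<theta> n \<sigma> *
            G n (\<lambda>k. if bcut (v_sol \<theta> n) \<le> k then cycle_count n \<sigma> k else 0)) / (norm_const \<theta> n * fact n) -
          measure_pmf.expectation (long_pmf (v_sol \<theta> n) {bcut (v_sol \<theta> n)..n}) (G n))
      \<le> 4 * B * K / c * (T (v_sol \<theta> n) * s (v_sol \<theta> n))"
      using ev by (rule eventually_mono) blast
    show "(\<lambda>n. 4 * B * K / c * (T (v_sol \<theta> n) * s (v_sol \<theta> n))) \<longlonglongrightarrow> 0"
      using tendsto_mult_left[OF filterlim_compose[OF Ts v_sol_tendsto], of "4 * B * K / c"] by simp
  qed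
qed

end

subsection \<open>Counts of a Poisson process in consecutive intervals\<close>

locale unit_poisson_process = prob_space M for M :: "'w measure" +
  fixes N :: "'w \<Rightarrow> real \<Rightarrow> real"
  assumes poisson: "poisson_process 1 M N"
begin

lemma measurable_path: "N \<in> M \<rightarrow>\<^sub>M borel_of skorokhod"
  using poisson by (simp add: poisson_process_def)

lemma path_cadlag: "\<omega> \<in> space M \<Longrightarrow> N \<omega> \<in> cadlag"
  using measurable_space[OF measurable_path] by (simp add: borel_of_def topspace_skorokhod space_measure_of_conv)

lemma indep_increments:
  assumes "0 \<le> t 0" "\<And>i. i < m \<Longrightarrow> t i \<le> t (Suc i)"
  shows "indep_vars (\<lambda>_. borel) (\<lambda>i \<omega>. N \<omega> (t (Suc i)) - N \<omega> (t i)) {..<m}"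
  using poisson assms unfolding poisson_process_def by blast

text \<open>Measurability of one increment is read off from the independence of increments over a
  partition with a single interval.\<close>

lemma measurable_increment [measurable]:
  assumes "0 \<le> s" "s \<le> t"
  shows "(\<lambda>\<omega>. N \<omega> t - N \<omega> s) \<in> borel_measurable M"
proof -
  have "indep_vars (\<lambda>_. borel)
      (\<lambda>i \<omega>. N \<omega> ((\<lambda>i::nat. if i = 0 then s else t) (Suc i)) - N \<omega> ((\<lambda>i::nat. if i = 0 then s else t) i)) {..<1::nat}"
    using assms by (intro indep_increments) auto
  then show ?thesis unfolding indep_vars_def by auto
qed

lemma increment_nat:
  assumes "0 \<le> s" "s \<le> t"
  shows "AE \<omega> in M. N \<omega> t - N \<omega> s \<in> range real"
proof (cases "s = t")
  case True
  then show ?thesis by (auto intro!: AE_I2 image_eqI[of _ _ 0])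
next
  case False
  then have d: "distr M borel (\<lambda>\<omega>. N \<omega> t - N \<omega> s) = distr (measure_pmf (poisson_pmf (t - s))) borel real"
    using poisson assms unfolding poisson_process_def by auto
  have "range real \<in> sets borel" by (rule sets.countable) auto
  then have b: "{x. x \<in> range real} \<in> sets borel" by simp
  have "AE x in distr (measure_pmf (poisson_pmf (t - s))) borel real. x \<in> range real"
    by (subst AE_distr_iff) (use b in auto)
  then have "AE x in distr M borel (\<lambda>\<omega>. N \<omega> t - N \<omega> s). x \<in> range real" unfolding d .
  then show ?thesis
    using measurable_increment[OF assms] b by (subst (asm) AE_distr_iff) auto
qed

lemma prob_increment:
  assumes "0 \<le> s" "s \<le> t"
  shows "prob ((\<lambda>\<omega>. N \<omega> t - N \<omega> s) -` {real c} \<inter> space M) = pmf (pois (t - s)) c"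
proof (cases "s = t")
  case True
  have "(\<lambda>\<omega>. N \<omega> t - N \<omega> s) -` {real c} \<inter> space M = (if c = 0 then space M else {})"
    using True by auto
  then show ?thesis using True by (simp add: pois_def prob_space)
next
  case False
  then have d: "distr M borel (\<lambda>\<omega>. N \<omega> t - N \<omega> s) = distr (measure_pmf (poisson_pmf (t - s))) borel real"
    using poisson assms unfolding poisson_process_def by auto
  have "prob ((\<lambda>\<omega>. N \<omega> t - N \<omega> s) -` {real c} \<inter> space M) = measure (distr M borel (\<lambda>\<omega>. N \<omega> t - N \<omega> s)) {real c}"
    using measurable_increment[OF assms] by (subst measure_distr) auto
  also have "\<dots> = measure_pmf.prob (poisson_pmf (t - s)) (real -` {real c} \<inter> UNIV)"
    unfolding d by (subst measure_distr) auto
  also have "real -` {real c} \<inter> UNIV = {c}" by auto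
  also have "measure_pmf.prob (poisson_pmf (t - s)) {c} = pmf (pois (t - s)) c"
    using False assms by (simp add: pois_def measure_pmf_single)
  finally show ?thesis .
qed

text \<open>Increments from 0 to rational times are natural numbers off one null set; right
  continuity and closedness of the integers extend integrality to all times.\<close>

lemma paths_integer_valued: "AE \<omega> in M. N \<omega> 0 = 0 \<and> (\<forall>t\<ge>0. N \<omega> t \<in> \<int>)"
proof -
  have "AE \<omega> in M. \<forall>q\<in>\<rat> \<inter> {0..}. N \<omega> q - N \<omega> 0 \<in> range real"
    by (subst AE_ball_countable) (auto intro!: increment_nat countable_subset[OF Int_lower1 countable_rat])
  moreover have "AE \<omega> in M. N \<omega> 0 = 0" using poisson by (simp add: poisson_process_def)
  moreover have "AE \<omega> in M. \<omega> \<in> space M" by (rule AE_space)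
  ultimately show ?thesis
  proof eventually_elim
    case (elim \<omega>)
    have q: "N \<omega> q \<in> \<int>" if "q \<in> \<rat>" "q \<ge> 0" for q
    proof -
      have "N \<omega> q - N \<omega> 0 \<in> range real" using elim(1) that by blast
      then show ?thesis using elim(2) by auto
    qed
    have "N \<omega> t \<in> \<int>" if t: "t \<ge> 0" for t
    proof (rule ccontr)
      assume "N \<omega> t \<notin> \<int>"
      then have "N \<omega> t \<in> - \<int>" by simp
      have "(N \<omega> \<longlongrightarrow> N \<omega> t) (at_right t)"
        using path_cadlag[OF elim(3)] t by (auto simp: cadlag_def continuous_within)
      from topological_tendstoD[OF this _ \<open>N \<omega> t \<in> - \<int>\<close>]
      have "\<forall>\<^sub>F u in at_right t. N \<omega> u \<in> - \<int>" by (simp add: open_Compl closed_Ints)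
      then obtain b where b: "b > t" "\<And>u. t < u \<Longrightarrow> u < b \<Longrightarrow> N \<omega> u \<in> - \<int>"
        unfolding eventually_at_right_field by blast
      obtain u where "u \<in> \<rat>" "t < u" "u < b" using Rats_dense_in_real[OF b(1)] by blast
      then show False using b(2)[of u] q[of u] t by auto
    qed
    then show ?case using elim(2) by blast
  qed
qed

context
  fixes b n :: nat and r :: "nat \<Rightarrow> real"
  assumes r: "\<And>k. r k \<ge> 0"
begin

text \<open>The interval of length \<open>r k\<close> that belongs to \<open>k\<close> runs from
  \<open>level (Suc k)\<close> to \<open>level k\<close>. Summing from the top places the largest
  indices first, just as a growing \<open>y\<close> lowers the threshold on cycle lengths.\<close>

definition level :: "nat \<Rightarrow> real" where
  "level k = (\<Sum>j\<in>{k..n}. r j)"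

text \<open>Increments are natural numbers only almost surely; rounding yields natural counts for
  every \<open>\<omega>\<close>.\<close>

definition counts :: "'w \<Rightarrow> nat \<Rightarrow> nat" where
  "counts \<omega> = (\<lambda>k. if k \<in> {b..n} then nat \<lfloor>N \<omega> (level k) - N \<omega> (level (Suc k))\<rfloor> else 0)"

lemma level_nonneg: "level k \<ge> 0"
  unfolding level_def using r by (intro sum_nonneg) auto

lemma level_Suc: "k \<le> n \<Longrightarrow> level k = level (Suc k) + r k"
  unfolding level_def by (simp add: sum.atLeast_Suc_atMost)

lemma level_mono: "level (Suc k) \<le> level k"
  using level_Suc[of k] r[of k] by (cases "k \<le> n") (auto simp: level_def)

lemma counts_eq: "AE \<omega> in M. \<forall>k\<in>{b..n}. N \<omega> (level k) - N \<omega> (level (Suc k)) = real (counts \<omega> k)"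
proof -
  have "AE \<omega> in M. \<forall>k\<in>{b..n}. N \<omega> (level k) - N \<omega> (level (Suc k)) \<in> range real"
    by (subst AE_ball_countable) (auto intro!: increment_nat level_nonneg level_mono)
  then show ?thesis
  proof eventually_elim
    case (elim \<omega>)
    show ?case
    proof
      fix k assume k: "k \<in> {b..n}"
      then obtain c where "N \<omega> (level k) - N \<omega> (level (Suc k)) = real c" using elim by blast
      then show "N \<omega> (level k) - N \<omega> (level (Suc k)) = real (counts \<omega> k)"
        using k by (simp add: counts_def)
    qed
  qed
qed

lemma prob_increments:
  "prob {\<omega> \<in> space M. \<forall>k\<in>{b..n}. N \<omega> (level k) - N \<omega> (level (Suc k)) = real (c k)} =
    (\<Prod>k\<in>{b..n}. pmf (pois (r k)) (c k))"
proof (cases "b \<le> n")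
  case False
  then show ?thesis by (simp add: prob_space)
next
  case True
  define m where "m = Suc n - b"
  \<comment> \<open>The levels decrease in \<open>k\<close>, so the increasing times required for
    independence list them backwards from \<open>level (Suc n)\<close>, which is 0.\<close>
  define t where "t i = level (Suc n - i)" for i
  let ?X = "\<lambda>i \<omega>. N \<omega> (t (Suc i)) - N \<omega> (t i)"
  have m: "{..<m} \<noteq> {}" using True by (auto simp: m_def lessThan_empty_iff)
  have tS: "t (Suc i) = level (n - i)" "t i = level (Suc (n - i))" if "i < m" for i
    using that by (auto simp: t_def m_def Suc_diff_le)
  have ind: "indep_vars (\<lambda>_. borel) ?X {..<m}"
  proof (rule indep_increments)
    show "0 \<le> t 0" unfolding t_def by (rule level_nonneg)
    show "t i \<le> t (Suc i)" if "i < m" for i unfolding tS[OF that] by (rule level_mono)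
  qed
  have "{\<omega> \<in> space M. \<forall>k\<in>{b..n}. N \<omega> (level k) - N \<omega> (level (Suc k)) = real (c k)} =
      (\<Inter>i\<in>{..<m}. ?X i -` {real (c (n - i))} \<inter> space M)" (is "?A = ?B")
  proof (intro equalityI subsetI)
    fix \<omega> assume w: "\<omega> \<in> ?A"
    show "\<omega> \<in> ?B"
    proof (intro INT_I)
      fix i assume i: "i \<in> {..<m}"
      then have "n - i \<in> {b..n}" by (auto simp: m_def)
      then show "\<omega> \<in> ?X i -` {real (c (n - i))} \<inter> space M" using w i tS[of i] by simp
    qed
  next
    fix \<omega> assume w: "\<omega> \<in> ?B"
    have "N \<omega> (level k) - N \<omega> (level (Suc k)) = real (c k)" if k: "k \<in> {b..n}" for k
    proof -
      have i: "n - k \<in> {..<m}" "n - (n - k) = k" using k by (auto simp: m_def)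
      then have "\<omega> \<in> ?X (n - k) -` {real (c (n - (n - k)))} \<inter> space M" using w by blast
      then show ?thesis using i tS[of "n - k"] by simp
    qed
    then show "\<omega> \<in> ?A" using w m by auto
  qed
  then have "prob ?A = prob (\<Inter>i\<in>{..<m}. ?X i -` {real (c (n - i))} \<inter> space M)" by simp
  also have "\<dots> = (\<Prod>i\<in>{..<m}. prob (?X i -` {real (c (n - i))} \<inter> space M))"
    by (rule indep_varsD[OF ind m]) auto
  also have "\<dots> = (\<Prod>i\<in>{..<m}. pmf (pois (r (n - i))) (c (n - i)))"
  proof (rule prod.cong[OF refl])
    fix i assume "i \<in> {..<m}"
    then have i: "i < m" by simp
    have "prob (?X i -` {real (c (n - i))} \<inter> space M) = pmf (pois (t (Suc i) - t i)) (c (n - i))"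
      unfolding tS[OF i] by (intro prob_increment level_nonneg level_mono)
    also have "t (Suc i) - t i = r (n - i)" unfolding tS[OF i] using level_Suc[of "n - i"] by simp
    finally show "prob (?X i -` {real (c (n - i))} \<inter> space M) = pmf (pois (r (n - i))) (c (n - i))" .
  qed
  also have "\<dots> = (\<Prod>k\<in>{b..n}. pmf (pois (r k)) (c k))"
    by (rule prod.reindex_bij_witness[where i = "\<lambda>k. n - k" and j = "\<lambda>i. n - i"]) (auto simp: m_def)
  finally show ?thesis .
qed

text \<open>The counts live in a countable set, where the two laws are compared point by point.
  Hence \<open>G\<close> may be any function, such as the supremum of a test functional over a set
  of paths.\<close>

lemma expectation_counts:
  fixes G :: "(nat \<Rightarrow> nat) \<Rightarrow> real"
  shows "(\<lambda>\<omega>. G (counts \<omega>)) \<in> borel_measurable M"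
    and "(\<integral>\<omega>. G (counts \<omega>) \<partial>M) = measure_pmf.expectation (Pi_pmf {b..n} 0 (\<lambda>k. pois (r k))) G"
proof -
  define C where "C = PiE_dflt {b..n} (0::nat) (\<lambda>_. UNIV)"
  let ?P = "Pi_pmf {b..n} (0::nat) (\<lambda>k. pois (r k))"
  \<comment> \<open>Samples of \<open>?P\<close> vanish outside \<open>{b..n}\<close> only almost
    surely; \<open>\<kappa>\<close> enforces this everywhere, so that both laws live on
    \<open>C\<close>.\<close>
  define \<kappa> where "\<kappa> c = (\<lambda>k. if k \<in> {b..n} then c k else 0 :: nat)" for c
  have C_iff: "c \<in> C \<longleftrightarrow> (\<forall>k. k \<notin> {b..n} \<longrightarrow> c k = 0)" for c by (auto simp: C_def PiE_dflt_def)
  have "C = (\<lambda>h x. if x \<in> {b..n} then h x else 0) ` PiE {b..n} (\<lambda>_. UNIV)"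
    unfolding C_def by (rule dflt_image_PiE[symmetric])
  then have cC: "countable C" by (auto intro!: countable_image countable_PiE)
  have meas_c: "counts \<in> M \<rightarrow>\<^sub>M count_space C"
    unfolding measurable_count_space_eq_countable[OF cC]
  proof (intro conjI ballI)
    show "counts \<in> space M \<rightarrow> C" by (auto simp: C_iff counts_def)
    fix c assume c: "c \<in> C"
    have m: "(\<lambda>\<omega>. nat \<lfloor>N \<omega> (level k) - N \<omega> (level (Suc k))\<rfloor>) \<in> measurable M (count_space UNIV)" for k
      using measurable_increment[OF level_nonneg level_mono, of k] by measurable
    have "counts -` {c} \<inter> space M =
        {\<omega> \<in> space M. \<forall>k\<in>{b..n}. nat \<lfloor>N \<omega> (level k) - N \<omega> (level (Suc k))\<rfloor> = c k}"
      using c by (auto simp: C_iff counts_def fun_eq_iff)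
    also have "\<dots> \<in> sets M"
    proof (rule sets.sets_Collect_finite_All)
      fix k
      show "{\<omega> \<in> space M. nat \<lfloor>N \<omega> (level k) - N \<omega> (level (Suc k))\<rfloor> = c k} \<in> sets M"
        using measurable_sets[OF m[of k], of "{c k}"] by (simp add: vimage_def Int_def conj_commute)
    qed simp
    finally show "counts -` {c} \<inter> space M \<in> sets M" .
  qed
  have meas_k: "\<kappa> \<in> measure_pmf ?P \<rightarrow>\<^sub>M count_space C"
    by (auto simp: measurable_count_space_eq_countable[OF cC] C_iff \<kappa>_def)
  have "distr M (count_space C) counts = distr (measure_pmf ?P) (count_space C) \<kappa>"
  proof (rule measure_eqI_countable[of _ C])
    fix c assume c: "c \<in> C"
    have "emeasure (distr M (count_space C) counts) {c} = emeasure M (counts -` {c} \<inter> space M)"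
      using c by (intro emeasure_distr meas_c) auto
    also have "\<dots> = emeasure M {\<omega> \<in> space M. \<forall>k\<in>{b..n}. N \<omega> (level k) - N \<omega> (level (Suc k)) = real (c k)}"
    proof (rule emeasure_eq_AE)
      show "AE \<omega> in M. \<omega> \<in> counts -` {c} \<inter> space M \<longleftrightarrow>
          \<omega> \<in> {\<omega> \<in> space M. \<forall>k\<in>{b..n}. N \<omega> (level k) - N \<omega> (level (Suc k)) = real (c k)}"
        using counts_eq
      proof eventually_elim
        case (elim \<omega>)
        have "counts \<omega> = c \<longleftrightarrow> (\<forall>k\<in>{b..n}. counts \<omega> k = c k)"
          using c by (auto simp: C_iff counts_def fun_eq_iff)
        then show ?case using elim by auto
      qed
      show "counts -` {c} \<inter> space M \<in> sets M" using measurable_sets[OF meas_c, of "{c}"] c by auto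
      show "{\<omega> \<in> space M. \<forall>k\<in>{b..n}. N \<omega> (level k) - N \<omega> (level (Suc k)) = real (c k)} \<in> sets M"
      proof (rule sets.sets_Collect_finite_All)
        fix k
        show "{\<omega> \<in> space M. N \<omega> (level k) - N \<omega> (level (Suc k)) = real (c k)} \<in> sets M"
          using measurable_sets[OF measurable_increment[OF level_nonneg level_mono, of k], of "{real (c k)}"]
          by (simp add: vimage_def Int_def conj_commute)
      qed simp
    qed
    also have "\<dots> = ennreal (\<Prod>k\<in>{b..n}. pmf (pois (r k)) (c k))"
      unfolding emeasure_eq_measure prob_increments ..
    also have "\<dots> = ennreal (pmf ?P c)" using c by (subst pmf_Pi') (auto simp: C_iff)
    also have "\<dots> = emeasure (measure_pmf ?P) {c}" by (simp add: emeasure_pmf_single)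
    also have "\<dots> = emeasure (measure_pmf ?P) (\<kappa> -` {c} \<inter> space (measure_pmf ?P))"
    proof (rule emeasure_eq_AE)
      show "AE d in measure_pmf ?P. d \<in> {c} \<longleftrightarrow> d \<in> \<kappa> -` {c} \<inter> space (measure_pmf ?P)"
        unfolding AE_measure_pmf_iff
      proof
        fix d assume "d \<in> set_pmf ?P"
        then have "d k = 0" if "k \<notin> {b..n}" for k
          using that set_Pi_pmf_subset[of "{b..n}" 0 "\<lambda>k. pois (r k)"] by blast
        then have "\<kappa> d = d" by (auto simp: \<kappa>_def)
        then show "d \<in> {c} \<longleftrightarrow> d \<in> \<kappa> -` {c} \<inter> space (measure_pmf ?P)" by simp
      qed
    qed simp_all
    also have "\<dots> = emeasure (distr (measure_pmf ?P) (count_space C) \<kappa>) {c}"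
      using c by (intro emeasure_distr[symmetric] meas_k) auto
    finally show "emeasure (distr M (count_space C) counts) {c} =
        emeasure (distr (measure_pmf ?P) (count_space C) \<kappa>) {c}" .
  qed (use cC in auto)
  then have "integral\<^sup>L (distr M (count_space C) counts) G = integral\<^sup>L (distr (measure_pmf ?P) (count_space C) \<kappa>) G"
    by simp
  moreover have "integral\<^sup>L (distr M (count_space C) counts) G = (\<integral>\<omega>. G (counts \<omega>) \<partial>M)"
    by (intro integral_distr meas_c) simp
  moreover have "integral\<^sup>L (distr (measure_pmf ?P) (count_space C) \<kappa>) G = measure_pmf.expectation ?P (\<lambda>d. G (\<kappa> d))"
    by (intro integral_distr meas_k) simp
  moreover have "measure_pmf.expectation ?P (\<lambda>d. G (\<kappa> d)) = measure_pmf.expectation ?P G"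
  proof (intro integral_cong_AE)
    show "AE d in measure_pmf ?P. G (\<kappa> d) = G d"
      unfolding AE_measure_pmf_iff
    proof
      fix d assume "d \<in> set_pmf ?P"
      then have "d k = 0" if "k \<notin> {b..n}" for k
        using that set_Pi_pmf_subset[of "{b..n}" 0 "\<lambda>k. pois (r k)"] by blast
      then have "\<kappa> d = d" by (auto simp: \<kappa>_def)
      then show "G (\<kappa> d) = G d" by simp
    qed
  qed simp_all
  ultimately show "(\<integral>\<omega>. G (counts \<omega>) \<partial>M) = measure_pmf.expectation ?P G" by simp
  show "(\<lambda>\<omega>. G (counts \<omega>)) \<in> borel_measurable M"
    by (rule measurable_compose[OF meas_c]) simp
qed

end

end

subsection \<open>The process of long cycles\<close>

text \<open>Supplies the hypothesis \<open>L_rc\<close> of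
  \<open>skorokhod_converges_random_time\<close>. \<open>L\<close> is a nondecreasing step function
  that includes the jump at \<open>a k\<close> itself, so the level \<open>s\<close> is first
  reached at the least jump point where \<open>L\<close> is at least \<open>s\<close>.\<close>

lemma step_function_level_set:
  fixes a w :: "nat \<Rightarrow> real"
  assumes K: "finite K" and w: "\<And>k. w k \<ge> 0"
  defines "L \<equiv> \<lambda>y. \<Sum>k | k \<in> K \<and> a k \<le> y. w k"
  assumes s: "0 < s" "s \<le> L z"
  shows "\<exists>\<sigma>. \<forall>y. s \<le> L y \<longleftrightarrow> \<sigma> \<le> y"
proof -
  have mono: "L y \<le> L y'" if "y \<le> y'" for y y'
    unfolding L_def using K that w by (intro sum_mono2) auto
  define J where "J = {a k | k. k \<in> K \<and> s \<le> L (a k)}"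
  have "J \<subseteq> a ` K" by (auto simp: J_def)
  then have fin: "finite J" using K finite_subset by blast
  have hit: "\<exists>j\<in>J. j \<le> y" if y: "s \<le> L y" for y
  proof -
    let ?Ky = "{k. k \<in> K \<and> a k \<le> y}"
    have ne: "?Ky \<noteq> {}" using y s(1) unfolding L_def by (metis less_le_not_le sum.empty)
    have fy: "finite (a ` ?Ky)" using K by simp
    define m where "m = Max (a ` ?Ky)"
    have "m \<in> a ` ?Ky" unfolding m_def using fy ne by (intro Max_in) auto
    then obtain k where k: "k \<in> K" "a k \<le> y" "m = a k" by auto
    have "?Ky = {k. k \<in> K \<and> a k \<le> m}"
      using k Max_ge[OF fy] by (auto simp: m_def)
    then have "L m = L y" by (simp add: L_def)
    then have "s \<le> L (a k)" using k(3) y by simp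
    then have "a k \<in> J" using k(1) by (auto simp: J_def)
    then show ?thesis using k(2) by blast
  qed
  then have ne: "J \<noteq> {}" using s(2) by blast
  show ?thesis
  proof (intro exI[of _ "Min J"] allI iffI)
    fix y assume "s \<le> L y"
    then obtain j where "j \<in> J" "j \<le> y" using hit by blast
    then show "Min J \<le> y" using Min_le[OF fin] by (meson order_trans)
  next
    fix y assume y: "Min J \<le> y"
    have "Min J \<in> J" using fin ne by (rule Min_in)
    then have "s \<le> L (Min J)" by (auto simp: J_def)
    then show "s \<le> L y" using mono[OF y] by linarith
  qed
qed

lemma cycle_count_eq_0:
  assumes "\<sigma> permutes {1..n}" "k > n"
  shows "cycle_count n \<sigma> k = 0"
proof -
  have "card (orbit \<sigma> x) \<le> n" if "x \<in> {1..n}" for x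
    using card_mono[OF _ permutes_orbit_subset[OF assms(1) that]] by simp
  then have "{c \<in> orbit \<sigma> ` {1..n}. card c = k} = {}" using assms(2) by force
  then show ?thesis by (simp add: cycle_count_def)
qed

context power_weights
begin

text \<open>A cycle of length \<open>k\<close> is counted by the process from time \<open>jump_time v k\<close> on, where \<open>v = v_sol \<theta> n\<close>.\<close>

definition jump_time :: "real \<Rightarrow> nat \<Rightarrow> real" where
  "jump_time v k = (if 2 * ellv v \<le> real k * v then 0 else exp (ellv v - real k * v))"

lemma jump_time_antimono:
  assumes "v > 0" "j \<le> k"
  shows "jump_time v k \<le> jump_time v j"
proof -
  have "real j * v \<le> real k * v" using assms by (intro mult_right_mono) auto
  then show ?thesis by (auto simp: jump_time_def)
qed

text \<open>The assumptions on \<open>y\<close> describe the range in which the minimum in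
  \<open>x_thr\<close> is \<open>- ln y\<close>.\<close>

lemma jump_time_le_iff:
  assumes "v > 0" "y > 0" "- ln y \<le> ellv v"
  shows "jump_time v k \<le> y \<longleftrightarrow> ellv v - ln y \<le> real k * v"
proof (cases "2 * ellv v \<le> real k * v")
  case True
  then show ?thesis using assms by (auto simp: jump_time_def)
next
  case False
  have "exp (ellv v - real k * v) \<le> y \<longleftrightarrow> ellv v - real k * v \<le> ln y"
    using assms(2) by (metis exp_le_cancel_iff exp_ln)
  then show ?thesis using False by (auto simp: jump_time_def)
qed

text \<open>\<open>jump_time\<close> inverts the passage from times to thresholds; its value 0 for
  \<open>2 * ellv v \<le> real k * v\<close> encodes the convention at \<open>y = 0\<close>.\<close>

lemma x_thr_le_iff:
  assumes v: "v_sol \<theta> n > 0" and l: "ellv (v_sol \<theta> n) > 0" and y: "y \<ge> 0"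
  shows "x_thr \<alpha> \<theta> n y \<le> real k \<longleftrightarrow> jump_time (v_sol \<theta> n) k \<le> y"
proof -
  define v where "v = v_sol \<theta> n"
  have *: "x_thr \<alpha> \<theta> n y \<le> real k \<longleftrightarrow>
      ellv v + (if y = 0 then ellv v else min (- ln y) (ellv v)) \<le> real k * v"
    using v unfolding x_thr_def ell_eq n_star_def v_def[symmetric]
    by (simp add: inverse_eq_divide pos_divide_le_eq)
  show ?thesis
  proof (cases "y = 0")
    case True
    then show ?thesis unfolding * v_def[symmetric] by (auto simp: jump_time_def not_le)
  next
    case False
    with y have y: "y > 0" by simp
    have "exp (ellv v - real k * v) \<le> y \<longleftrightarrow> ellv v - real k * v \<le> ln y"
      using y by (metis exp_le_cancel_iff exp_ln)
    then show ?thesis unfolding * v_def[symmetric] using False y by (auto simp: jump_time_def min_def)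
  qed
qed

lemma P_proc_eq:
  assumes v: "v_sol \<theta> n > 0" and l: "ellv (v_sol \<theta> n) > 0" and \<sigma>: "\<sigma> permutes {1..n}"
  shows "P_proc \<alpha> \<theta> n \<sigma> =
    (\<lambda>y\<in>{0..}. \<Sum>k | k \<in> {1..n} \<and> jump_time (v_sol \<theta> n) k \<le> y. real (cycle_count n \<sigma> k))"
proof
  fix y
  let ?S = "{k. k \<in> {1..n} \<and> jump_time (v_sol \<theta> n) k \<le> y}"
  show "P_proc \<alpha> \<theta> n \<sigma> y = (\<lambda>y\<in>{0..}. \<Sum>k | k \<in> {1..n} \<and> jump_time (v_sol \<theta> n) k \<le> y.
      real (cycle_count n \<sigma> k)) y"
  proof (cases "y \<ge> 0")
    case True
    have "(\<Sum>\<^sub>\<infinity>k\<in>{k. 1 \<le> k \<and> x_thr \<alpha> \<theta> n y \<le> real k}. real (cycle_count n \<sigma> k)) =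
        (\<Sum>\<^sub>\<infinity>k\<in>?S. real (cycle_count n \<sigma> k))"
      using x_thr_le_iff[OF v l True] cycle_count_eq_0[OF \<sigma>]
      by (intro infsum_cong_neutral) (auto simp: not_le)
    then show ?thesis using True by (simp add: P_proc_def)
  qed (simp add: P_proc_def)
qed

definition cut_path :: "nat \<Rightarrow> (nat \<Rightarrow> nat) \<Rightarrow> real \<Rightarrow> real" where
  "cut_path n c = (\<lambda>y\<in>{0..}. \<Sum>k | k \<in> {bcut (v_sol \<theta> n)..n} \<and> jump_time (v_sol \<theta> n) k \<le> y. real (c k))"

text \<open>The mean of \<open>cut_path\<close> at time \<open>y\<close> under independent Poisson
  counts and, by \<open>cut_path_eq_clock\<close>, the time at which \<open>N\<close> is
  read.\<close>

definition clock :: "nat \<Rightarrow> real \<Rightarrow> real" where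
  "clock n y = (\<Sum>k | k \<in> {bcut (v_sol \<theta> n)..n} \<and> jump_time (v_sol \<theta> n) k \<le> y. lam (v_sol \<theta> n) k)"

text \<open>Up to the times in \<open>visible n\<close>, only cycles of length at least \<open>bcut\<close> have been counted.\<close>

definition visible :: "nat \<Rightarrow> real set" where
  "visible n = {y. 0 \<le> y \<and> (\<forall>k. jump_time (v_sol \<theta> n) k \<le> y \<longrightarrow> bcut (v_sol \<theta> n) \<le> k)}"

lemma eventually_v_sol:
  "\<forall>\<^sub>F v in at_right 0. P v \<Longrightarrow> \<forall>\<^sub>F n in sequentially. P (v_sol \<theta> n)"
  by (rule eventually_compose_filterlim[OF _ v_sol_tendsto])

lemma eventually_visible:
  "\<forall>\<^sub>F n in sequentially. v_sol \<theta> n > 0 \<and> ellv (v_sol \<theta> n) > 0 \<and> bcut (v_sol \<theta> n) \<ge> 1"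
  "y > 0 \<Longrightarrow> \<forall>\<^sub>F n in sequentially. \<forall>k. jump_time (v_sol \<theta> n) k \<le> y \<longleftrightarrow> ellv (v_sol \<theta> n) - ln y \<le> real k * v_sol \<theta> n"
  "y > 0 \<Longrightarrow> \<forall>\<^sub>F n in sequentially. \<forall>k. jump_time (v_sol \<theta> n) k \<le> y \<longrightarrow> bcut (v_sol \<theta> n) \<le> k"
  "\<forall>\<^sub>F n in sequentially. {0..T} \<subseteq> visible n"
proof -
  have pos: "\<forall>\<^sub>F v in at_right (0::real). 0 < v" by (simp add: eventually_at_right_less)
  have "\<forall>\<^sub>F v in at_right 0. 0 < ellv v" using ellv_at_top[of 0] by (simp add: filterlim_at_top_dense)
  then have "\<forall>\<^sub>F v in at_right 0. v > 0 \<and> ellv v > 0 \<and> bcut v \<ge> 1"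
    using pos bcut_props by eventually_elim blast
  then show "\<forall>\<^sub>F n in sequentially. v_sol \<theta> n > 0 \<and> ellv (v_sol \<theta> n) > 0 \<and> bcut (v_sol \<theta> n) \<ge> 1"
    by (rule eventually_v_sol)
  have iff: "\<forall>\<^sub>F v in at_right 0. \<forall>k. jump_time v k \<le> y \<longleftrightarrow> ellv v - ln y \<le> real k * v" if "y > 0" for y
  proof -
    have "\<forall>\<^sub>F v in at_right 0. 0 \<le> ellv v - (- ln y)" using ellv_at_top[of "- ln y"] by (simp add: filterlim_at_top)
    then show ?thesis using pos by eventually_elim (use jump_time_le_iff that in auto)
  qed
  then show "y > 0 \<Longrightarrow> \<forall>\<^sub>F n in sequentially. \<forall>k. jump_time (v_sol \<theta> n) k \<le> y \<longleftrightarrow> ellv (v_sol \<theta> n) - ln y \<le> real k * v_sol \<theta> n"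
    by (intro eventually_v_sol)
  have cut: "\<forall>\<^sub>F v in at_right 0. \<forall>k. jump_time v k \<le> y \<longrightarrow> bcut v \<le> k" if "y > 0" for y
  proof -
    \<comment> \<open>The cut-off sits at 3/4 of \<open>\<alpha> * ln (inverse v)\<close>, the
      leading term of \<open>ellv v\<close>, and so eventually lies below each fixed
      threshold.\<close>
    have "\<forall>\<^sub>F v in at_right 0. 3 / 4 * (\<alpha> * ln (inverse v)) + v \<le> ellv v - ln y"
      unfolding ellv_def using \<alpha> by real_asymp
    then show ?thesis using iff[OF that] bcut_props pos
    proof eventually_elim
      case (elim v)
      show ?case
      proof (intro allI impI)
        fix k assume "jump_time v k \<le> y"
        then have "ellv v - ln y \<le> real k * v" using elim(2) by blast
        then have "real (bcut v) * v \<le> real k * v" using elim(1,3) by linarith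
        then show "bcut v \<le> k" using elim(4) by simp
      qed
    qed
  qed
  then show "y > 0 \<Longrightarrow> \<forall>\<^sub>F n in sequentially. \<forall>k. jump_time (v_sol \<theta> n) k \<le> y \<longrightarrow> bcut (v_sol \<theta> n) \<le> k"
    by (intro eventually_v_sol)
  have "\<forall>\<^sub>F n in sequentially. \<forall>k. jump_time (v_sol \<theta> n) k \<le> max T 1 \<longrightarrow> bcut (v_sol \<theta> n) \<le> k"
    by (intro eventually_v_sol cut) simp
  then show "\<forall>\<^sub>F n in sequentially. {0..T} \<subseteq> visible n"
    by eventually_elim (fastforce simp: visible_def)
qed

lemma clock_tendsto:
  assumes "y \<ge> 0"
  shows "(\<lambda>n. clock n y) \<longlonglongrightarrow> y"
proof -
  have pos: "(\<lambda>n. clock n y) \<longlonglongrightarrow> y" if y: "y > 0" for y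
  proof (rule Lim_transform_eventually[OF intensity_limit[OF y]])
    show "\<forall>\<^sub>F n in sequentially. (\<Sum>k | k \<in> {1..n} \<and> ell \<alpha> \<theta> n - ln y \<le> real k * v_sol \<theta> n. lam (v_sol \<theta> n) k) = clock n y"
      using eventually_visible(1) eventually_visible(2,3)[OF y]
    proof eventually_elim
      case (elim n)
      have "{k. k \<in> {1..n} \<and> ell \<alpha> \<theta> n - ln y \<le> real k * v_sol \<theta> n} =
          {k. k \<in> {bcut (v_sol \<theta> n)..n} \<and> jump_time (v_sol \<theta> n) k \<le> y}"
        using elim unfolding ell_eq by fastforce
      then show ?case by (simp add: clock_def)
    qed
  qed
  show ?thesis
  proof (cases "y = 0")
    case True
    \<comment> \<open>At \<open>y = 0\<close> the threshold is \<open>2 * ell\<close>, outside the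
      scope of \<open>intensity_limit\<close>; monotonicity bounds the clock by its value at
      \<open>e / 2\<close>.\<close>
    have "(\<lambda>n. clock n 0) \<longlonglongrightarrow> 0"
    proof (rule tendstoI)
      fix e :: real assume e: "e > 0"
      have "\<forall>\<^sub>F n in sequentially. clock n (e / 2) < e"
        using e by (intro order_tendstoD(2)[OF pos]) auto
      then show "\<forall>\<^sub>F n in sequentially. dist (clock n 0) 0 < e"
      proof eventually_elim
        case (elim n)
        have "clock n 0 \<le> clock n (e / 2)"
          unfolding clock_def using e by (intro sum_mono2) (auto simp: lam_nonneg)
        moreover have "0 \<le> clock n 0" unfolding clock_def by (intro sum_nonneg) (auto simp: lam_nonneg)
        ultimately show ?case using elim by simp
      qed
    qed
    then show ?thesis using True by simp
  qed (use pos assms in auto)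
qed

text \<open>For large \<open>n\<close> the true process lies in this set, yet the set depends on the
  long counts alone. Suprema over it are therefore functions of these counts.\<close>

definition extensions :: "nat \<Rightarrow> (nat \<Rightarrow> nat) \<Rightarrow> (real \<Rightarrow> real) set" where
  "extensions n c = {x \<in> cadlag. \<forall>y\<in>visible n. x y = cut_path n c y}"

lemma cut_path_in_extensions: "cut_path n c \<in> extensions n c"
  unfolding extensions_def cut_path_def by (intro CollectI conjI ballI refl step_function_cadlag) simp

lemma P_proc_in_extensions:
  assumes v: "v_sol \<theta> n > 0" "ellv (v_sol \<theta> n) > 0" "bcut (v_sol \<theta> n) \<ge> 1" and \<sigma>: "\<sigma> permutes {1..n}"
  shows "P_proc \<alpha> \<theta> n \<sigma> \<in> extensions n (\<lambda>k. if bcut (v_sol \<theta> n) \<le> k then cycle_count n \<sigma> k else 0)"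
proof -
  have "P_proc \<alpha> \<theta> n \<sigma> \<in> cadlag"
    unfolding P_proc_eq[OF v(1,2) \<sigma>] by (intro step_function_cadlag) simp
  moreover have "P_proc \<alpha> \<theta> n \<sigma> y = cut_path n (\<lambda>k. if bcut (v_sol \<theta> n) \<le> k then cycle_count n \<sigma> k else 0) y"
    if y: "y \<in> visible n" for y
  proof -
    have "{k. k \<in> {1..n} \<and> jump_time (v_sol \<theta> n) k \<le> y} =
        {k. k \<in> {bcut (v_sol \<theta> n)..n} \<and> jump_time (v_sol \<theta> n) k \<le> y}"
      using y v(3) by (auto simp: visible_def)
    then show ?thesis using y unfolding P_proc_eq[OF v(1,2) \<sigma>] cut_path_def
      by (simp add: visible_def)
  qed
  ultimately show ?thesis by (simp add: extensions_def)
qed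

end

lemma continuous_map_skorokhod_tendsto:
  fixes f :: "(real \<Rightarrow> real) \<Rightarrow> real"
  assumes f: "continuous_map skorokhod euclideanreal f" and x: "x \<in> cadlag"
    and X: "range X \<subseteq> cadlag" "skorokhod_converges X x"
  shows "(\<lambda>n. f (X n)) \<longlonglongrightarrow> f x"
proof (rule topological_tendstoI)
  fix S assume S: "open S" "f x \<in> S"
  have "openin skorokhod {x \<in> topspace skorokhod. f x \<in> S}"
    using f S by (auto simp: continuous_map_def)
  then have "openin skorokhod {x \<in> cadlag. f x \<in> S}" by (simp add: topspace_skorokhod)
  moreover have "x \<in> {x \<in> cadlag. f x \<in> S}" using x S by simp
  ultimately have "\<forall>\<^sub>F n in sequentially. X n \<in> {x \<in> cadlag. f x \<in> S}"
    using X unfolding openin_skorokhod by blast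
  then show "\<forall>\<^sub>F n in sequentially. f (X n) \<in> S" by (rule eventually_mono) simp
qed

lemma continuous_map_skorokhod_measurable:
  fixes f :: "(real \<Rightarrow> real) \<Rightarrow> real"
  assumes "continuous_map skorokhod euclideanreal f"
  shows "f \<in> borel_measurable (borel_of skorokhod)"
proof (rule borel_measurableI)
  fix S :: "real set" assume "open S"
  then have "openin skorokhod {x \<in> topspace skorokhod. f x \<in> S}"
    using assms by (auto simp: continuous_map_def)
  moreover have "f -` S \<inter> space (borel_of skorokhod) = {x \<in> topspace skorokhod. f x \<in> S}"
    by (auto simp: borel_of_def space_measure_of_conv)
  moreover have "{U. openin skorokhod U} \<subseteq> Pow (topspace skorokhod)" by (auto dest: openin_subset)
  ultimately show "f -` S \<inter> space (borel_of skorokhod) \<in> sets (borel_of skorokhod)"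
    by (simp add: borel_of_def)
qed

section \<open>Coupling with the given Poisson process\<close>

locale long_cycles = power_weights \<alpha> \<theta> + unit_poisson_process M N
  for \<alpha> :: real and \<theta> :: "nat \<Rightarrow> real" and M :: "'w measure" and N :: "'w \<Rightarrow> real \<Rightarrow> real"
begin

definition cut_counts :: "nat \<Rightarrow> 'w \<Rightarrow> nat \<Rightarrow> nat" where
  "cut_counts n = counts (bcut (v_sol \<theta> n)) n (lam (v_sol \<theta> n))"

text \<open>Jump times do not increase with the cycle length, so the lengths counted by time
  \<open>y\<close> form a top segment \<open>{m..n}\<close>. Their increments telescope from level 0
  at \<open>Suc n\<close> to the level of \<open>m\<close>, which is the clock.\<close>

lemma cut_path_eq_clock:
  assumes v: "v_sol \<theta> n > 0" and y: "y \<ge> 0" and N0: "N \<omega> 0 = 0"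
    and eq: "\<forall>k\<in>{bcut (v_sol \<theta> n)..n}. N \<omega> (level n (lam (v_sol \<theta> n)) k) -
      N \<omega> (level n (lam (v_sol \<theta> n)) (Suc k)) = real (cut_counts n \<omega> k)"
  shows "cut_path n (cut_counts n \<omega>) y = N \<omega> (clock n y)"
proof -
  let ?v = "v_sol \<theta> n"
  let ?b = "bcut ?v" and ?U = "level n (lam ?v)"
  let ?K = "{k. k \<in> {?b..n} \<and> jump_time ?v k \<le> y}"
  have r: "lam ?v k \<ge> 0" for k by (rule lam_nonneg)
  have U: "?U k = (\<Sum>j\<in>{k..n}. lam ?v j)" for k by (simp add: level_def[OF r])
  show ?thesis
  proof (cases "?K = {}")
    case True
    have "cut_path n (cut_counts n \<omega>) y = (\<Sum>k\<in>?K. real (cut_counts n \<omega> k))"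
      using y by (simp add: cut_path_def)
    moreover have "clock n y = 0" unfolding clock_def True by simp
    ultimately show ?thesis unfolding True using N0 by simp
  next
    case False
    define m where "m = Min ?K"
    have fin: "finite ?K" by simp
    have m: "m \<in> ?K" unfolding m_def using fin False by (rule Min_in)
    have K: "?K = {m..n}"
    proof (intro equalityI subsetI)
      fix k assume "k \<in> ?K"
      then show "k \<in> {m..n}" using Min_le[OF fin, of k] by (simp add: m_def)
    next
      fix k assume "k \<in> {m..n}"
      then show "k \<in> ?K" using m jump_time_antimono[OF v, of m k] by auto
    qed
    have "cut_path n (cut_counts n \<omega>) y = (\<Sum>k\<in>?K. real (cut_counts n \<omega> k))"
      using y by (simp add: cut_path_def)
    also have "\<dots> = (\<Sum>k\<in>{m..n}. real (cut_counts n \<omega> k))" unfolding K ..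
    also have "\<dots> = (\<Sum>k\<in>{m..n}. - (N \<omega> (?U (Suc k)) - N \<omega> (?U k)))"
    proof (rule sum.cong[OF refl])
      fix k assume "k \<in> {m..n}"
      then have "k \<in> {?b..n}" using m by auto
      then have "N \<omega> (?U k) - N \<omega> (?U (Suc k)) = real (cut_counts n \<omega> k)" using eq by blast
      then show "real (cut_counts n \<omega> k) = - (N \<omega> (?U (Suc k)) - N \<omega> (?U k))" by linarith
    qed
    also have "\<dots> = N \<omega> (?U m) - N \<omega> (?U (Suc n))"
      unfolding sum_negf using m by (subst sum_Suc_diff) auto
    also have "?U (Suc n) = 0" by (simp add: U)
    also have "?U m = clock n y" unfolding clock_def K by (simp add: U)
    finally show ?thesis using N0 by simp
  qed
qed

text \<open>Whatever continuations are chosen, on \<open>[0, T]\<close> they eventually equal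
  \<open>N\<close> read by the clock, because the visible times exhaust the half line.\<close>

lemma extensions_converge:
  assumes w: "\<omega> \<in> space M" and N0: "N \<omega> 0 = 0" and int: "\<forall>t\<ge>0. N \<omega> t \<in> \<int>"
    and eq: "\<And>n. \<forall>k\<in>{bcut (v_sol \<theta> n)..n}. N \<omega> (level n (lam (v_sol \<theta> n)) k) -
      N \<omega> (level n (lam (v_sol \<theta> n)) (Suc k)) = real (cut_counts n \<omega> k)"
    and x: "\<And>n. x n \<in> extensions n (cut_counts n \<omega>)"
  shows "skorokhod_converges x (N \<omega>)"
proof (rule skorokhod_converges_random_time[where L = clock])
  show "N \<omega> \<in> cadlag" by (rule path_cadlag[OF w])
  show "N \<omega> t \<in> \<int>" if "t \<ge> 0" for t using int that by blast
  show "0 \<le> clock n y" for n y unfolding clock_def by (intro sum_nonneg lam_nonneg)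
  show "clock n y \<le> clock n z" if "y \<le> z" for n y z
    unfolding clock_def using that by (intro sum_mono2) (auto simp: lam_nonneg)
  show "\<exists>\<sigma>. \<forall>y. s \<le> clock n y \<longleftrightarrow> \<sigma> \<le> y" if "0 < s" "s \<le> clock n z" for n s z
    using that unfolding clock_def by (intro step_function_level_set lam_nonneg) auto
  show "(\<lambda>n. clock n y) \<longlonglongrightarrow> y" if "y \<ge> 0" for y by (rule clock_tendsto[OF that])
  fix T :: real
  show "\<forall>\<^sub>F n in sequentially. \<forall>y\<in>{0..T}. x n y = N \<omega> (clock n y)"
    using eventually_visible(4)[of T] eventually_visible(1)
  proof eventually_elim
    case (elim n)
    show ?case
    proof
      fix y assume y: "y \<in> {0..T}"
      then have "x n y = cut_path n (cut_counts n \<omega>) y" using x[of n] elim(1) by (auto simp: extensions_def)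
      also have "\<dots> = N \<omega> (clock n y)" using y elim(2) by (intro cut_path_eq_clock N0 eq) auto
      finally show "x n y = N \<omega> (clock n y)" .
    qed
  qed
qed

text \<open>\<open>F n c\<close> is the supremum of the functional given the long counts. It
  dominates the value at the true process and, under the coupling, tends to
  \<open>f (N \<omega>)\<close>, since even nearly maximizing continuations converge to
  \<open>N \<omega>\<close>.\<close>

lemma upper_bound:
  fixes f :: "(real \<Rightarrow> real) \<Rightarrow> real"
  assumes f: "continuous_map skorokhod euclideanreal f" and B: "\<And>x. x \<in> cadlag \<Longrightarrow> \<bar>f x\<bar> \<le> B" and e: "e > 0"
  shows "\<forall>\<^sub>F n in sequentially.
    (\<integral>x. f x \<partial>distr (weighted_perm_measure \<theta> n) (borel_of skorokhod) (P_proc \<alpha> \<theta> n)) <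
    (\<integral>x. f x \<partial>distr M (borel_of skorokhod) N) + e"
proof -
  define F where "F n c = (SUP x\<in>extensions n c. f x)" for n c
  have sub: "extensions n c \<subseteq> cadlag" for n c by (auto simp: extensions_def)
  have ne: "extensions n c \<noteq> {}" for n c using cut_path_in_extensions by blast
  have bdd: "bdd_above (f ` extensions n c)" for n c
    using sub[of n c] B by (intro bdd_aboveI2[where M = B]) (auto simp: abs_le_iff)
  have F_upper: "f x \<le> F n c" if "x \<in> extensions n c" for x n c
    unfolding F_def by (rule cSUP_upper[OF that bdd])
  have F_B: "\<bar>F n c\<bar> \<le> B" for n c
  proof -
    have "F n c \<le> B" unfolding F_def using sub B by (intro cSUP_least ne) (auto simp: abs_le_iff)
    moreover have "- B \<le> f (cut_path n c)" using B[of "cut_path n c"] cut_path_in_extensions sub by (force simp: abs_le_iff)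
    then have "- B \<le> F n c" using F_upper[OF cut_path_in_extensions, of n c] by linarith
    ultimately show ?thesis by simp
  qed
  have r: "lam (v_sol \<theta> n) k \<ge> 0" for n k by (rule lam_nonneg)
  have AE_lim: "AE \<omega> in M. (\<lambda>n. F n (cut_counts n \<omega>)) \<longlonglongrightarrow> f (N \<omega>)"
  proof -
    have "AE \<omega> in M. \<forall>n. \<forall>k\<in>{bcut (v_sol \<theta> n)..n}. N \<omega> (level n (lam (v_sol \<theta> n)) k) -
      N \<omega> (level n (lam (v_sol \<theta> n)) (Suc k)) = real (cut_counts n \<omega> k)"
      unfolding AE_all_countable cut_counts_def by (intro allI counts_eq r)
    then show ?thesis using paths_integer_valued AE_space
    proof eventually_elim
      case (elim \<omega>)
      \<comment> \<open>The supremum need not be attained, so each \<open>n\<close> gets a path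
        within \<open>1 / (n + 1)\<close> of it.\<close>
      have "\<exists>x\<in>extensions n (cut_counts n \<omega>). F n (cut_counts n \<omega>) - 1 / real (Suc n) < f x" for n
        using less_cSUP_iff[OF ne bdd, of "F n (cut_counts n \<omega>) - 1 / real (Suc n)" n "cut_counts n \<omega>"]
        unfolding F_def[symmetric] by simp
      then obtain x where x: "\<And>n. x n \<in> extensions n (cut_counts n \<omega>)"
          "\<And>n. F n (cut_counts n \<omega>) - 1 / real (Suc n) < f (x n)" by metis
      have "skorokhod_converges x (N \<omega>)"
        using elim x(1) by (intro extensions_converge) auto
      then have lim: "(\<lambda>n. f (x n)) \<longlonglongrightarrow> f (N \<omega>)"
        using x(1) sub path_cadlag[OF elim(3)] by (intro continuous_map_skorokhod_tendsto[OF f]) auto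
      have lim': "(\<lambda>n. f (x n) + 1 / real (Suc n)) \<longlonglongrightarrow> f (N \<omega>)"
        using tendsto_add[OF lim LIMSEQ_Suc[OF lim_1_over_n]] by simp
      have "\<forall>\<^sub>F n in sequentially. f (x n) \<le> F n (cut_counts n \<omega>)"
        by (intro always_eventually allI F_upper x)
      moreover have "F n (cut_counts n \<omega>) \<le> f (x n) + 1 / real (Suc n)" for n
        using x(2)[of n] by linarith
      then have "\<forall>\<^sub>F n in sequentially. F n (cut_counts n \<omega>) \<le> f (x n) + 1 / real (Suc n)"
        by (intro always_eventually allI)
      ultimately show ?case by (rule real_tendsto_sandwich[OF _ _ lim lim'])
    qed
  qed
  have meas_f: "f \<in> borel_measurable (borel_of skorokhod)"
    by (rule continuous_map_skorokhod_measurable[OF f])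
  have meas_fN: "(\<lambda>\<omega>. f (N \<omega>)) \<in> borel_measurable M"
    by (rule measurable_compose[OF measurable_path meas_f])
  \<comment> \<open>Measurability comes from the countable range of the counts, not from the form of
    the supremum.\<close>
  have meas_F: "(\<lambda>\<omega>. F n (cut_counts n \<omega>)) \<in> borel_measurable M" for n
    unfolding cut_counts_def by (rule expectation_counts(1)[OF r])
  have "(\<lambda>n. \<integral>\<omega>. F n (cut_counts n \<omega>) \<partial>M) \<longlonglongrightarrow> (\<integral>\<omega>. f (N \<omega>) \<partial>M)"
    by (rule integral_dominated_convergence[where w = "\<lambda>_. B"])
      (use meas_fN meas_F AE_lim F_B in auto)
  also have "(\<integral>\<omega>. f (N \<omega>) \<partial>M) = (\<integral>x. f x \<partial>distr M (borel_of skorokhod) N)"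
    by (rule integral_distr[symmetric, OF measurable_path meas_f])
  also have "(\<lambda>n. \<integral>\<omega>. F n (cut_counts n \<omega>) \<partial>M) =
      (\<lambda>n. measure_pmf.expectation (long_pmf (v_sol \<theta> n) {bcut (v_sol \<theta> n)..n}) (F n))"
    unfolding cut_counts_def long_pmf_def by (intro ext expectation_counts(2) r)
  finally have lim1: "(\<lambda>n. measure_pmf.expectation (long_pmf (v_sol \<theta> n) {bcut (v_sol \<theta> n)..n}) (F n))
      \<longlonglongrightarrow> (\<integral>x. f x \<partial>distr M (borel_of skorokhod) N)" .
  define W where "W n = (\<Sum>\<sigma> | \<sigma> permutes {1..n}. perm_weight \<theta> n \<sigma> *
      F n (\<lambda>k. if bcut (v_sol \<theta> n) \<le> k then cycle_count n \<sigma> k else 0)) / (norm_const \<theta> n * fact n)" for n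
  \<comment> \<open>Here the actual cycle counts replace the independent ones; that the functional
    varies with \<open>n\<close> is covered by convergence in total variation.\<close>
  have "W \<longlonglongrightarrow> (\<integral>x. f x \<partial>distr M (borel_of skorokhod) N)"
    using tendsto_add[OF conditioned_counts_limit(1)[of F, OF F_B] lim1] by (simp add: W_def[abs_def])
  then have "\<forall>\<^sub>F n in sequentially. W n < (\<integral>x. f x \<partial>distr M (borel_of skorokhod) N) + e"
    using e by (intro order_tendstoD(2)) auto
  then show ?thesis using conditioned_counts_limit(2)[of F, OF F_B] eventually_visible(1)
  proof eventually_elim
    case (elim n)
    let ?S = "{\<sigma>. \<sigma> permutes {1..n}}" and ?c = "\<lambda>\<sigma> k. if bcut (v_sol \<theta> n) \<le> k then cycle_count n \<sigma> k else 0"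
    have fin: "finite ?S" by (simp add: finite_permutations)
    have pw: "perm_weight \<theta> n \<sigma> \<ge> 0" for \<sigma>
      unfolding perm_weight_def by (intro prod_nonneg) (auto simp: \<theta>_nonneg)
    have w0: "1 / (norm_const \<theta> n * fact n) * perm_weight \<theta> n \<sigma> \<ge> 0" for \<sigma>
      using elim(2) pw by simp
    have ext: "P_proc \<alpha> \<theta> n \<sigma> \<in> extensions n (?c \<sigma>)" if "\<sigma> \<in> ?S" for \<sigma>
      using elim(3) that by (intro P_proc_in_extensions) auto
    have meas: "P_proc \<alpha> \<theta> n \<in> weighted_perm_measure \<theta> n \<rightarrow>\<^sub>M borel_of skorokhod"
      unfolding weighted_perm_measure_def measurable_point_measure_eq1
      using ext sub by (auto simp: borel_of_def space_measure_of_conv topspace_skorokhod)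
    have "(\<integral>x. f x \<partial>distr (weighted_perm_measure \<theta> n) (borel_of skorokhod) (P_proc \<alpha> \<theta> n)) =
        (\<integral>\<sigma>. f (P_proc \<alpha> \<theta> n \<sigma>) \<partial>weighted_perm_measure \<theta> n)"
      by (rule integral_distr[OF meas meas_f])
    also have "\<dots> = (\<Sum>\<sigma>\<in>?S. (1 / (norm_const \<theta> n * fact n) * perm_weight \<theta> n \<sigma>) *\<^sub>R f (P_proc \<alpha> \<theta> n \<sigma>))"
      unfolding weighted_perm_measure_def by (rule lebesgue_integral_point_measure_finite[OF fin w0])
    also have "\<dots> \<le> (\<Sum>\<sigma>\<in>?S. (1 / (norm_const \<theta> n * fact n) * perm_weight \<theta> n \<sigma>) * F n (?c \<sigma>))"
      unfolding real_scaleR_def by (intro sum_mono mult_left_mono F_upper ext w0)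
    also have "\<dots> = W n" unfolding W_def by (simp add: sum_divide_distrib mult_ac)
    finally show ?case using elim(1) by linarith
  qed
qed

end

theorem theorem1p3:
  fixes \<alpha> :: real and \<theta> :: "nat \<Rightarrow> real"
    and M :: "'w measure" and N :: "'w \<Rightarrow> real \<Rightarrow> real"
  assumes "\<alpha> > 0"
    and "\<forall>k\<ge>1. \<theta> k \<ge> 0"
    and "\<theta> \<sim>[at_top] (\<lambda>k. real k powr \<alpha>)"
    and "poisson_process 1 M N"
  shows "weak_conv_in skorokhod
           (\<lambda>n. distr (weighted_perm_measure \<theta> n) (borel_of skorokhod) (P_proc \<alpha> \<theta> n))
           (distr M (borel_of skorokhod) N)"
  unfolding weak_conv_in_def
proof (intro allI impI)
  fix f :: "(real \<Rightarrow> real) \<Rightarrow> real"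
  assume f: "continuous_map skorokhod euclideanreal f \<and> bounded (f ` topspace skorokhod)"
  interpret prob_space M using assms(4) by (simp add: poisson_process_def)
  interpret long_cycles \<alpha> \<theta> M N
    by unfold_locales (use assms in auto)
  let ?I = "\<lambda>f n. \<integral>x. f x \<partial>distr (weighted_perm_measure \<theta> n) (borel_of skorokhod) (P_proc \<alpha> \<theta> n)"
    and ?J = "\<lambda>f. \<integral>x. f x \<partial>distr M (borel_of skorokhod) N"
  obtain B where B: "\<And>x. x \<in> cadlag \<Longrightarrow> \<bar>f x\<bar> \<le> B"
    using f unfolding bounded_iff topspace_skorokhod by auto
  \<comment> \<open>The upper bound for the negated functional is the lower bound for
    \<open>f\<close>.\<close>
  have minus: "continuous_map skorokhod euclideanreal (\<lambda>x. - f x)"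
    using f by (intro continuous_map_minus) auto
  show "(\<lambda>n. ?I f n) \<longlonglongrightarrow> ?J f"
  proof (rule tendstoI)
    fix e :: real assume e: "e > 0"
    have "\<forall>\<^sub>F n in sequentially. ?I f n < ?J f + e"
      using f by (intro upper_bound[where B = B] B e) auto
    moreover have "\<forall>\<^sub>F n in sequentially. ?I (\<lambda>x. - f x) n < ?J (\<lambda>x. - f x) + e"
      using B by (intro upper_bound[where B = B] minus e) auto
    ultimately show "\<forall>\<^sub>F n in sequentially. dist (?I f n) (?J f) < e"
      by eventually_elim (simp add: dist_real_def abs_less_iff)
  qed
qed

end
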